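(* Assume the standing assumptions (A0)–(A3) described in the context, that $r>-1$, and that the moment condition (M$_p$) holds for some $p>\max\{2,1+r\}$. Let $M_1:=\max_{\tau_0\le t<\tau_1}X_t$. Then for any $\varepsilon>0$, for all $x$ sufficiently large, $$x^{-1-r}(\log x)^{-\varepsilon}\le\mathbb{P}[M_1\ge x]\le x^{-1-r}(\log x)^{1+\varepsilon}.$$ In particular $\mathbb{E}[M_1^{1+r}]=\infty$ but $\mathbb{E}[M_1^{1+r-\varepsilon}]<\infty$ for every $\varepsilon>0$.
   Context: $\mathbb{N}=\{1,2,\dots\}$. (A0): $\mathbb{S}$ is a locally finite (every bounded set meets it in finitely many points), unbounded subset of $[0,\infty)$ with $0\in\mathbb{S}$; $(X_t)_{t\in\mathbb{N}}$ is an $\mathbb{S}$-valued process adapted to a filtration $(\mathcal{F}_t)_{t\in\mathbb{N}}$ with $\mathbb{P}[X_1=0]=1$. (A1): for each $x,y\in\mathbb{S}$ there exist $m(x,y)\in\mathbb{N}$, $\varphi(x,y)>0$ with $\mathbb{P}[X_{t+m(X_t,y)}=y\mid\mathcal{F}_t]\ge\varphi(X_t,y)$ a.s. for all $t$. Write $\Delta_t:=X_{t+1}-X_t$. (A2): there are $c\in\mathbb{R}$, $s^2\in(0,\infty)$ with, as $X_t\to\infty$, $\mathbb{E}[\Delta_t\mid\mathcal{F}_t]=cX_t^{-1}+o(X_t^{-1}(\log X_t)^{-1})$ and $\mathbb{E}[\Delta_t^2\mid\mathcal{F}_t]=s^2+o((\log X_t)^{-1})$ a.s., where the implicit constants in $o(\cdot)$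 are non-random and uniform in $t$ and in the sample point. Set $r:=-2c/s^2$. Excursions: $\tau_0:=1$, $\tau_n:=\min\{t>\tau_{n-1}:X_t=0\}$ ($\min\emptyset=\infty$), $\eta_n:=\tau_n-\tau_{n-1}$, $\mathcal{E}_n:=(X_t)_{\tau_{n-1}\le t\le\tau_n-1}$, $N:=\min\{n\in\mathbb{N}:\tau_n=\infty\}$. (A3): (a) on $\{N=\infty\}$, $(\mathcal{E}_n)_{n\in\mathbb{N}}$ is i.i.d.; (b) $\mathbb{P}[\eta_{n+1}<\infty\mid\tau_n<\infty]=\mathbb{P}[\eta_1<\infty]$ for all $n$. (M$_p$): there exist $\delta>0$, $C<\infty$ with $\mathbb{E}[|\Delta_t|^p\mid\mathcal{F}_t]\le C(1+X_t)^{p-2-\delta}$ a.s. for all $t$.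
   Formalization: In the final moment claim, for ε ≥ 1+r (exponent 1+r−ε ≤ 0) the event M_1 = 0 is taken to contribute 0 (convention 0^q = 0); with the literal reading E[M_1^{1+r−ε}] would be infinite for ε > 1+r whenever P[M_1 = 0] > 0. *)

theory Defs
  imports "HOL-Probability.Probability"
begin

primrec exc_time :: "(nat \<Rightarrow> 'a \<Rightarrow> real) \<Rightarrow> nat \<Rightarrow> 'a \<Rightarrow> enat" where
  "exc_time X 0 \<omega> = enat 1"
| "exc_time X (Suc n) \<omega> =
     (case exc_time X n \<omega> of
        enat s \<Rightarrow> (if \<exists>t>s. X t \<omega> = 0 then enat (LEAST t. s < t \<and> X t \<omega> = 0) else \<infinity>)
      | \<infinity> \<Rightarrow> \<infinity>)"

definition exc_len :: "(nat \<Rightarrow> 'a \<Rightarrow> real) \<Rightarrow> nat \<Rightarrow> 'a \<Rightarrow> enat" where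
  "exc_len X n \<omega> = exc_time X n \<omega> - exc_time X (n - 1) \<omega>"

text \<open>The n-th excursion (n >= 1): the path (X_t) for tau_(n-1) <= t <= tau_n - 1, as a list;
  it is only meaningful when tau_n is finite (default: empty list).\<close>
definition excursion :: "(nat \<Rightarrow> 'a \<Rightarrow> real) \<Rightarrow> nat \<Rightarrow> 'a \<Rightarrow> real list" where
  "excursion X n \<omega> =
     (case (exc_time X (n - 1) \<omega>, exc_time X n \<omega>) of
        (enat a, enat b) \<Rightarrow> map (\<lambda>t. X t \<omega>) [a..<b]
      | _ \<Rightarrow> [])"

definition num_exc :: "(nat \<Rightarrow> 'a \<Rightarrow> real) \<Rightarrow> 'a \<Rightarrow> enat" where
  "num_exc X \<omega> = (if \<exists>n. exc_time X n \<omega> = \<infinity> then enat (LEAST n. exc_time X n \<omega> = \<infinity>) else \<infinity>)"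

text \<open>M_1 = max over tau_0 <= t < tau_1 of X_t (a supremum in the extended reals,
  which is infinite only if tau_1 is infinite and the path is unbounded).\<close>
definition first_exc_max :: "(nat \<Rightarrow> 'a \<Rightarrow> real) \<Rightarrow> 'a \<Rightarrow> ereal" where
  "first_exc_max X \<omega> = (SUP t\<in>{t. 1 \<le> t \<and> enat t < exc_time X 1 \<omega>}. ereal (X t \<omega>))"

end

theory Submission
  imports Defs "HOL-Real_Asymp.Real_Asymp"
begin

text \<open>
  Write a = 1 + r and f(x) = x^a (ln x)^g. Under (A2) and the moment condition a Taylor expansion shows
  that the conditional drift of f(X) at a large state x is (s2/2) a g x^(a-2) (ln x)^(g-1) to leading
  order, so f(X) is a supermartingale far from 0 for g < 0 and a submartingale for g > 0.

  Upper bound: take g = -1 and stop at the return to 0 or at the first passage above R. The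
  expected value of f at the stopping time is bounded, since the drift can be positive only in a bounded
  set, in which the process spends a finite expected time before returning to 0; Markov's inequality
  gives the bound. In particular the first excursion is finite almost surely.

  Lower bound: take g > 0 small and clamp f between a large level A and 2R. The clamped function is a
  submartingale up to passage above R, vanishes at 0 after subtracting f(A), and is at most f(2R), so
  the passage probability is at least a constant over f(2R). The constant is positive because
  excursions are identically distributed and the process reaches every state.
\<close>

section \<open>Lyapunov functions\<close>

definition powlog :: "real \<Rightarrow> real \<Rightarrow> real \<Rightarrow> real" where
  "powlog b g x = x powr b * ln x powr g"

definition powlog' :: "real \<Rightarrow> real \<Rightarrow> real \<Rightarrow> real" where
  "powlog' b g x = b * powlog (b - 1) g x + g * powlog (b - 1) (g - 1) x"

definition powlog'' :: "real \<Rightarrow> real \<Rightarrow> real \<Rightarrow> real" where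
  "powlog'' b g x = b * powlog' (b - 1) g x + g * powlog' (b - 1) (g - 1) x"

definition powlog''' :: "real \<Rightarrow> real \<Rightarrow> real \<Rightarrow> real" where
  "powlog''' b g x = b * powlog'' (b - 1) g x + g * powlog'' (b - 1) (g - 1) x"

lemma powlog_measurable [measurable]: "powlog b g \<in> borel_measurable borel"
  unfolding powlog_def by measurable

lemma powlog'_measurable [measurable]: "powlog' b g \<in> borel_measurable borel"
  unfolding powlog'_def by measurable

lemma powlog''_measurable [measurable]: "powlog'' b g \<in> borel_measurable borel"
  unfolding powlog''_def by measurable

lemma DERIV_powlog:
  assumes "x > 1"
  shows "(powlog b g has_real_derivative powlog' b g x) (at x)"
proof -
  have *: "ln x > 0" "x > 0" using assms by auto
  show ?thesis
    unfolding powlog_def powlog'_def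
    by (rule derivative_eq_intros refl * | use * in \<open>simp add: powr_diff field_simps\<close>)+
qed

lemma DERIV_powlog':
  assumes "x > 1"
  shows "(powlog' b g has_real_derivative powlog'' b g x) (at x)"
  unfolding powlog'_def[of b g, abs_def] powlog''_def
  by (auto intro!: derivative_eq_intros DERIV_powlog assms)

lemma DERIV_powlog'':
  assumes "x > 1"
  shows "(powlog'' b g has_real_derivative powlog''' b g x) (at x)"
  unfolding powlog''_def[of b g, abs_def] powlog'''_def
  by (auto intro!: derivative_eq_intros DERIV_powlog' assms)

lemma powlog_bigo:
  assumes "k > 0"
  shows "powlog b g \<in> O(\<lambda>x. x powr (b + k))"
  unfolding powlog_def using assms by real_asymp

lemma powlog'_bigo:
  assumes "k > 0"
  shows "powlog' b g \<in> O(\<lambda>x. x powr (b - 1 + k))"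
  unfolding powlog'_def[abs_def]
  by (intro sum_in_bigo landau_o.big.cmult_in_iff' | simp add: powlog_bigo assms)+

lemma powlog''_bigo:
  assumes "k > 0"
  shows "powlog'' b g \<in> O(\<lambda>x. x powr (b - 2 + k))"
  unfolding powlog''_def[abs_def]
  using powlog'_bigo[OF assms, of "b - 1"]
  by (intro sum_in_bigo) (auto)

lemma powlog'''_bigo:
  assumes "k > 0"
  shows "powlog''' b g \<in> O(\<lambda>x. x powr (b - 3 + k))"
  unfolding powlog'''_def[abs_def]
  using powlog''_bigo[OF assms, of "b - 1"]
  by (intro sum_in_bigo) (auto)

lemma powlog_taylor:
  assumes "x > 2" "\<bar>d\<bar> \<le> x / 2"
  shows "\<exists>t. x / 2 \<le> t \<and> t \<le> 2 * x \<and>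
    powlog b g (x + d) = powlog b g x + powlog' b g x * d + powlog'' b g x / 2 * d\<^sup>2 + powlog''' b g t / 6 * d ^ 3"
proof (cases "d = 0")
  case True
  then show ?thesis using assms by (intro exI[of _ x]) auto
next
  case False
  define D where "D = (\<lambda>n::nat. if n = 0 then powlog b g else if n = 1 then powlog' b g
     else if n = 2 then powlog'' b g else powlog''' b g)"
  have "\<exists>t. (if x + d < x then x + d < t \<and> t < x else x < t \<and> t < x + d) \<and>
     powlog b g (x + d) = (\<Sum>m<3. D m x / fact m * (x + d - x) ^ m) + D 3 t / fact 3 * (x + d - x) ^ 3"
  proof (rule Taylor[where a = "x / 2" and b = "2 * x"])
    show "\<forall>m t. m < 3 \<and> x / 2 \<le> t \<and> t \<le> 2 * x \<longrightarrow> (D m has_real_derivative D (Suc m) t) (at t)"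
    proof (intro allI impI, elim conjE)
      fix m :: nat and t assume "m < 3" "x / 2 \<le> t"
      then have "t > 1" "m = 0 \<or> m = 1 \<or> m = 2" using assms by auto
      then show "(D m has_real_derivative D (Suc m) t) (at t)"
        by (auto simp: D_def DERIV_powlog DERIV_powlog' DERIV_powlog'')
    qed
  qed (use assms False in \<open>auto simp: D_def abs_if split: if_splits\<close>)
  then obtain t where t: "if x + d < x then x + d < t \<and> t < x else x < t \<and> t < x + d"
    "powlog b g (x + d) = (\<Sum>m<3. D m x / fact m * (x + d - x) ^ m) + D 3 t / fact 3 * (x + d - x) ^ 3"
    by auto
  show ?thesis
    by (rule exI[of _ t]) (use t assms in \<open>auto simp: D_def abs_if eval_nat_numeral split: if_splits\<close>)
qed

lemma powlog_mono:
  assumes "a > 0"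
  shows "\<exists>b\<ge>3. \<forall>x y. b \<le> x \<longrightarrow> x \<le> y \<longrightarrow> powlog a g x \<le> powlog a g y"
proof (intro exI conjI allI impI)
  define b where "b = max 3 (exp (\<bar>g\<bar> / a))"
  show "b \<ge> 3" by (simp add: b_def)
  fix x y assume xy: "b \<le> x" "x \<le> y"
  show "powlog a g x \<le> powlog a g y"
  proof (rule DERIV_nonneg_imp_nondecreasing[OF xy(2)])
    fix t assume t: "x \<le> t" "t \<le> y"
    have t1: "t > 1" "exp (\<bar>g\<bar> / a) \<le> t" using t xy by (auto simp: b_def)
    then have "\<bar>g\<bar> / a \<le> ln t" by (metis exp_gt_zero ln_exp ln_le_cancel_iff order_less_le_trans)
    then have "\<bar>g\<bar> \<le> a * ln t" using assms by (simp add: field_simps)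
    then have "0 \<le> a * ln t + g" by linarith
    moreover have "powlog' a g t = t powr (a - 1) * ln t powr (g - 1) * (a * ln t + g)"
      using t1 by (simp add: powlog'_def powlog_def powr_diff field_simps)
    ultimately have "0 \<le> powlog' a g t" by simp
    then show "\<exists>y. (powlog a g has_real_derivative y) (at t) \<and> 0 \<le> y"
      using DERIV_powlog[OF t1(1)] by blast
  qed
qed

lemma abs_powr_le_powr_of_half_less:
  fixes x d j p :: real
  assumes "0 < x" "x / 2 < \<bar>d\<bar>" "j \<le> p"
  shows "\<bar>d\<bar> powr j \<le> 2 powr (p - j) * x powr (j - p) * \<bar>d\<bar> powr p"
proof -
  have "\<bar>d\<bar> powr j = \<bar>d\<bar> powr (j - p) * \<bar>d\<bar> powr p"
    by (simp flip: powr_add)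
  also have "\<dots> \<le> (x / 2) powr (j - p) * \<bar>d\<bar> powr p"
    using assms by (intro mult_right_mono powr_mono2') auto
  also have "(x / 2) powr (j - p) = 2 powr (p - j) * x powr (j - p)"
    using assms powr_minus_divide[of 2 "j - p"] by (simp add: powr_divide)
  finally show ?thesis .
qed

lemma abs_cube_le:
  fixes x d k p :: real
  assumes "0 < x" "\<bar>d\<bar> \<le> x" "2 \<le> p"
  shows "\<bar>d\<bar> ^ 3 \<le> x powr (1 - k) * d\<^sup>2 + x powr (1 - (1 - k) * (p - 2)) * \<bar>d\<bar> powr p"
proof (cases "\<bar>d\<bar> \<le> x powr (1 - k)")
  case True
  have "\<bar>d\<bar> ^ 3 = \<bar>d\<bar> * d\<^sup>2" by (simp add: eval_nat_numeral)
  also have "\<dots> \<le> x powr (1 - k) * d\<^sup>2" using True by (intro mult_right_mono) auto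
  finally show ?thesis by (simp add: add_increasing2)
next
  case False
  then have d: "\<bar>d\<bar> > 0" by (metis abs_ge_zero abs_of_nonneg not_le powr_ge_zero zero_less_abs_iff less_le_trans order_le_less)
  have "\<bar>d\<bar> ^ 3 = \<bar>d\<bar> * \<bar>d\<bar> powr 2" using d by (simp add: eval_nat_numeral)
  also have "\<bar>d\<bar> powr 2 = \<bar>d\<bar> powr (- (p - 2)) * \<bar>d\<bar> powr p" by (simp flip: powr_add)
  also have "\<bar>d\<bar> powr (- (p - 2)) \<le> (x powr (1 - k)) powr (- (p - 2))"
    using False assms by (intro powr_mono2') auto
  also have "\<bar>d\<bar> * ((x powr (1 - k)) powr (- (p - 2)) * \<bar>d\<bar> powr p)
      \<le> x * ((x powr (1 - k)) powr (- (p - 2)) * \<bar>d\<bar> powr p)"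
    using assms by (intro mult_right_mono) auto
  also have "\<dots> = x powr (1 - (1 - k) * (p - 2)) * \<bar>d\<bar> powr p"
  proof -
    have "x * (x powr (1 - k)) powr (- (p - 2)) = x powr 1 * x powr ((1 - k) * (- (p - 2)))"
      using assms by (simp add: powr_powr)
    also have "\<dots> = x powr (1 - (1 - k) * (p - 2))"
      unfolding powr_add[symmetric] by (simp add: algebra_simps)
    finally show ?thesis by (simp flip: mult.assoc)
  qed
  finally show ?thesis using d by (simp add: add_increasing mult_left_mono mult_right_mono)
qed

lemma powlog_increment:
  assumes "0 < \<delta>" "2 < p"
  obtains K \<rho> x1 where "0 \<le> K" "0 < \<rho>" "4 \<le> x1"
    "\<And>x d. x1 \<le> x \<Longrightarrow> \<bar>d\<bar> \<le> x / 2 \<Longrightarrow>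
       \<bar>powlog a g (x + d) - powlog a g x - powlog' a g x * d - powlog'' a g x / 2 * d\<^sup>2\<bar>
         \<le> K * (x powr (a - 2 - \<rho>) * d\<^sup>2 + x powr (a - p + \<delta> / 2) * \<bar>d\<bar> powr p)"
    "\<And>x d. x1 \<le> x \<Longrightarrow> x / 2 < \<bar>d\<bar> \<Longrightarrow>
       powlog a g x + \<bar>powlog' a g x * d\<bar> + \<bar>powlog'' a g x / 2 * d\<^sup>2\<bar>
         \<le> K * x powr (a - p + \<delta> / 2) * \<bar>d\<bar> powr p"
proof -
  define \<kappa> where "\<kappa> = min (1 / 2) (\<delta> / (4 * (p - 2)))"
  define k where "k = min (\<kappa> / 2) (\<delta> / 4)"
  have \<kappa>: "\<kappa> > 0" "\<kappa> * (p - 2) \<le> \<delta> / 4"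
    using assms by (auto simp: \<kappa>_def min_def field_simps)
  have k: "k > 0" "k \<le> \<kappa> / 2" "k \<le> \<delta> / 4" using \<kappa> assms by (auto simp: k_def)
  obtain c0 where c0: "c0 > 0" "eventually (\<lambda>x. norm (powlog a g x) \<le> c0 * norm (x powr (a + k))) at_top"
    using powlog_bigo[OF k(1), of a g] by (elim landau_o.bigE)
  obtain c1 where c1: "c1 > 0" "eventually (\<lambda>x. norm (powlog' a g x) \<le> c1 * norm (x powr (a - 1 + k))) at_top"
    using powlog'_bigo[OF k(1), of a g] by (elim landau_o.bigE)
  obtain c2 where c2: "c2 > 0" "eventually (\<lambda>x. norm (powlog'' a g x) \<le> c2 * norm (x powr (a - 2 + k))) at_top"
    using powlog''_bigo[OF k(1), of a g] by (elim landau_o.bigE)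
  obtain c3 where c3: "c3 > 0" "eventually (\<lambda>x. norm (powlog''' a g x) \<le> c3 * norm (x powr (a - 3 + k))) at_top"
    using powlog'''_bigo[OF k(1), of a g] by (elim landau_o.bigE)
  from eventually_conj[OF c0(2) eventually_conj[OF c1(2) eventually_conj[OF c2(2) c3(2)]]]
  obtain x0 where x0: "\<And>x. x \<ge> x0 \<Longrightarrow> \<bar>powlog a g x\<bar> \<le> c0 * x powr (a + k)"
    "\<And>x. x \<ge> x0 \<Longrightarrow> \<bar>powlog' a g x\<bar> \<le> c1 * x powr (a - 1 + k)"
    "\<And>x. x \<ge> x0 \<Longrightarrow> \<bar>powlog'' a g x\<bar> \<le> c2 * x powr (a - 2 + k)"
    "\<And>x. x \<ge> x0 \<Longrightarrow> \<bar>powlog''' a g x\<bar> \<le> c3 * x powr (a - 3 + k)"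
    unfolding eventually_at_top_linorder by auto
  define x1 where "x1 = max 4 (2 * x0)"
  define q where "q = a - 3 + k"
  define K where "K = c3 * 2 powr \<bar>q\<bar> + 2 powr p * (c0 + c1 + c2)"
  have x1: "x \<ge> x0" "x / 2 \<ge> x0" "x \<ge> 4" if "x1 \<le> x" for x
    using that by (auto simp: x1_def)
  have K: "K \<ge> 0" "c3 * 2 powr \<bar>q\<bar> \<le> K" "2 powr p * (c0 + c1 + c2) \<le> K"
    using c0 c1 c2 c3 by (auto simp: K_def)
  show thesis
  proof (rule that[of K "\<kappa> / 2" x1])
    show "0 \<le> K" "0 < \<kappa> / 2" "4 \<le> x1" using K \<kappa> by (auto simp: x1_def)
  next
    fix x d assume x: "x1 \<le> x" and d: "\<bar>d\<bar> \<le> x / 2"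
    obtain t where t: "x / 2 \<le> t" "t \<le> 2 * x" and
      eq: "powlog a g (x + d) = powlog a g x + powlog' a g x * d + powlog'' a g x / 2 * d\<^sup>2 + powlog''' a g t / 6 * d ^ 3"
      using powlog_taylor[of x d a g] x1[OF x] d by auto
    have tq: "t powr q \<le> 2 powr \<bar>q\<bar> * x powr q"
    proof (cases "q \<ge> 0")
      case True
      have "t powr q \<le> (2 * x) powr q" using t True x1[OF x] by (intro powr_mono2) auto
      then show ?thesis using True x1[OF x] by (simp add: powr_mult)
    next
      case False
      have "t powr q \<le> (x / 2) powr q" using t False x1[OF x] by (intro powr_mono2') auto
      then show ?thesis using False x1[OF x] by (simp add: powr_divide powr_minus field_simps)
    qed
    have "\<bar>powlog a g (x + d) - powlog a g x - powlog' a g x * d - powlog'' a g x / 2 * d\<^sup>2\<bar>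
       = \<bar>powlog''' a g t\<bar> / 6 * \<bar>d\<bar> ^ 3"
      by (simp add: eq abs_mult power_abs)
    also have "\<dots> \<le> (c3 * t powr q) * \<bar>d\<bar> ^ 3"
      using x0(4)[of t] t x1[OF x] by (intro mult_right_mono) (auto simp: q_def)
    also have "\<dots> \<le> (c3 * (2 powr \<bar>q\<bar> * x powr q)) * \<bar>d\<bar> ^ 3"
      using tq c3 by (intro mult_right_mono mult_left_mono) auto
    also have "\<dots> \<le> (K * x powr q) * \<bar>d\<bar> ^ 3"
      using K by (intro mult_right_mono) (auto simp flip: mult.assoc intro!: mult_right_mono)
    also have "\<dots> \<le> (K * x powr q) * (x powr (1 - \<kappa>) * d\<^sup>2 + x powr (1 - (1 - \<kappa>) * (p - 2)) * \<bar>d\<bar> powr p)"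
      using K d x1[OF x] assms by (intro mult_left_mono abs_cube_le) auto
    also have "\<dots> = K * (x powr (q + (1 - \<kappa>)) * d\<^sup>2 + x powr (q + (1 - (1 - \<kappa>) * (p - 2))) * \<bar>d\<bar> powr p)"
      by (simp only: powr_add distrib_left mult_ac)
    also have "\<dots> \<le> K * (x powr (a - 2 - \<kappa> / 2) * d\<^sup>2 + x powr (a - p + \<delta> / 2) * \<bar>d\<bar> powr p)"
    proof -
      have "x powr (q + (1 - \<kappa>)) \<le> x powr (a - 2 - \<kappa> / 2)"
        using k x1[OF x] by (intro powr_mono) (auto simp: q_def)
      moreover have "x powr (q + (1 - (1 - \<kappa>) * (p - 2))) \<le> x powr (a - p + \<delta> / 2)"
        using k \<kappa> x1[OF x] by (intro powr_mono) (auto simp: q_def algebra_simps)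
      ultimately show ?thesis
        using K by (intro mult_left_mono[of _ _ K] add_mono mult_right_mono) auto
    qed
    finally show "\<bar>powlog a g (x + d) - powlog a g x - powlog' a g x * d - powlog'' a g x / 2 * d\<^sup>2\<bar>
         \<le> K * (x powr (a - 2 - \<kappa> / 2) * d\<^sup>2 + x powr (a - p + \<delta> / 2) * \<bar>d\<bar> powr p)" .
  next
    fix x d assume x: "x1 \<le> x" and d: "x / 2 < \<bar>d\<bar>"
    have d0: "\<bar>d\<bar> > 0" "x > 0" using d x1[OF x] by auto
    define W where "W = x powr (a - p + \<delta> / 2) * \<bar>d\<bar> powr p"
    have *: "x powr (a - j + k) * \<bar>d\<bar> powr j \<le> 2 powr p * W" if "0 \<le> j" "j \<le> 2" for j
    proof -
      have "x powr (a - j + k) * \<bar>d\<bar> powr j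
          \<le> x powr (a - j + k) * (2 powr (p - j) * x powr (j - p) * \<bar>d\<bar> powr p)"
        using that assms d d0 by (intro mult_left_mono abs_powr_le_powr_of_half_less) auto
      also have "\<dots> = 2 powr (p - j) * x powr (a - p + k) * \<bar>d\<bar> powr p"
        using d0 by (simp add: powr_add powr_diff field_simps)
      also have "\<dots> \<le> 2 powr p * x powr (a - p + \<delta> / 2) * \<bar>d\<bar> powr p"
        using that k assms x1[OF x] by (intro mult_right_mono mult_mono powr_mono) auto
      finally show ?thesis by (simp add: W_def mult.assoc)
    qed
    have "powlog a g x \<le> c0 * (x powr (a - 0 + k) * \<bar>d\<bar> powr 0)"
      using x0(1)[of x] x1[OF x] d0 by simp
    also have "\<dots> \<le> c0 * (2 powr p * W)" using c0 by (intro mult_left_mono *) auto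
    finally have 0: "powlog a g x \<le> c0 * (2 powr p * W)" .
    have "\<bar>powlog' a g x * d\<bar> \<le> (c1 * x powr (a - 1 + k)) * \<bar>d\<bar>"
      unfolding abs_mult using x0(2)[of x] x1[OF x] by (intro mult_right_mono) auto
    also have "\<dots> = c1 * (x powr (a - 1 + k) * \<bar>d\<bar> powr 1)" using d0 by simp
    also have "\<dots> \<le> c1 * (2 powr p * W)" using c1 by (intro mult_left_mono *) auto
    finally have 1: "\<bar>powlog' a g x * d\<bar> \<le> c1 * (2 powr p * W)" .
    have "\<bar>powlog'' a g x / 2 * d\<^sup>2\<bar> \<le> (c2 * x powr (a - 2 + k)) * d\<^sup>2"
      unfolding abs_mult abs_power2 using x0(3)[of x] x1[OF x] by (intro mult_right_mono) auto
    also have "\<dots> = c2 * (x powr (a - 2 + k) * \<bar>d\<bar> powr 2)" using d0 by simp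
    also have "\<dots> \<le> c2 * (2 powr p * W)" using c2 by (intro mult_left_mono *) auto
    finally have 2: "\<bar>powlog'' a g x / 2 * d\<^sup>2\<bar> \<le> c2 * (2 powr p * W)" .
    have "powlog a g x + \<bar>powlog' a g x * d\<bar> + \<bar>powlog'' a g x / 2 * d\<^sup>2\<bar> \<le> (2 powr p * (c0 + c1 + c2)) * W"
      using 0 1 2 by (simp add: algebra_simps)
    also have "\<dots> \<le> K * W" using K by (intro mult_right_mono) (auto simp: W_def)
    finally show "powlog a g x + \<bar>powlog' a g x * d\<bar> + \<bar>powlog'' a g x / 2 * d\<^sup>2\<bar>
         \<le> K * x powr (a - p + \<delta> / 2) * \<bar>d\<bar> powr p"
      by (simp add: W_def mult.assoc)
  qed
qed

lemma powlog_drift: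
  fixes a g s2 c K1 K2 \<rho> \<rho>' :: real
  assumes "0 < a" "g \<noteq> 0" "0 < s2" and c: "c = - (a - 1) * s2 / 2"
    and "0 < \<rho>" "0 < \<rho>'" and th: "\<theta> = - sgn g"
  shows "\<exists>e>0. eventually (\<lambda>x.
     \<theta> * powlog' a g x * (c / x) + \<bar>\<theta> * powlog' a g x\<bar> * (e / (x * ln x))
     + (\<theta> * (powlog'' a g x / 2) + K1 * x powr (a - 2 - \<rho>)) * s2
     + \<bar>\<theta> * (powlog'' a g x / 2) + K1 * x powr (a - 2 - \<rho>)\<bar> * (e / ln x)
     + K2 * x powr (a - 2 - \<rho>') \<le> 0) at_top"
proof -
  define C where "C = a + \<bar>a * (a - 1)\<bar> / 2"
  have C: "C > 0" using assms by (simp add: C_def add_pos_nonneg)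
  define e where "e = s2 * \<bar>g\<bar> * a / (4 * C)"
  have e: "e > 0" using assms C by (simp add: e_def)
  define \<Phi> where "\<Phi> = (\<lambda>x::real. s2 / 2 * (\<theta> * (g * a + g * (g - 1) / ln x)) + e * \<bar>a + g / ln x\<bar>
    + e * (\<bar>a * (a - 1) + g * (2 * a - 1) / ln x + g * (g - 1) / (ln x)\<^sup>2\<bar> / 2)
    + K1 * (x powr (-\<rho>) * ln x powr (1 - g)) * s2
    + \<bar>K1\<bar> * (x powr (-\<rho>) * ln x powr (1 - g)) * (e / ln x)
    + K2 * (x powr (-\<rho>') * ln x powr (1 - g)))"
  have l1: "((\<lambda>x::real. k / ln x) \<longlongrightarrow> 0) at_top" for k :: real by real_asymp
  have l2: "((\<lambda>x::real. k / (ln x)\<^sup>2) \<longlongrightarrow> 0) at_top" for k :: real by real_asymp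
  have l3: "((\<lambda>x::real. x powr (-z) * ln x powr (1 - g)) \<longlongrightarrow> 0) at_top" if "z > 0" for z
    using that by real_asymp
  have "(\<Phi> \<longlongrightarrow> s2 / 2 * (\<theta> * (g * a + 0)) + e * \<bar>a + 0\<bar> + e * (\<bar>a * (a - 1) + 0 + 0\<bar> / 2)
     + K1 * 0 * s2 + \<bar>K1\<bar> * 0 * 0 + K2 * 0) at_top"
    unfolding \<Phi>_def by (intro tendsto_intros l1 l2 l3 assms) simp
  moreover have "s2 / 2 * (\<theta> * (g * a + 0)) + e * \<bar>a + 0\<bar> + e * (\<bar>a * (a - 1) + 0 + 0\<bar> / 2)
     + K1 * 0 * s2 + \<bar>K1\<bar> * 0 * 0 + K2 * 0 = - (s2 * \<bar>g\<bar> * a) / 4"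
  proof -
    have "\<theta> * g = - \<bar>g\<bar>" by (simp add: th abs_sgn mult.commute)
    then have "s2 / 2 * (\<theta> * (g * a)) = - (s2 * \<bar>g\<bar> * a) / 2" by (simp flip: mult.assoc)
    moreover have "e * \<bar>a\<bar> + e * (\<bar>a * (a - 1)\<bar> / 2) = e * C"
      using assms by (simp add: C_def algebra_simps)
    moreover have "e * C = s2 * \<bar>g\<bar> * a / 4" using C by (simp add: e_def)
    ultimately show ?thesis by simp
  qed
  moreover have "- (s2 * \<bar>g\<bar> * a) / 4 < 0" using assms by simp
  ultimately have "eventually (\<lambda>x. \<Phi> x < 0) at_top"
    using order_tendstoD(2) by metis
  moreover have "eventually (\<lambda>x::real. x > 1) at_top" by (rule eventually_gt_at_top)
  ultimately have "eventually (\<lambda>x.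
     \<theta> * powlog' a g x * (c / x) + \<bar>\<theta> * powlog' a g x\<bar> * (e / (x * ln x))
     + (\<theta> * (powlog'' a g x / 2) + K1 * x powr (a - 2 - \<rho>)) * s2
     + \<bar>\<theta> * (powlog'' a g x / 2) + K1 * x powr (a - 2 - \<rho>)\<bar> * (e / ln x)
     + K2 * x powr (a - 2 - \<rho>') \<le> 0) at_top"
  proof eventually_elim
    case (elim x)
    define L where "L = ln x"
    have L: "L > 0" using elim by (simp add: L_def)
    define N where "N = x powr (a - 2) * L powr (g - 1)"
    have N: "N > 0" using elim L by (simp add: N_def)
    have th1: "\<bar>\<theta>\<bar> = 1" using assms by (simp add: th abs_sgn_eq)
    have D1: "powlog' a g x = x * N * L * (a + g / L)"
      using elim L unfolding N_def powlog'_def powlog_def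
      by (simp add: powr_diff power2_eq_square field_simps flip: L_def)
    have D2: "powlog'' a g x = N * L * (a * (a - 1) + g * (2 * a - 1) / L + g * (g - 1) / L\<^sup>2)"
      using elim L unfolding N_def powlog''_def powlog'_def powlog_def
      by (simp add: powr_diff power2_eq_square field_simps flip: L_def)
    have R: "x powr (a - 2 - z) = N * (x powr (- z) * L powr (1 - g))" for z
    proof -
      have "x powr (a - 2 - z) = x powr (a - 2) * x powr (- z)" by (simp flip: powr_add)
      moreover have "L powr (g - 1) * L powr (1 - g) = 1" using L by (simp flip: powr_add)
      ultimately show ?thesis by (simp add: N_def mult_ac)
    qed
    have t1: "\<theta> * powlog' a g x * (c / x) + \<theta> * (powlog'' a g x / 2) * s2
        = N * (s2 / 2 * (\<theta> * (g * a + g * (g - 1) / L)))"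
      using elim L by (simp add: D1 D2 c field_simps power2_eq_square)
    have t2: "\<bar>\<theta> * powlog' a g x\<bar> * (e / (x * L)) = N * (e * \<bar>a + g / L\<bar>)"
    proof -
      have "\<bar>\<theta> * powlog' a g x\<bar> = x * N * L * \<bar>a + g / L\<bar>"
        unfolding D1 abs_mult th1 using elim L N by simp
      then show ?thesis using elim L by simp
    qed
    have t3: "\<bar>\<theta> * (powlog'' a g x / 2)\<bar> * (e / L)
       = N * (e * (\<bar>a * (a - 1) + g * (2 * a - 1) / L + g * (g - 1) / L\<^sup>2\<bar> / 2))"
      using elim L N unfolding D2 by (simp add: abs_mult th1)
    have t4: "\<bar>K1 * x powr (a - 2 - \<rho>)\<bar> * (e / L) = N * (\<bar>K1\<bar> * (x powr (-\<rho>) * L powr (1 - g)) * (e / L))"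
      unfolding R using N by (simp add: abs_mult)
    have "\<bar>\<theta> * (powlog'' a g x / 2) + K1 * x powr (a - 2 - \<rho>)\<bar> * (e / L)
      \<le> \<bar>\<theta> * (powlog'' a g x / 2)\<bar> * (e / L) + \<bar>K1 * x powr (a - 2 - \<rho>)\<bar> * (e / L)"
      unfolding distrib_right[symmetric] using L e by (intro mult_right_mono abs_triangle_ineq) auto
    then have "\<theta> * powlog' a g x * (c / x) + \<bar>\<theta> * powlog' a g x\<bar> * (e / (x * ln x))
     + (\<theta> * (powlog'' a g x / 2) + K1 * x powr (a - 2 - \<rho>)) * s2
     + \<bar>\<theta> * (powlog'' a g x / 2) + K1 * x powr (a - 2 - \<rho>)\<bar> * (e / ln x)
     + K2 * x powr (a - 2 - \<rho>') \<le>
       (\<theta> * powlog' a g x * (c / x) + \<theta> * (powlog'' a g x / 2) * s2) + \<bar>\<theta> * powlog' a g x\<bar> * (e / (x * L))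
     + \<bar>\<theta> * (powlog'' a g x / 2)\<bar> * (e / L) + \<bar>K1 * x powr (a - 2 - \<rho>)\<bar> * (e / L)
     + K1 * x powr (a - 2 - \<rho>) * s2 + K2 * x powr (a - 2 - \<rho>')"
      by (simp add: L_def algebra_simps)
    also have "\<dots> = N * \<Phi> x"
      unfolding t1 t2 t3 t4 unfolding R \<Phi>_def L_def[symmetric] by (simp only: distrib_left mult_ac add_ac)
    also have "\<dots> \<le> 0" using N elim by (simp add: mult_le_0_iff)
    finally show ?case .
  qed
  with e show ?thesis by blast
qed

lemma powlog_nonneg: "0 \<le> powlog b g x"
  by (simp add: powlog_def)

text \<open>The increment of h from x in I is dominated by a quadratic and a p-th moment term in the jump d,
  with coefficients u, v, w for which the bound on the conditional expectation provided by (A2), with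
  errors of size e, and by the moment condition is nonpositive.\<close>
definition drift_dominated ::
  "real \<Rightarrow> real \<Rightarrow> real \<Rightarrow> real \<Rightarrow> real \<Rightarrow> real \<Rightarrow> real set \<Rightarrow> (real \<Rightarrow> real) \<Rightarrow> bool" where
  "drift_dominated c s2 p \<delta> C e I h \<longleftrightarrow>
     (\<exists>u\<in>borel_measurable borel. \<exists>v\<in>borel_measurable borel. \<exists>w\<in>borel_measurable borel.
        (\<forall>x. 0 \<le> w x) \<and>
        (\<forall>x\<in>I. \<forall>d\<ge>-x. h (x + d) - h x \<le> u x * d + v x * d\<^sup>2 + w x * \<bar>d\<bar> powr p) \<and>
        (\<forall>x\<in>I. u x * (c / x) + \<bar>u x\<bar> * (e / (x * ln x)) + v x * s2 + \<bar>v x\<bar> * (e / ln x)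
           + w x * (C * (1 + x) powr (p - 2 - \<delta>)) \<le> 0))"

lemma one_plus_powr_le:
  fixes x q :: real
  assumes "1 \<le> x"
  shows "(1 + x) powr q \<le> 2 powr \<bar>q\<bar> * x powr q"
proof (cases "q \<ge> 0")
  case True
  have "(1 + x) powr q \<le> (2 * x) powr q" using assms True by (intro powr_mono2) auto
  then show ?thesis using assms True by (simp add: powr_mult)
next
  case False
  have "(1 + x) powr q \<le> 1 * x powr q" using assms False by (simp add: powr_mono2')
  also have "\<dots> \<le> 2 powr \<bar>q\<bar> * x powr q" by (intro mult_right_mono ge_one_powr_ge_zero) auto
  finally show ?thesis .
qed

lemma powlog_drift_moment:
  fixes a g s2 c K1 K2 \<rho> \<delta> C p :: real
  assumes "0 < a" "g \<noteq> 0" "0 < s2" "c = - (a - 1) * s2 / 2"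
    and "0 < \<rho>" "0 < \<delta>" "\<theta> = - sgn g" "0 \<le> C" "0 \<le> K2"
  obtains e x2 where "e > 0" "\<And>x. x2 \<le> x \<Longrightarrow>
     \<theta> * powlog' a g x * (c / x) + \<bar>\<theta> * powlog' a g x\<bar> * (e / (x * ln x))
     + (\<theta> * (powlog'' a g x / 2) + K1 * x powr (a - 2 - \<rho>)) * s2
     + \<bar>\<theta> * (powlog'' a g x / 2) + K1 * x powr (a - 2 - \<rho>)\<bar> * (e / ln x)
     + K2 * x powr (a - p + \<delta> / 2) * (C * (1 + x) powr (p - 2 - \<delta>)) \<le> 0"
proof -
  define q where "q = p - 2 - \<delta>"
  have "\<delta> / 2 > 0" using assms by simp
  from powlog_drift[OF assms(1-5) this assms(7), of K1 "K2 * C * 2 powr \<bar>q\<bar>"]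
  obtain e x0 where e: "e > 0" and x0: "\<And>x. x \<ge> x0 \<Longrightarrow>
     \<theta> * powlog' a g x * (c / x) + \<bar>\<theta> * powlog' a g x\<bar> * (e / (x * ln x))
     + (\<theta> * (powlog'' a g x / 2) + K1 * x powr (a - 2 - \<rho>)) * s2
     + \<bar>\<theta> * (powlog'' a g x / 2) + K1 * x powr (a - 2 - \<rho>)\<bar> * (e / ln x)
     + K2 * C * 2 powr \<bar>q\<bar> * x powr (a - 2 - \<delta> / 2) \<le> 0"
    unfolding eventually_at_top_linorder by auto
  show thesis
  proof (rule that[of e "max 1 x0"])
    fix x assume x: "max 1 x0 \<le> x"
    have "K2 * x powr (a - p + \<delta> / 2) * (C * (1 + x) powr q)
       \<le> K2 * x powr (a - p + \<delta> / 2) * (C * (2 powr \<bar>q\<bar> * x powr q))"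
      using assms x by (intro mult_left_mono one_plus_powr_le) auto
    also have "\<dots> = K2 * C * 2 powr \<bar>q\<bar> * (x powr (a - p + \<delta> / 2) * x powr q)" by simp
    also have "x powr (a - p + \<delta> / 2) * x powr q = x powr (a - 2 - \<delta> / 2)"
      unfolding powr_add[symmetric] by (simp add: q_def algebra_simps)
    finally show "\<theta> * powlog' a g x * (c / x) + \<bar>\<theta> * powlog' a g x\<bar> * (e / (x * ln x))
     + (\<theta> * (powlog'' a g x / 2) + K1 * x powr (a - 2 - \<rho>)) * s2
     + \<bar>\<theta> * (powlog'' a g x / 2) + K1 * x powr (a - 2 - \<rho>)\<bar> * (e / ln x)
     + K2 * x powr (a - p + \<delta> / 2) * (C * (1 + x) powr (p - 2 - \<delta>)) \<le> 0"
      using x0[of x] x by (simp add: q_def)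
  qed (rule e)
qed

lemma powlog_super:
  assumes "0 < a" "0 < s2" "c = - (a - 1) * s2 / 2" "2 < p" "a \<le> p" "0 < \<delta>" "0 \<le> C"
  obtains b A e where "3 \<le> b" "b \<le> A" "0 < e"
    "\<And>x y. b \<le> x \<Longrightarrow> x \<le> y \<Longrightarrow> powlog a (-1) x \<le> powlog a (-1) y"
    "drift_dominated c s2 p \<delta> C e {A..} (\<lambda>z. powlog a (-1) (max z b))"
proof -
  obtain b where b: "b \<ge> 3" and mono: "\<And>x y. b \<le> x \<Longrightarrow> x \<le> y \<Longrightarrow> powlog a (-1) x \<le> powlog a (-1) y"
    using powlog_mono[OF assms(1)] by blast
  obtain K \<rho> x1 where K: "0 \<le> K" "0 < \<rho>" "4 \<le> x1" and
    small: "\<And>x d. x1 \<le> x \<Longrightarrow> \<bar>d\<bar> \<le> x / 2 \<Longrightarrow>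
       \<bar>powlog a (-1) (x + d) - powlog a (-1) x - powlog' a (-1) x * d - powlog'' a (-1) x / 2 * d\<^sup>2\<bar>
         \<le> K * (x powr (a - 2 - \<rho>) * d\<^sup>2 + x powr (a - p + \<delta> / 2) * \<bar>d\<bar> powr p)" and
    large: "\<And>x d. x1 \<le> x \<Longrightarrow> x / 2 < \<bar>d\<bar> \<Longrightarrow>
       powlog a (-1) x + \<bar>powlog' a (-1) x * d\<bar> + \<bar>powlog'' a (-1) x / 2 * d\<^sup>2\<bar>
         \<le> K * x powr (a - p + \<delta> / 2) * \<bar>d\<bar> powr p"
    by (rule powlog_increment[OF assms(6,4)]) blast
  define K2 where "K2 = K + 3 powr a * 2 powr (p - a)"
  have K2: "0 \<le> K2" "K \<le> K2" using K by (auto simp: K2_def)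
  obtain e x2 where e: "e > 0" and x2: "\<And>x. x2 \<le> x \<Longrightarrow>
     1 * powlog' a (-1) x * (c / x) + \<bar>1 * powlog' a (-1) x\<bar> * (e / (x * ln x))
     + (1 * (powlog'' a (-1) x / 2) + K * x powr (a - 2 - \<rho>)) * s2
     + \<bar>1 * (powlog'' a (-1) x / 2) + K * x powr (a - 2 - \<rho>)\<bar> * (e / ln x)
     + K2 * x powr (a - p + \<delta> / 2) * (C * (1 + x) powr (p - 2 - \<delta>)) \<le> 0"
    by (rule powlog_drift_moment[of a "-1" s2 c \<rho> \<delta> 1 C K2 K p]) (use assms K K2 in auto)
  define A where "A = max (2 * b) (max x1 x2)"
  have A: "2 * b \<le> x" "x1 \<le> x" "x2 \<le> x" if "A \<le> x" for x
    using that by (auto simp: A_def)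
  have "drift_dominated c s2 p \<delta> C e {A..} (\<lambda>z. powlog a (-1) (max z b))"
    unfolding drift_dominated_def
  proof (intro bexI conjI allI ballI impI)
    show "0 \<le> K2 * x powr (a - p + \<delta> / 2)" for x using K2 by simp
    fix x assume "x \<in> {A..}"
    then have x: "A \<le> x" by simp
    note Ax = A[OF x]
    show "powlog' a (-1) x * (c / x) + \<bar>powlog' a (-1) x\<bar> * (e / (x * ln x))
       + (powlog'' a (-1) x / 2 + K * x powr (a - 2 - \<rho>)) * s2
       + \<bar>powlog'' a (-1) x / 2 + K * x powr (a - 2 - \<rho>)\<bar> * (e / ln x)
       + K2 * x powr (a - p + \<delta> / 2) * (C * (1 + x) powr (p - 2 - \<delta>)) \<le> 0"
      using x2[OF Ax(3)] by simp
    fix d assume d: "- x \<le> d"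
    define W where "W = x powr (a - p + \<delta> / 2) * \<bar>d\<bar> powr p"
    have W: "0 \<le> W" by (simp add: W_def)
    have KW: "K * W \<le> K2 * W" using K2 W by (intro mult_right_mono)
    have hx: "max x b = x" using Ax b by simp
    have "powlog a (-1) (max (x + d) b) - powlog a (-1) x
       \<le> powlog' a (-1) x * d + (powlog'' a (-1) x / 2 * d\<^sup>2 + K * (x powr (a - 2 - \<rho>) * d\<^sup>2)) + K2 * W"
    proof (cases "\<bar>d\<bar> \<le> x / 2")
      case True
      then have "max (x + d) b = x + d" using Ax by (simp add: max_def abs_if split: if_splits)
      then show ?thesis using small[OF Ax(2) True] KW by (simp add: W_def algebra_simps)
    next
      case False
      then have dd: "x / 2 < \<bar>d\<bar>" "0 < x" using Ax b by auto
      have "powlog a (-1) (max (x + d) b) \<le> powlog a (-1) x + 3 powr a * 2 powr (p - a) * W"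
      proof (cases "x + d \<le> b")
        case True
        have "powlog a (-1) b \<le> powlog a (-1) x" using mono[of b x] Ax b by simp
        moreover have "0 \<le> 3 powr a * 2 powr (p - a) * W" using W by simp
        ultimately show ?thesis using True by (simp add: max_def)
      next
        case False
        define z where "z = x + d"
        have z: "z > 3" "z \<le> 3 * \<bar>d\<bar>" using False b dd by (auto simp: z_def)
        have "exp 1 \<le> z" using e_less_272 z by simp
        then have "1 \<le> ln z" using z by (subst ln_ge_iff) auto
        then have "ln z powr (-1) \<le> 1" by (simp add: powr_minus_divide)
        then have "powlog a (-1) z \<le> z powr a * 1"
          unfolding powlog_def by (intro mult_left_mono) auto
        also have "\<dots> \<le> (3 * \<bar>d\<bar>) powr a" using z assms by (simp add: powr_mono2)
        also have "\<dots> = 3 powr a * \<bar>d\<bar> powr a" by (simp add: powr_mult)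
        also have "\<dots> \<le> 3 powr a * (2 powr (p - a) * x powr (a - p) * \<bar>d\<bar> powr p)"
          using dd assms by (intro mult_left_mono abs_powr_le_powr_of_half_less) auto
        also have "\<dots> \<le> 3 powr a * (2 powr (p - a) * x powr (a - p + \<delta> / 2) * \<bar>d\<bar> powr p)"
          using Ax b assms by (intro mult_left_mono mult_right_mono powr_mono) auto
        finally have "powlog a (-1) z \<le> 3 powr a * 2 powr (p - a) * W" by (simp add: W_def mult_ac)
        then show ?thesis using False powlog_nonneg[of a "-1" x] by (simp add: z_def max_def)
      qed
      moreover have "0 \<le> K * (x powr (a - 2 - \<rho>) * d\<^sup>2)" using K by simp
      moreover have "K2 * W = K * W + 3 powr a * 2 powr (p - a) * W"
        by (simp add: K2_def algebra_simps)
      moreover have "powlog a (-1) x + \<bar>powlog' a (-1) x * d\<bar> + \<bar>powlog'' a (-1) x / 2 * d\<^sup>2\<bar> \<le> K * W"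
        using large[OF Ax(2) dd(1)] by (simp add: W_def mult.assoc)
      ultimately show ?thesis using powlog_nonneg[of a "-1" x] by linarith
    qed
    then show "powlog a (-1) (max (x + d) b) - powlog a (-1) (max x b)
       \<le> powlog' a (-1) x * d + (powlog'' a (-1) x / 2 + K * x powr (a - 2 - \<rho>)) * d\<^sup>2
         + K2 * x powr (a - p + \<delta> / 2) * \<bar>d\<bar> powr p"
      unfolding hx by (simp add: W_def algebra_simps)
  qed measurable
  moreover have "b \<le> A" using b by (simp add: A_def)
  ultimately show thesis using that b mono e by blast
qed

lemma powlog_sub:
  assumes "0 < a" "0 < s2" "c = - (a - 1) * s2 / 2" "2 < p" "0 < \<delta>" "0 \<le> C" "0 < g"
  obtains A0 e where "3 \<le> A0" "0 < e"
    "\<And>x y. A0 \<le> x \<Longrightarrow> x \<le> y \<Longrightarrow> powlog a g x \<le> powlog a g y"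
    "\<And>A R. A0 \<le> A \<Longrightarrow> drift_dominated c s2 p \<delta> C e {A..R} (\<lambda>z. - powlog a g (max A (min z (2 * R))))"
proof -
  obtain b where b: "b \<ge> 3" and mono: "\<And>x y. b \<le> x \<Longrightarrow> x \<le> y \<Longrightarrow> powlog a g x \<le> powlog a g y"
    using powlog_mono[OF assms(1)] by blast
  obtain K \<rho> x1 where K: "0 \<le> K" "0 < \<rho>" "4 \<le> x1" and
    small: "\<And>x d. x1 \<le> x \<Longrightarrow> \<bar>d\<bar> \<le> x / 2 \<Longrightarrow>
       \<bar>powlog a g (x + d) - powlog a g x - powlog' a g x * d - powlog'' a g x / 2 * d\<^sup>2\<bar>
         \<le> K * (x powr (a - 2 - \<rho>) * d\<^sup>2 + x powr (a - p + \<delta> / 2) * \<bar>d\<bar> powr p)" and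
    large: "\<And>x d. x1 \<le> x \<Longrightarrow> x / 2 < \<bar>d\<bar> \<Longrightarrow>
       powlog a g x + \<bar>powlog' a g x * d\<bar> + \<bar>powlog'' a g x / 2 * d\<^sup>2\<bar>
         \<le> K * x powr (a - p + \<delta> / 2) * \<bar>d\<bar> powr p"
    by (rule powlog_increment[OF assms(5,4)]) blast
  obtain e x2 where e: "e > 0" and x2: "\<And>x. x2 \<le> x \<Longrightarrow>
     -1 * powlog' a g x * (c / x) + \<bar>-1 * powlog' a g x\<bar> * (e / (x * ln x))
     + (-1 * (powlog'' a g x / 2) + K * x powr (a - 2 - \<rho>)) * s2
     + \<bar>-1 * (powlog'' a g x / 2) + K * x powr (a - 2 - \<rho>)\<bar> * (e / ln x)
     + K * x powr (a - p + \<delta> / 2) * (C * (1 + x) powr (p - 2 - \<delta>)) \<le> 0"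
    by (rule powlog_drift_moment[of a g s2 c \<rho> \<delta> "-1" C K K p]) (use assms K in auto)
  define A0 where "A0 = max (2 * b) (max x1 x2)"
  have A0: "2 * b \<le> x" "x1 \<le> x" "x2 \<le> x" if "A0 \<le> x" for x
    using that by (auto simp: A0_def)
  have "drift_dominated c s2 p \<delta> C e {A..R} (\<lambda>z. - powlog a g (max A (min z (2 * R))))" if A: "A0 \<le> A" for A R
    unfolding drift_dominated_def
  proof (intro bexI conjI allI ballI impI)
    show "0 \<le> K * x powr (a - p + \<delta> / 2)" for x using K by simp
    fix x assume "x \<in> {A..R}"
    then have x: "A \<le> x" "x \<le> R" by auto
    note Ax = A0[OF order_trans[OF A x(1)]]
    show "- powlog' a g x * (c / x) + \<bar>- powlog' a g x\<bar> * (e / (x * ln x))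
       + (- (powlog'' a g x / 2) + K * x powr (a - 2 - \<rho>)) * s2
       + \<bar>- (powlog'' a g x / 2) + K * x powr (a - 2 - \<rho>)\<bar> * (e / ln x)
       + K * x powr (a - p + \<delta> / 2) * (C * (1 + x) powr (p - 2 - \<delta>)) \<le> 0"
      using x2[OF Ax(3)] by simp
    fix d assume d: "- x \<le> d"
    define W where "W = x powr (a - p + \<delta> / 2) * \<bar>d\<bar> powr p"
    define z where "z = max A (min (x + d) (2 * R))"
    have hx: "max A (min x (2 * R)) = x" using x Ax b by simp
    have "powlog a g x - powlog a g z
       \<le> - powlog' a g x * d + (- (powlog'' a g x / 2 * d\<^sup>2) + K * (x powr (a - 2 - \<rho>) * d\<^sup>2)) + K * W"
    proof (cases "\<bar>d\<bar> \<le> x / 2")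
      case True
      then have "x + d \<le> z" "b \<le> x + d" using Ax x by (auto simp: z_def abs_if split: if_splits)
      then have "powlog a g (x + d) \<le> powlog a g z" using mono by blast
      then show ?thesis using small[OF Ax(2) True] by (simp add: W_def algebra_simps)
    next
      case False
      then have dd: "x / 2 < \<bar>d\<bar>" by auto
      moreover have "0 \<le> K * (x powr (a - 2 - \<rho>) * d\<^sup>2)" using K by simp
      moreover have "powlog a g x + \<bar>powlog' a g x * d\<bar> + \<bar>powlog'' a g x / 2 * d\<^sup>2\<bar> \<le> K * W"
        using large[OF Ax(2) dd(1)] by (simp add: W_def mult.assoc)
      ultimately show ?thesis using powlog_nonneg[of a g z] by linarith
    qed
    then show "- powlog a g (max A (min (x + d) (2 * R))) - - powlog a g (max A (min x (2 * R)))
       \<le> - powlog' a g x * d + (- (powlog'' a g x / 2) + K * x powr (a - 2 - \<rho>)) * d\<^sup>2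
         + K * x powr (a - p + \<delta> / 2) * \<bar>d\<bar> powr p"
      unfolding hx by (simp add: W_def z_def algebra_simps)
  qed measurable
  moreover have "3 \<le> A0" "b \<le> A0" using b by (auto simp: A0_def)
  ultimately show thesis using that mono e by (meson order_trans)
qed

section \<open>One-step estimates\<close>

locale lamperti_process = prob_space M for M :: "'a measure" +
  fixes F :: "nat \<Rightarrow> 'a measure" and X :: "nat \<Rightarrow> 'a \<Rightarrow> real" and S :: "real set"
    and a c s2 p \<delta> C :: real
  assumes S_nonneg: "S \<subseteq> {0..}"
    and S_zero: "0 \<in> S"
    and S_locfin: "\<And>B. bounded B \<Longrightarrow> finite (B \<inter> S)"
    and F_sub: "\<And>t. 1 \<le> t \<Longrightarrow> subalgebra M (F t)"
    and F_mono: "\<And>s t. 1 \<le> s \<Longrightarrow> s \<le> t \<Longrightarrow> sets (F s) \<subseteq> sets (F t)"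
    and X_adapted: "\<And>t. 1 \<le> t \<Longrightarrow> X t \<in> borel_measurable (F t)"
    and X_in_S: "\<And>t \<omega>. 1 \<le> t \<Longrightarrow> \<omega> \<in> space M \<Longrightarrow> X t \<omega> \<in> S"
    and X_start: "AE \<omega> in M. X 1 \<omega> = 0"
    and A1: "\<exists>(m :: real \<Rightarrow> real \<Rightarrow> nat) (\<phi> :: real \<Rightarrow> real \<Rightarrow> real).
              (\<forall>x\<in>S. \<forall>y\<in>S. 1 \<le> m x y \<and> 0 < \<phi> x y) \<and>
              (\<forall>y\<in>S. \<forall>t\<ge>1. AE \<omega> in M.
                 real_cond_exp M (F t)
                   (indicator {\<omega>' \<in> space M. X (t + m (X t \<omega>') y) \<omega>' = y}) \<omega>
                 \<ge> \<phi> (X t \<omega>) y)"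
    and s2_pos: "0 < s2"
    and A2_drift: "\<And>e. e > 0 \<Longrightarrow> \<exists>x0. \<forall>t\<ge>1. AE \<omega> in M. x0 \<le> X t \<omega> \<longrightarrow>
              \<bar>real_cond_exp M (F t) (\<lambda>\<omega>'. X (Suc t) \<omega>' - X t \<omega>') \<omega> - c / X t \<omega>\<bar>
                \<le> e / (X t \<omega> * ln (X t \<omega>))"
    and A2_var: "\<And>e. e > 0 \<Longrightarrow> \<exists>x0. \<forall>t\<ge>1. AE \<omega> in M. x0 \<le> X t \<omega> \<longrightarrow>
              \<bar>real_cond_exp M (F t) (\<lambda>\<omega>'. (X (Suc t) \<omega>' - X t \<omega>')\<^sup>2) \<omega> - s2\<bar>
                \<le> e / ln (X t \<omega>)"
    and a_pos: "0 < a"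
    and a_le_p: "a \<le> p"
    and c_eq: "c = - (a - 1) * s2 / 2"
    and p_gt2: "2 < p"
    and \<delta>_pos: "0 < \<delta>"
    and C_nonneg: "0 \<le> C"
    and Mp: "\<And>t. 1 \<le> t \<Longrightarrow> AE \<omega> in M.
              nn_cond_exp M (F t) (\<lambda>\<omega>'. ennreal (\<bar>X (Suc t) \<omega>' - X t \<omega>'\<bar> powr p)) \<omega>
                \<le> ennreal (C * (1 + X t \<omega>) powr (p - 2 - \<delta>))"
begin

lemma F_sigma_finite: "1 \<le> t \<Longrightarrow> sigma_finite_subalgebra M (F t)"
  by (intro finite_measure_subalgebra_is_sigma_finite finite_measure_subalgebra.intro
      finite_measure_subalgebra_axioms.intro F_sub finite_measure_axioms)

lemma X_measurable [measurable (raw)]: "1 \<le> t \<Longrightarrow> X t \<in> borel_measurable M"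
  using measurable_from_subalg F_sub X_adapted by blast

lemma F_sets: "1 \<le> t \<Longrightarrow> B \<in> sets (F t) \<Longrightarrow> B \<in> sets M"
  using F_sub unfolding subalgebra_def by blast

lemma X_nonneg: "1 \<le> t \<Longrightarrow> \<omega> \<in> space M \<Longrightarrow> 0 \<le> X t \<omega>"
  using X_in_S S_nonneg by fastforce

lemma S_countable: "countable S"
proof -
  have "S \<subseteq> (\<Union>n::nat. {0..real n} \<inter> S)"
    using S_nonneg real_arch_simple by fastforce
  moreover have "countable (\<Union>n::nat. {0..real n} \<inter> S)"
    by (intro countable_UN) (auto intro!: countable_finite S_locfin)
  ultimately show ?thesis by (rule countable_subset)
qed

lemma bounded_of_X:
  fixes k :: "real \<Rightarrow> real"
  assumes "1 \<le> t"
  obtains K where "0 \<le> K" "\<And>\<omega>. \<omega> \<in> space M \<Longrightarrow> X t \<omega> \<le> R \<Longrightarrow> \<bar>k (X t \<omega>)\<bar> \<le> K"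
proof -
  define T where "T = (\<lambda>x. \<bar>k x\<bar>) ` ({0..R} \<inter> S)"
  have T: "finite T" unfolding T_def by (intro finite_imageI S_locfin) auto
  show thesis
  proof (rule that[of "Max (insert 0 T)"])
    show "0 \<le> Max (insert 0 T)" using T by simp
    fix \<omega> assume "\<omega> \<in> space M" "X t \<omega> \<le> R"
    then have "\<bar>k (X t \<omega>)\<bar> \<in> T"
      unfolding T_def using assms X_in_S X_nonneg by auto
    then show "\<bar>k (X t \<omega>)\<bar> \<le> Max (insert 0 T)" using T by simp
  qed
qed

context
  fixes t :: nat and B :: "'a set" and R :: real
  assumes t: "1 \<le> t" and B: "B \<in> sets (F t)" "\<And>\<omega>. \<omega> \<in> B \<Longrightarrow> X t \<omega> \<le> R"
begin

lemma B_space: "B \<subseteq> space M"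
  using F_sets[OF t B(1)] sets.sets_into_space by blast

lemma B_meas: "B \<in> sets M"
  using F_sets[OF t B(1)] .

lemma bounded_integrable:
  assumes [measurable]: "k \<in> borel_measurable borel"
  shows "integrable M (\<lambda>\<omega>. indicator B \<omega> * (k (X t \<omega>) :: real))"
proof -
  obtain K where K: "0 \<le> K" "\<And>\<omega>. \<omega> \<in> space M \<Longrightarrow> X t \<omega> \<le> R \<Longrightarrow> \<bar>k (X t \<omega>)\<bar> \<le> K"
    using bounded_of_X[OF t, of R k] by blast
  note [measurable] = B_meas X_measurable[OF t]
  show ?thesis
    by (rule integrable_const_bound[of _ K])
       (use K B in \<open>auto intro!: AE_I2 simp: indicator_def abs_mult\<close>)
qed

lemma jump_moment:
  assumes k [measurable]: "k \<in> borel_measurable borel" and k0: "\<And>x. 0 \<le> k x"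
  shows "integrable M (\<lambda>\<omega>. indicator B \<omega> * k (X t \<omega>) * \<bar>X (Suc t) \<omega> - X t \<omega>\<bar> powr p)"
    and "(\<integral>\<omega>. indicator B \<omega> * k (X t \<omega>) * \<bar>X (Suc t) \<omega> - X t \<omega>\<bar> powr p \<partial>M)
       \<le> (\<integral>\<omega>. indicator B \<omega> * (k (X t \<omega>) * (C * (1 + X t \<omega>) powr (p - 2 - \<delta>))) \<partial>M)"
proof -
  note [measurable] = B_meas X_measurable[OF t] B(1) X_adapted[OF t]
  have [measurable]: "X (Suc t) \<in> borel_measurable M" by (rule X_measurable) simp
  interpret sigma_finite_subalgebra M "F t" by (rule F_sigma_finite[OF t])
  let ?f = "\<lambda>\<omega>. indicator B \<omega> * k (X t \<omega>) * \<bar>X (Suc t) \<omega> - X t \<omega>\<bar> powr p"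
  let ?g = "\<lambda>\<omega>. indicator B \<omega> * (k (X t \<omega>) * (C * (1 + X t \<omega>) powr (p - 2 - \<delta>)))"
  have g: "integrable M ?g"
    by (rule bounded_integrable) measurable
  have "(\<integral>\<^sup>+\<omega>. ennreal (?f \<omega>) \<partial>M)
     = (\<integral>\<^sup>+\<omega>. ennreal (indicator B \<omega> * k (X t \<omega>)) * ennreal (\<bar>X (Suc t) \<omega> - X t \<omega>\<bar> powr p) \<partial>M)"
    by (intro nn_integral_cong) (simp add: ennreal_mult k0)
  also have "\<dots> = (\<integral>\<^sup>+\<omega>. ennreal (indicator B \<omega> * k (X t \<omega>)) *
      nn_cond_exp M (F t) (\<lambda>\<omega>. ennreal (\<bar>X (Suc t) \<omega> - X t \<omega>\<bar> powr p)) \<omega> \<partial>M)"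
    by (rule nn_cond_exp_intg[symmetric]) measurable
  also have "\<dots> \<le> (\<integral>\<^sup>+\<omega>. ennreal (indicator B \<omega> * k (X t \<omega>)) *
       ennreal (C * (1 + X t \<omega>) powr (p - 2 - \<delta>)) \<partial>M)"
    using Mp[OF t] by (intro nn_integral_mono_AE) (auto intro!: mult_left_mono)
  also have "\<dots> = (\<integral>\<^sup>+\<omega>. ennreal (?g \<omega>) \<partial>M)"
    by (intro nn_integral_cong) (simp add: k0 C_nonneg mult.assoc flip: ennreal_mult)
  also have "\<dots> = ennreal (\<integral>\<omega>. ?g \<omega> \<partial>M)"
    using g by (intro nn_integral_eq_integral) (auto intro!: AE_I2 simp: k0 C_nonneg)
  finally have le: "(\<integral>\<^sup>+\<omega>. ennreal (?f \<omega>) \<partial>M) \<le> ennreal (\<integral>\<omega>. ?g \<omega> \<partial>M)" .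
  show f: "integrable M ?f"
    by (rule integrableI_nonneg)
      (use le in \<open>auto intro!: AE_I2 simp: k0 less_top[symmetric] top_unique\<close>)
  have "ennreal (\<integral>\<omega>. ?f \<omega> \<partial>M) \<le> ennreal (\<integral>\<omega>. ?g \<omega> \<partial>M)"
    using le f by (subst nn_integral_eq_integral[symmetric]) (auto intro!: AE_I2 simp: k0)
  moreover have "0 \<le> (\<integral>\<omega>. ?g \<omega> \<partial>M)"
    by (intro integral_nonneg_AE AE_I2) (auto simp: k0 C_nonneg)
  ultimately show "(\<integral>\<omega>. ?f \<omega> \<partial>M) \<le> (\<integral>\<omega>. ?g \<omega> \<partial>M)"
    by simp
qed

lemma jump_integrable:
  assumes [measurable]: "G \<in> borel_measurable M"
    and bd: "\<And>\<omega>. \<omega> \<in> B \<Longrightarrow> \<bar>G \<omega>\<bar> \<le> K * (1 + \<bar>X (Suc t) \<omega> - X t \<omega>\<bar> powr p)"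
  shows "integrable M (\<lambda>\<omega>. indicator B \<omega> * (G \<omega> :: real))"
proof (rule Bochner_Integration.integrable_bound)
  note [measurable] = B_meas
  have "integrable M (\<lambda>\<omega>. indicator B \<omega> * (1::real) * \<bar>X (Suc t) \<omega> - X t \<omega>\<bar> powr p)"
    by (rule jump_moment(1)) auto
  moreover have "integrable M (\<lambda>\<omega>. indicator B \<omega> :: real)"
    by (rule integrable_const_bound[of _ 1]) auto
  ultimately have "integrable M (\<lambda>\<omega>. K * (indicator B \<omega> + indicator B \<omega> * (1::real) * \<bar>X (Suc t) \<omega> - X t \<omega>\<bar> powr p))"
    by (intro Bochner_Integration.integrable_add integrable_mult_right)
  then show "integrable M (\<lambda>\<omega>. indicator B \<omega> * (K * (1 + \<bar>X (Suc t) \<omega> - X t \<omega>\<bar> powr p)))"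
    by (simp add: algebra_simps)
  show "(\<lambda>\<omega>. indicator B \<omega> * G \<omega>) \<in> borel_measurable M" by measurable
  show "AE \<omega> in M. norm (indicator B \<omega> * G \<omega>)
       \<le> norm (indicator B \<omega> * (K * (1 + \<bar>X (Suc t) \<omega> - X t \<omega>\<bar> powr p)))"
  proof (rule AE_I2)
    fix \<omega> show "norm (indicator B \<omega> * G \<omega>)
       \<le> norm (indicator B \<omega> * (K * (1 + \<bar>X (Suc t) \<omega> - X t \<omega>\<bar> powr p)))"
    proof (cases "\<omega> \<in> B")
      case True
      have "\<bar>G \<omega>\<bar> \<le> \<bar>K * (1 + \<bar>X (Suc t) \<omega> - X t \<omega>\<bar> powr p)\<bar>"
        using bd[OF True] by linarith
      then show ?thesis using True by simp
    qed simp
  qed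
qed

lemma expected_increment_nonpos:
  assumes dd: "drift_dominated c s2 p \<delta> C e I h"
    and XI: "\<And>\<omega>. \<omega> \<in> B \<Longrightarrow> X t \<omega> \<in> I"
    and drift: "AE \<omega> in M. X t \<omega> \<in> I \<longrightarrow>
      \<bar>real_cond_exp M (F t) (\<lambda>\<omega>'. X (Suc t) \<omega>' - X t \<omega>') \<omega> - c / X t \<omega>\<bar> \<le> e / (X t \<omega> * ln (X t \<omega>))"
    and var: "AE \<omega> in M. X t \<omega> \<in> I \<longrightarrow>
      \<bar>real_cond_exp M (F t) (\<lambda>\<omega>'. (X (Suc t) \<omega>' - X t \<omega>')\<^sup>2) \<omega> - s2\<bar> \<le> e / ln (X t \<omega>)"
    and int: "integrable M (\<lambda>\<omega>. indicator B \<omega> * (h (X (Suc t) \<omega>) - h (X t \<omega>)))"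
  shows "(\<integral>\<omega>. indicator B \<omega> * (h (X (Suc t) \<omega>) - h (X t \<omega>)) \<partial>M) \<le> 0"
proof -
  note [measurable] = B_meas X_measurable[OF t] B(1) X_adapted[OF t]
  have [measurable]: "X (Suc t) \<in> borel_measurable M" by (rule X_measurable) simp
  interpret sigma_finite_subalgebra M "F t" by (rule F_sigma_finite[OF t])
  obtain u v w where [measurable]: "u \<in> borel_measurable borel" "v \<in> borel_measurable borel"
      "w \<in> borel_measurable borel" and w: "\<And>x. 0 \<le> w x"
    and pt: "\<And>x d. x \<in> I \<Longrightarrow> d \<ge> -x \<Longrightarrow> h (x + d) - h x \<le> u x * d + v x * d\<^sup>2 + w x * \<bar>d\<bar> powr p"
    and neg: "\<And>x. x \<in> I \<Longrightarrow> u x * (c / x) + \<bar>u x\<bar> * (e / (x * ln x)) + v x * s2 + \<bar>v x\<bar> * (e / ln x)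
           + w x * (C * (1 + x) powr (p - 2 - \<delta>)) \<le> 0"
    using dd unfolding drift_dominated_def by metis
  define \<Delta> where "\<Delta> \<omega> = X (Suc t) \<omega> - X t \<omega>" for \<omega>
  have [measurable]: "\<Delta> \<in> borel_measurable M" unfolding \<Delta>_def by measurable
  define \<mu> where "\<mu> = real_cond_exp M (F t) \<Delta>"
  define \<nu> where "\<nu> = real_cond_exp M (F t) (\<lambda>\<omega>. (\<Delta> \<omega>)\<^sup>2)"
  have d1: "\<bar>d\<bar> \<le> 1 + \<bar>d\<bar> powr p" for d :: real
  proof (cases "\<bar>d\<bar> \<le> 1")
    case False
    then have "\<bar>d\<bar> powr 1 \<le> \<bar>d\<bar> powr p" using p_gt2 by (intro powr_mono) auto
    then show ?thesis by simp
  qed (simp add: add_increasing2)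
  have d2: "d\<^sup>2 \<le> 1 + \<bar>d\<bar> powr p" for d :: real
  proof (cases "\<bar>d\<bar> \<le> 1")
    case True
    then have "d\<^sup>2 \<le> 1" by (simp add: abs_square_le_1)
    then show ?thesis by (simp add: add_increasing2)
  next
    case False
    then have "\<bar>d\<bar> powr 2 \<le> \<bar>d\<bar> powr p" using p_gt2 by (intro powr_mono) auto
    then show ?thesis using False by simp
  qed
  have i1: "integrable M (\<lambda>\<omega>. indicator B \<omega> * u (X t \<omega>) * \<Delta> \<omega>)"
  proof -
    obtain K where K: "0 \<le> K" "\<And>\<omega>. \<omega> \<in> space M \<Longrightarrow> X t \<omega> \<le> R \<Longrightarrow> \<bar>u (X t \<omega>)\<bar> \<le> K"
      using bounded_of_X[OF t, of R u] by blast
    have "integrable M (\<lambda>\<omega>. indicator B \<omega> * (u (X t \<omega>) * \<Delta> \<omega>))"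
      by (rule jump_integrable[of _ K])
         (use K B B_space d1 in \<open>auto simp: abs_mult simp flip: \<Delta>_def intro!: mult_mono\<close>)
    then show ?thesis by (simp add: mult.assoc)
  qed
  have i2: "integrable M (\<lambda>\<omega>. indicator B \<omega> * v (X t \<omega>) * (\<Delta> \<omega>)\<^sup>2)"
  proof -
    obtain K where K: "0 \<le> K" "\<And>\<omega>. \<omega> \<in> space M \<Longrightarrow> X t \<omega> \<le> R \<Longrightarrow> \<bar>v (X t \<omega>)\<bar> \<le> K"
      using bounded_of_X[OF t, of R v] by blast
    have "integrable M (\<lambda>\<omega>. indicator B \<omega> * (v (X t \<omega>) * (\<Delta> \<omega>)\<^sup>2))"
      by (rule jump_integrable[of _ K])
         (use K B B_space d2 in \<open>auto simp: abs_mult simp flip: \<Delta>_def intro!: mult_mono\<close>)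
    then show ?thesis by (simp add: mult.assoc)
  qed
  have i3: "integrable M (\<lambda>\<omega>. indicator B \<omega> * w (X t \<omega>) * \<bar>\<Delta> \<omega>\<bar> powr p)"
    unfolding \<Delta>_def by (rule jump_moment(1)) (auto simp: w)
  have m1: "integrable M (\<lambda>\<omega>. indicator B \<omega> * u (X t \<omega>) * \<mu> \<omega>)"
    "(\<integral>\<omega>. indicator B \<omega> * u (X t \<omega>) * \<mu> \<omega> \<partial>M) = (\<integral>\<omega>. indicator B \<omega> * u (X t \<omega>) * \<Delta> \<omega> \<partial>M)"
    unfolding \<mu>_def by (rule real_cond_exp_intg[OF i1]; measurable)+
  have m2: "integrable M (\<lambda>\<omega>. indicator B \<omega> * v (X t \<omega>) * \<nu> \<omega>)"
    "(\<integral>\<omega>. indicator B \<omega> * v (X t \<omega>) * \<nu> \<omega> \<partial>M) = (\<integral>\<omega>. indicator B \<omega> * v (X t \<omega>) * (\<Delta> \<omega>)\<^sup>2 \<partial>M)"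
    unfolding \<nu>_def by (rule real_cond_exp_intg[OF i2]; measurable)+
  have abs_le: "k * z \<le> k * y + \<bar>k\<bar> * q" if "\<bar>z - y\<bar> \<le> q" for k z y q :: real
  proof -
    have "k * (z - y) \<le> \<bar>k\<bar> * \<bar>z - y\<bar>" by (metis abs_ge_self abs_mult)
    also have "\<dots> \<le> \<bar>k\<bar> * q" using that by (intro mult_left_mono) auto
    finally show ?thesis by (simp add: algebra_simps)
  qed
  let ?u = "\<lambda>x. u x * (c / x) + \<bar>u x\<bar> * (e / (x * ln x))"
  let ?v = "\<lambda>x. v x * s2 + \<bar>v x\<bar> * (e / ln x)"
  let ?w = "\<lambda>x. w x * (C * (1 + x) powr (p - 2 - \<delta>))"
  have b1: "integrable M (\<lambda>\<omega>. indicator B \<omega> * ?u (X t \<omega>))" by (rule bounded_integrable) measurable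
  have b2: "integrable M (\<lambda>\<omega>. indicator B \<omega> * ?v (X t \<omega>))" by (rule bounded_integrable) measurable
  have b3: "integrable M (\<lambda>\<omega>. indicator B \<omega> * ?w (X t \<omega>))" by (rule bounded_integrable) measurable
  have "(\<integral>\<omega>. indicator B \<omega> * (h (X (Suc t) \<omega>) - h (X t \<omega>)) \<partial>M)
     \<le> (\<integral>\<omega>. indicator B \<omega> * u (X t \<omega>) * \<Delta> \<omega> + indicator B \<omega> * v (X t \<omega>) * (\<Delta> \<omega>)\<^sup>2
           + indicator B \<omega> * w (X t \<omega>) * \<bar>\<Delta> \<omega>\<bar> powr p \<partial>M)"
  proof (rule integral_mono[OF int])
    fix \<omega> assume om: "\<omega> \<in> space M"
    show "indicator B \<omega> * (h (X (Suc t) \<omega>) - h (X t \<omega>)) \<le>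
      indicator B \<omega> * u (X t \<omega>) * \<Delta> \<omega> + indicator B \<omega> * v (X t \<omega>) * (\<Delta> \<omega>)\<^sup>2
           + indicator B \<omega> * w (X t \<omega>) * \<bar>\<Delta> \<omega>\<bar> powr p"
    proof (cases "\<omega> \<in> B")
      case True
      have "- X t \<omega> \<le> \<Delta> \<omega>" unfolding \<Delta>_def using X_nonneg[of "Suc t" \<omega>] om by simp
      from pt[OF XI[OF True] this] show ?thesis using True by (simp add: \<Delta>_def)
    qed simp
  qed (intro Bochner_Integration.integrable_add i1 i2 i3)
  also have "\<dots> = (\<integral>\<omega>. indicator B \<omega> * u (X t \<omega>) * \<mu> \<omega> \<partial>M) + (\<integral>\<omega>. indicator B \<omega> * v (X t \<omega>) * \<nu> \<omega> \<partial>M)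
       + (\<integral>\<omega>. indicator B \<omega> * w (X t \<omega>) * \<bar>\<Delta> \<omega>\<bar> powr p \<partial>M)"
    using i1 i2 i3 by (simp add: m1 m2)
  also have "\<dots> \<le> (\<integral>\<omega>. indicator B \<omega> * ?u (X t \<omega>) \<partial>M) + (\<integral>\<omega>. indicator B \<omega> * ?v (X t \<omega>) \<partial>M)
       + (\<integral>\<omega>. indicator B \<omega> * ?w (X t \<omega>) \<partial>M)"
  proof (intro add_mono)
    show "(\<integral>\<omega>. indicator B \<omega> * u (X t \<omega>) * \<mu> \<omega> \<partial>M) \<le> (\<integral>\<omega>. indicator B \<omega> * ?u (X t \<omega>) \<partial>M)"
    proof (rule integral_mono_AE[OF m1(1) b1])
      show "AE \<omega> in M. indicator B \<omega> * u (X t \<omega>) * \<mu> \<omega> \<le> indicator B \<omega> * ?u (X t \<omega>)"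
        using drift
      proof eventually_elim
        case (elim \<omega>)
        then show ?case
          using abs_le[of "\<mu> \<omega>" "c / X t \<omega>" "e / (X t \<omega> * ln (X t \<omega>))" "u (X t \<omega>)"] XI[of \<omega>]
          by (cases "\<omega> \<in> B") (auto simp: \<mu>_def \<Delta>_def[abs_def])
      qed
    qed
    show "(\<integral>\<omega>. indicator B \<omega> * v (X t \<omega>) * \<nu> \<omega> \<partial>M) \<le> (\<integral>\<omega>. indicator B \<omega> * ?v (X t \<omega>) \<partial>M)"
    proof (rule integral_mono_AE[OF m2(1) b2])
      show "AE \<omega> in M. indicator B \<omega> * v (X t \<omega>) * \<nu> \<omega> \<le> indicator B \<omega> * ?v (X t \<omega>)"
        using var
      proof eventually_elim
        case (elim \<omega>)
        then show ?case
          using abs_le[of "\<nu> \<omega>" s2 "e / ln (X t \<omega>)" "v (X t \<omega>)"] XI[of \<omega>]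
          by (cases "\<omega> \<in> B") (auto simp: \<nu>_def \<Delta>_def[abs_def])
      qed
    qed
    show "(\<integral>\<omega>. indicator B \<omega> * w (X t \<omega>) * \<bar>\<Delta> \<omega>\<bar> powr p \<partial>M) \<le> (\<integral>\<omega>. indicator B \<omega> * ?w (X t \<omega>) \<partial>M)"
      unfolding \<Delta>_def by (rule jump_moment(2)) (auto simp: w)
  qed
  also have "\<dots> = (\<integral>\<omega>. indicator B \<omega> * ?u (X t \<omega>) + indicator B \<omega> * ?v (X t \<omega>) + indicator B \<omega> * ?w (X t \<omega>) \<partial>M)"
    using b1 b2 b3 by simp
  also have "\<dots> \<le> 0"
  proof -
    have "indicator B \<omega> * ?u (X t \<omega>) + indicator B \<omega> * ?v (X t \<omega>) + indicator B \<omega> * ?w (X t \<omega>) \<le> 0" for \<omega>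
      using neg[OF XI[of \<omega>]] by (cases "\<omega> \<in> B") auto
    then have "0 \<le> (\<integral>\<omega>. - (indicator B \<omega> * ?u (X t \<omega>) + indicator B \<omega> * ?v (X t \<omega>) + indicator B \<omega> * ?w (X t \<omega>)) \<partial>M)"
      by (intro integral_nonneg_AE AE_I2) (simp only: neg_0_le_iff_le)
    then show ?thesis by (simp only: integral_minus)
  qed
  finally show ?thesis .
qed

end

end

section \<open>The stopped process\<close>

lemma sum_shift_diff_le:
  fixes f :: "nat \<Rightarrow> real"
  assumes "\<And>t. 0 \<le> f t" "\<And>t. f t \<le> 1"
  shows "(\<Sum>t=1..n. f t - f (t + m)) \<le> real m"
proof (induction m)
  case (Suc m)
  have "(\<Sum>t=1..n. f (t + m) - f (Suc (t + m))) = f (1 + m) - f (Suc n + m)"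
    by (induction n) auto
  moreover have "f (1 + m) - f (Suc n + m) \<le> 1"
    using assms(1)[of "Suc n + m"] assms(2)[of "1 + m"] by linarith
  moreover have "(\<Sum>t=1..n. f t - f (t + Suc m)) = (\<Sum>t=1..n. f t - f (t + m)) + (\<Sum>t=1..n. f (t + m) - f (Suc (t + m)))"
    by (simp flip: sum.distrib)
  ultimately show ?case using Suc by simp
qed simp

context lamperti_process
begin

lemma space_F: "1 \<le> t \<Longrightarrow> space (F t) = space M"
  using F_sub unfolding subalgebra_def by auto

lemma X_adapted_le: "1 \<le> s \<Longrightarrow> s \<le> t \<Longrightarrow> X s \<in> borel_measurable (F t)"
  using X_adapted[of s] F_mono[of s t] space_F[of s] space_F[of t]
  unfolding measurable_def by auto

definition surv :: "nat \<Rightarrow> 'a set" where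
  "surv t = {\<omega> \<in> space M. \<forall>s\<in>{2..t}. X s \<omega> \<noteq> 0}"

lemma surv_F: "1 \<le> t \<Longrightarrow> surv t \<in> sets (F t)"
proof -
  assume t: "1 \<le> t"
  have "surv t = {\<omega> \<in> space (F t). \<forall>s\<in>{2..t}. X s \<omega> \<noteq> 0}"
    by (simp add: surv_def space_F[OF t])
  also have "\<dots> \<in> sets (F t)"
  proof (rule sets.sets_Collect_finite_All)
    fix s assume "s \<in> {2..t}"
    then have [measurable]: "X s \<in> borel_measurable (F t)" by (intro X_adapted_le) auto
    show "{\<omega> \<in> space (F t). X s \<omega> \<noteq> 0} \<in> sets (F t)" by measurable
  qed auto
  finally show ?thesis .
qed

lemma surv_meas [measurable]: "surv t \<in> sets M"
proof (cases "1 \<le> t")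
  case True then show ?thesis using surv_F F_sets by blast
next
  case False then show ?thesis by (simp add: surv_def)
qed

lemma surv_antimono: "s \<le> t \<Longrightarrow> surv t \<subseteq> surv s"
  by (auto simp: surv_def)

lemma irreducible:
  obtains m :: "real \<Rightarrow> real \<Rightarrow> nat" and \<phi> :: "real \<Rightarrow> real \<Rightarrow> real" where
    "\<And>x y. x \<in> S \<Longrightarrow> y \<in> S \<Longrightarrow> 1 \<le> m x y" "\<And>x y. x \<in> S \<Longrightarrow> y \<in> S \<Longrightarrow> 0 < \<phi> x y"
    "\<And>y t. y \<in> S \<Longrightarrow> 1 \<le> t \<Longrightarrow> {\<omega> \<in> space M. X (t + m (X t \<omega>) y) \<omega> = y} \<in> sets M"
    "\<And>y t B \<phi>0. y \<in> S \<Longrightarrow> 1 \<le> t \<Longrightarrow> B \<in> sets (F t) \<Longrightarrow> (\<And>\<omega>. \<omega> \<in> B \<Longrightarrow> \<phi>0 \<le> \<phi> (X t \<omega>) y) \<Longrightarrow>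
       \<phi>0 * prob B \<le> prob (B \<inter> {\<omega> \<in> space M. X (t + m (X t \<omega>) y) \<omega> = y})"
proof -
  obtain m :: "real \<Rightarrow> real \<Rightarrow> nat" and \<phi> :: "real \<Rightarrow> real \<Rightarrow> real" where
    pos: "\<forall>x\<in>S. \<forall>y\<in>S. 1 \<le> m x y \<and> 0 < \<phi> x y" and
    hit: "\<forall>y\<in>S. \<forall>t\<ge>1. AE \<omega> in M.
                 real_cond_exp M (F t)
                   (indicator {\<omega>' \<in> space M. X (t + m (X t \<omega>') y) \<omega>' = y}) \<omega>
                 \<ge> \<phi> (X t \<omega>) y"
    using A1 by blast
  define E where "E y t = {\<omega> \<in> space M. X (t + m (X t \<omega>) y) \<omega> = y}" for y t
  have E [measurable]: "E y t \<in> sets M" if t: "1 \<le> t" for y t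
  proof -
    have "E y t = (\<Union>x\<in>S. {\<omega> \<in> space M. X t \<omega> = x \<and> X (t + m x y) \<omega> = y})"
      using X_in_S[OF t] by (auto simp: E_def)
    also have "\<dots> \<in> sets M"
    proof (rule sets.countable_UN''[OF S_countable])
      fix x
      have [measurable]: "X t \<in> borel_measurable M" "X (t + m x y) \<in> borel_measurable M"
        using t by (auto intro!: X_measurable)
      show "{\<omega> \<in> space M. X t \<omega> = x \<and> X (t + m x y) \<omega> = y} \<in> sets M" by measurable
    qed
    finally show ?thesis .
  qed
  have main: "\<phi>0 * prob B \<le> prob (B \<inter> E y t)"
    if y: "y \<in> S" and t: "1 \<le> t" and B: "B \<in> sets (F t)" and le: "\<And>\<omega>. \<omega> \<in> B \<Longrightarrow> \<phi>0 \<le> \<phi> (X t \<omega>) y"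
    for y t B \<phi>0
  proof -
    note [measurable] = F_sets[OF t B] B E[OF t]
    interpret sigma_finite_subalgebra M "F t" by (rule F_sigma_finite[OF t])
    have i: "integrable M (\<lambda>\<omega>. indicator B \<omega> * indicator (E y t) \<omega> :: real)"
      by (rule integrable_const_bound[of _ 1]) (auto simp: indicator_def)
    note rc = real_cond_exp_intg[OF i]
    have "\<phi>0 * prob B = (\<integral>\<omega>. \<phi>0 * indicator B \<omega> \<partial>M)" by simp
    also have "\<dots> \<le> (\<integral>\<omega>. indicator B \<omega> * real_cond_exp M (F t) (indicator (E y t)) \<omega> \<partial>M)"
    proof (rule integral_mono_AE)
      show "integrable M (\<lambda>\<omega>. \<phi>0 * indicat_real B \<omega>)"
        by (intro integrable_mult_right integrable_const_bound[of _ 1]) auto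
      show "integrable M (\<lambda>\<omega>. indicat_real B \<omega> * real_cond_exp M (F t) (indicat_real (E y t)) \<omega>)"
        by (rule rc(1)) measurable
      show "AE \<omega> in M. \<phi>0 * indicat_real B \<omega> \<le> indicat_real B \<omega> * real_cond_exp M (F t) (indicat_real (E y t)) \<omega>"
        using hit[rule_format, OF y t] unfolding E_def[symmetric]
        by eventually_elim (use le in \<open>force simp: indicator_def\<close>)
    qed
    also have "\<dots> = (\<integral>\<omega>. indicator B \<omega> * indicator (E y t) \<omega> \<partial>M)"
      by (rule rc(2)) measurable
    also have "\<dots> = prob (B \<inter> E y t)" by (simp flip: indicator_inter_arith)
    finally show ?thesis .
  qed
  show thesis
    by (rule that[of m \<phi>]) (use pos main E in \<open>auto simp: E_def\<close>)
qed

text \<open>From a bounded set the process hits 0 within a bounded time with probability bounded below,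
  so the probabilities of being alive in that set are dominated by a telescoping sum.\<close>
lemma visits_bounded:
  "\<exists>V. \<forall>n. (\<Sum>t=1..n. prob {\<omega> \<in> surv t. X t \<omega> \<le> A}) \<le> V"
proof -
  obtain m :: "real \<Rightarrow> real \<Rightarrow> nat" and \<phi> :: "real \<Rightarrow> real \<Rightarrow> real" where
    m: "\<And>x y. x \<in> S \<Longrightarrow> y \<in> S \<Longrightarrow> 1 \<le> m x y" and \<phi>: "\<And>x y. x \<in> S \<Longrightarrow> y \<in> S \<Longrightarrow> 0 < \<phi> x y"
    and hit: "\<And>y t B \<phi>0. y \<in> S \<Longrightarrow> 1 \<le> t \<Longrightarrow> B \<in> sets (F t) \<Longrightarrow> (\<And>\<omega>. \<omega> \<in> B \<Longrightarrow> \<phi>0 \<le> \<phi> (X t \<omega>) y) \<Longrightarrow>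
       \<phi>0 * prob B \<le> prob (B \<inter> {\<omega> \<in> space M. X (t + m (X t \<omega>) y) \<omega> = y})"
    by (rule irreducible) blast
  define T where "T = {0..A} \<inter> S"
  have T: "finite T" unfolding T_def by (rule S_locfin) simp
  define m0 where "m0 = Max (insert 1 ((\<lambda>x. m x 0) ` T))"
  define \<phi>0 where "\<phi>0 = Min (insert 1 ((\<lambda>x. \<phi> x 0) ` T))"
  have \<phi>0: "\<phi>0 > 0" "\<And>x. x \<in> T \<Longrightarrow> \<phi>0 \<le> \<phi> x 0"
    using T \<phi> S_zero by (auto simp: \<phi>0_def T_def)
  have m0: "\<And>x. x \<in> T \<Longrightarrow> m x 0 \<le> m0" using T by (auto simp: m0_def)
  have XT: "X t \<omega> \<in> T" if "1 \<le> t" "\<omega> \<in> surv t" "X t \<omega> \<le> A" for t \<omega>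
    using that X_in_S X_nonneg by (auto simp: T_def surv_def)
  have step: "\<phi>0 * prob {\<omega> \<in> surv t. X t \<omega> \<le> A} \<le> prob (surv t) - prob (surv (t + m0))" if t: "1 \<le> t" for t
  proof -
    have [measurable]: "X t \<in> borel_measurable (F t)" "surv t \<in> sets (F t)"
      using X_adapted surv_F t by auto
    have "{\<omega> \<in> surv t. X t \<omega> \<le> A} = {\<omega> \<in> space (F t). \<omega> \<in> surv t \<and> X t \<omega> \<le> A}"
      using space_F[OF t] by (auto simp: surv_def)
    also have "\<dots> \<in> sets (F t)" by measurable
    finally have B: "{\<omega> \<in> surv t. X t \<omega> \<le> A} \<in> sets (F t)" .
    have "\<phi>0 * prob {\<omega> \<in> surv t. X t \<omega> \<le> A}
        \<le> prob ({\<omega> \<in> surv t. X t \<omega> \<le> A} \<inter> {\<omega> \<in> space M. X (t + m (X t \<omega>) 0) \<omega> = 0})"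
      by (rule hit[OF S_zero t B]) (use XT[OF t] \<phi>0 in auto)
    also have "\<dots> \<le> prob (surv t - surv (t + m0))"
    proof (rule finite_measure_mono)
      show "{\<omega> \<in> surv t. X t \<omega> \<le> A} \<inter> {\<omega> \<in> space M. X (t + m (X t \<omega>) 0) \<omega> = 0} \<subseteq> surv t - surv (t + m0)"
      proof safe
        fix \<omega> assume *: "\<omega> \<in> surv t" "X t \<omega> \<le> A" "X (t + m (X t \<omega>) 0) \<omega> = 0" "\<omega> \<in> surv (t + m0)"
        have "X t \<omega> \<in> T" using XT[OF t *(1,2)] .
        then have "1 \<le> m (X t \<omega>) 0" "m (X t \<omega>) 0 \<le> m0"
          using m0 m S_zero by (auto simp: T_def)
        then have "t + m (X t \<omega>) 0 \<in> {2..t + m0}" using t by auto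
        then show False using * unfolding surv_def by blast
      qed
    qed measurable
    also have "\<dots> = prob (surv t) - prob (surv (t + m0))"
      by (rule finite_measure_Diff) (auto intro: surv_antimono[THEN subsetD, rotated])
    finally show ?thesis .
  qed
  have "(\<Sum>t=1..n. prob {\<omega> \<in> surv t. X t \<omega> \<le> A}) \<le> real m0 / \<phi>0" for n
  proof -
    have "\<phi>0 * (\<Sum>t=1..n. prob {\<omega> \<in> surv t. X t \<omega> \<le> A}) \<le> (\<Sum>t=1..n. prob (surv t) - prob (surv (t + m0)))"
      unfolding sum_distrib_left by (intro sum_mono step) auto
    also have "\<dots> \<le> real m0" by (rule sum_shift_diff_le) auto
    finally show ?thesis using \<phi>0 by (simp add: field_simps)
  qed
  then show ?thesis by blast
qed

definition alive :: "real \<Rightarrow> nat \<Rightarrow> 'a set" where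
  "alive R t = {\<omega> \<in> surv t. \<forall>s\<in>{1..t}. X s \<omega> < R}"

definition peak :: "real \<Rightarrow> nat \<Rightarrow> 'a set" where
  "peak R t = (\<Union>s\<in>{1..t}. {\<omega> \<in> surv s. R \<le> X s \<omega>})"

text \<open>Since time starts at 1, index k corresponds to time k + 1.\<close>
primrec stopped :: "real \<Rightarrow> nat \<Rightarrow> 'a \<Rightarrow> real" where
  "stopped R 0 \<omega> = X 1 \<omega>"
| "stopped R (Suc k) \<omega> = (if \<omega> \<in> alive R (Suc k) then X (Suc (Suc k)) \<omega> else stopped R k \<omega>)"

lemma alive_F: "1 \<le> t \<Longrightarrow> alive R t \<in> sets (F t)"
proof -
  assume t: "1 \<le> t"
  have "alive R t = surv t \<inter> {\<omega> \<in> space (F t). \<forall>s\<in>{1..t}. X s \<omega> < R}"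
    by (auto simp: alive_def surv_def space_F[OF t])
  also have "\<dots> \<in> sets (F t)"
  proof (intro sets.Int surv_F t sets.sets_Collect_finite_All)
    fix s assume "s \<in> {1..t}"
    then have [measurable]: "X s \<in> borel_measurable (F t)" by (intro X_adapted_le) auto
    show "{\<omega> \<in> space (F t). X s \<omega> < R} \<in> sets (F t)" by measurable
  qed auto
  finally show ?thesis .
qed

lemma alive_Suc_meas [measurable]: "alive R (Suc k) \<in> sets M"
  by (rule F_sets[of "Suc k"]) (auto intro: alive_F)

lemma survX_meas: "1 \<le> s \<Longrightarrow> {\<omega> \<in> surv s. R \<le> X s \<omega>} \<in> sets M"
proof -
  assume "1 \<le> s"
  then have [measurable]: "X s \<in> borel_measurable M" by (rule X_measurable)
  have "{\<omega> \<in> surv s. R \<le> X s \<omega>} = {\<omega> \<in> space M. \<omega> \<in> surv s \<and> R \<le> X s \<omega>}" by (auto simp: surv_def)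
  also have "\<dots> \<in> sets M" by measurable
  finally show ?thesis .
qed

lemma peak_meas [measurable]: "peak R t \<in> sets M"
  unfolding peak_def by (intro sets.finite_UN survX_meas) auto

lemma stopped_meas [measurable]: "stopped R k \<in> borel_measurable M"
proof (induction k)
  case 0
  have "stopped R 0 = X 1" by (simp add: fun_eq_iff)
  then show ?case by (simp add: X_measurable)
next
  case (Suc k)
  note [measurable] = Suc
  have [measurable]: "X (Suc (Suc k)) \<in> borel_measurable M" by (rule X_measurable) simp
  have "stopped R (Suc k) = (\<lambda>\<omega>. if \<omega> \<in> alive R (Suc k) then X (Suc (Suc k)) \<omega> else stopped R k \<omega>)"
    by (simp add: fun_eq_iff)
  also have "\<dots> \<in> borel_measurable M" by measurable
  finally show ?case .
qed

lemma stopped_alive: "\<omega> \<in> alive R (Suc k) \<Longrightarrow> stopped R k \<omega> = X (Suc k) \<omega>"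
  by (cases k) (auto simp: alive_def surv_def)

lemma peak_mono: "s \<le> t \<Longrightarrow> peak R s \<subseteq> peak R t"
  unfolding peak_def by (rule UN_mono) auto

lemma alive_not_peak: "\<omega> \<in> surv t \<Longrightarrow> \<omega> \<notin> peak R t \<Longrightarrow> \<omega> \<in> alive R t"
proof -
  assume *: "\<omega> \<in> surv t" "\<omega> \<notin> peak R t"
  have "X s \<omega> < R" if "s \<in> {1..t}" for s
  proof -
    have "\<omega> \<in> surv s" using surv_antimono[of s t] that * by auto
    then show ?thesis using * that by (force simp: peak_def)
  qed
  then show ?thesis using * by (auto simp: alive_def)
qed

lemma stopped_peak: "\<omega> \<in> peak R (Suc k) \<Longrightarrow> R \<le> stopped R k \<omega>"
proof (induction k)
  case 0 then show ?case by (auto simp: peak_def)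
next
  case (Suc k)
  show ?case
  proof (cases "\<omega> \<in> peak R (Suc k)")
    case True
    then have "\<omega> \<notin> alive R (Suc k)" by (force simp: peak_def alive_def)
    then show ?thesis using Suc.IH[OF True] by simp
  next
    case False
    with Suc.prems have "\<omega> \<in> surv (Suc (Suc k))" "R \<le> X (Suc (Suc k)) \<omega>"
      by (auto simp: peak_def le_Suc_eq)
    moreover have "\<omega> \<in> alive R (Suc k)"
      using False calculation surv_antimono[of "Suc k" "Suc (Suc k)"] by (intro alive_not_peak) auto
    ultimately show ?thesis by simp
  qed
qed

lemma stopped_cases:
  assumes "\<omega> \<in> space M"
  shows "\<omega> \<in> alive R (Suc k) \<or> \<omega> \<in> peak R (Suc k) \<or> stopped R k \<omega> = 0"
proof (induction k)
  case 0
  have "\<omega> \<in> surv (Suc 0)" using assms by (auto simp: surv_def)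
  then show ?case using alive_not_peak[of \<omega> "Suc 0" R] by blast
next
  case (Suc k)
  show ?case
  proof (cases "\<omega> \<in> alive R (Suc k)")
    case True
    show ?thesis
    proof (cases "X (Suc (Suc k)) \<omega> = 0")
      case False
      then have "\<omega> \<in> surv (Suc (Suc k))"
        using True by (auto simp: alive_def surv_def le_Suc_eq)
      then show ?thesis using alive_not_peak by blast
    qed (use True in simp)
  next
    case False
    then show ?thesis using Suc peak_mono[of "Suc k" "Suc (Suc k)" R] by auto
  qed
qed

lemma expectation_stopped_Suc:
  assumes [measurable]: "h \<in> borel_measurable borel"
    and int: "\<And>k. integrable M (\<lambda>\<omega>. indicator (alive R (Suc k)) \<omega> * (h (X (Suc (Suc k)) \<omega>) - h (X (Suc k) \<omega>) :: real))"
  shows "integrable M (\<lambda>\<omega>. h (stopped R k \<omega>))"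
    and "(\<integral>\<omega>. h (stopped R (Suc k) \<omega>) \<partial>M) = (\<integral>\<omega>. h (stopped R k \<omega>) \<partial>M)
      + (\<integral>\<omega>. indicator (alive R (Suc k)) \<omega> * (h (X (Suc (Suc k)) \<omega>) - h (X (Suc k) \<omega>)) \<partial>M)"
proof -
  have eq: "h (stopped R (Suc k) \<omega>) = h (stopped R k \<omega>)
      + indicator (alive R (Suc k)) \<omega> * (h (X (Suc (Suc k)) \<omega>) - h (X (Suc k) \<omega>))" for k \<omega>
    using stopped_alive[of \<omega> R k] by simp
  have i: "integrable M (\<lambda>\<omega>. h (stopped R k \<omega>))" for k
  proof (induction k)
    case 0
    have "integrable M (\<lambda>\<omega>. h 0)" by simp
    then show ?case
    proof (rule Bochner_Integration.integrable_cong_AE_imp)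
      show "AE \<omega> in M. h 0 = h (stopped R 0 \<omega>)" using X_start by eventually_elim simp
    qed measurable
  next
    case (Suc k)
    show ?case unfolding eq by (intro Bochner_Integration.integrable_add Suc int)
  qed
  show "integrable M (\<lambda>\<omega>. h (stopped R k \<omega>))" by (rule i)
  show "(\<integral>\<omega>. h (stopped R (Suc k) \<omega>) \<partial>M) = (\<integral>\<omega>. h (stopped R k \<omega>) \<partial>M)
      + (\<integral>\<omega>. indicator (alive R (Suc k)) \<omega> * (h (X (Suc (Suc k)) \<omega>) - h (X (Suc k) \<omega>)) \<partial>M)"
    unfolding eq by (intro Bochner_Integration.integral_add i int)
qed

end

section \<open>Upper tail bound and recurrence\<close>

context lamperti_process
begin

lemma alive_below:
  "\<omega> \<in> alive R (Suc k) \<Longrightarrow> X (Suc k) \<omega> \<le> R"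
  by (force simp: alive_def)

lemma alive_subset_surv: "alive R t \<subseteq> surv t"
  by (auto simp: alive_def)

lemma alive_lower_F: "{\<omega> \<in> alive R (Suc k). A \<le> X (Suc k) \<omega>} \<in> sets (F (Suc k))"
  and alive_upper_F: "{\<omega> \<in> alive R (Suc k). X (Suc k) \<omega> < A} \<in> sets (F (Suc k))"
proof -
  have [measurable]: "X (Suc k) \<in> borel_measurable (F (Suc k))" "alive R (Suc k) \<in> sets (F (Suc k))"
    using X_adapted alive_F by auto
  have sub: "alive R (Suc k) \<subseteq> space (F (Suc k))" using sets.sets_into_space[OF \<open>alive R (Suc k) \<in> _\<close>] .
  have "{\<omega> \<in> alive R (Suc k). A \<le> X (Suc k) \<omega>} = {\<omega> \<in> space (F (Suc k)). \<omega> \<in> alive R (Suc k) \<and> A \<le> X (Suc k) \<omega>}"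
    using sub by auto
  also have "\<dots> \<in> sets (F (Suc k))" by measurable
  finally show "{\<omega> \<in> alive R (Suc k). A \<le> X (Suc k) \<omega>} \<in> sets (F (Suc k))" .
  have "{\<omega> \<in> alive R (Suc k). X (Suc k) \<omega> < A} = {\<omega> \<in> space (F (Suc k)). \<omega> \<in> alive R (Suc k) \<and> X (Suc k) \<omega> < A}"
    using sub by auto
  also have "\<dots> \<in> sets (F (Suc k))" by measurable
  finally show "{\<omega> \<in> alive R (Suc k). X (Suc k) \<omega> < A} \<in> sets (F (Suc k))" .
qed

lemma A2_threshold:
  assumes "0 < e"
  obtains x0 where
    "\<And>t. 1 \<le> t \<Longrightarrow> AE \<omega> in M. x0 \<le> X t \<omega> \<longrightarrow>
              \<bar>real_cond_exp M (F t) (\<lambda>\<omega>'. X (Suc t) \<omega>' - X t \<omega>') \<omega> - c / X t \<omega>\<bar>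
                \<le> e / (X t \<omega> * ln (X t \<omega>))"
    "\<And>t. 1 \<le> t \<Longrightarrow> AE \<omega> in M. x0 \<le> X t \<omega> \<longrightarrow>
              \<bar>real_cond_exp M (F t) (\<lambda>\<omega>'. (X (Suc t) \<omega>' - X t \<omega>')\<^sup>2) \<omega> - s2\<bar>
                \<le> e / ln (X t \<omega>)"
proof -
  obtain x1 where x1: "\<forall>t\<ge>1. AE \<omega> in M. x1 \<le> X t \<omega> \<longrightarrow>
              \<bar>real_cond_exp M (F t) (\<lambda>\<omega>'. X (Suc t) \<omega>' - X t \<omega>') \<omega> - c / X t \<omega>\<bar>
                \<le> e / (X t \<omega> * ln (X t \<omega>))"
    using A2_drift[OF assms] by blast
  obtain x2 where x2: "\<forall>t\<ge>1. AE \<omega> in M. x2 \<le> X t \<omega> \<longrightarrow>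
              \<bar>real_cond_exp M (F t) (\<lambda>\<omega>'. (X (Suc t) \<omega>' - X t \<omega>')\<^sup>2) \<omega> - s2\<bar>
                \<le> e / ln (X t \<omega>)"
    using A2_var[OF assms] by blast
  show thesis
  proof (rule that[of "max x1 x2"])
    fix t :: nat assume t: "1 \<le> t"
    show "AE \<omega> in M. max x1 x2 \<le> X t \<omega> \<longrightarrow>
              \<bar>real_cond_exp M (F t) (\<lambda>\<omega>'. X (Suc t) \<omega>' - X t \<omega>') \<omega> - c / X t \<omega>\<bar>
                \<le> e / (X t \<omega> * ln (X t \<omega>))"
      using x1[rule_format, OF t] by eventually_elim simp
    show "AE \<omega> in M. max x1 x2 \<le> X t \<omega> \<longrightarrow>
              \<bar>real_cond_exp M (F t) (\<lambda>\<omega>'. (X (Suc t) \<omega>' - X t \<omega>')\<^sup>2) \<omega> - s2\<bar>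
                \<le> e / ln (X t \<omega>)"
      using x2[rule_format, OF t] by eventually_elim simp
  qed
qed

lemma peak_upper_bound:
  obtains K R0 where "\<And>R t. R0 \<le> R \<Longrightarrow> powlog a (-1) R * prob (peak R t) \<le> K"
proof -
  obtain b A0 e where b: "3 \<le> b" "b \<le> A0" and e: "0 < e" and
    mono: "\<And>x y. b \<le> x \<Longrightarrow> x \<le> y \<Longrightarrow> powlog a (-1) x \<le> powlog a (-1) y" and
    dd: "drift_dominated c s2 p \<delta> C e {A0..} (\<lambda>z. powlog a (-1) (max z b))"
    by (rule powlog_super[OF a_pos s2_pos c_eq p_gt2 a_le_p \<delta>_pos C_nonneg]) blast
  obtain x0 where
    x0: "\<And>t. 1 \<le> t \<Longrightarrow> AE \<omega> in M. x0 \<le> X t \<omega> \<longrightarrow>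
              \<bar>real_cond_exp M (F t) (\<lambda>\<omega>'. X (Suc t) \<omega>' - X t \<omega>') \<omega> - c / X t \<omega>\<bar>
                \<le> e / (X t \<omega> * ln (X t \<omega>))"
    "\<And>t. 1 \<le> t \<Longrightarrow> AE \<omega> in M. x0 \<le> X t \<omega> \<longrightarrow>
              \<bar>real_cond_exp M (F t) (\<lambda>\<omega>'. (X (Suc t) \<omega>' - X t \<omega>')\<^sup>2) \<omega> - s2\<bar>
                \<le> e / ln (X t \<omega>)"
    by (rule A2_threshold[OF e]) blast
  define A where "A = max A0 x0"
  have A: "A0 \<le> A" "x0 \<le> A" "3 \<le> A" using b by (auto simp: A_def)
  have ddA: "drift_dominated c s2 p \<delta> C e {A..} (\<lambda>z. powlog a (-1) (max z b))"
    using dd A unfolding drift_dominated_def by (meson atLeast_iff order_trans)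
  define h where "h z = powlog a (-1) (max z b)" for z
  have [measurable]: "h \<in> borel_measurable borel" unfolding h_def by measurable
  have h0: "0 \<le> h z" for z by (simp add: h_def powlog_nonneg)
  have h_growth: "h (x + d) \<le> 2 powr p * (b + Q) powr p * (1 + \<bar>d\<bar> powr p)" if "0 \<le> x" "x \<le> Q" for x d Q
  proof -
    define z where "z = max (x + d) b"
    have z: "3 \<le> z" "z \<le> (b + Q) + \<bar>d\<bar>" using b that by (auto simp: z_def)
    have "exp 1 \<le> z" using e_less_272 z by simp
    then have "1 \<le> ln z" using z by (subst ln_ge_iff) auto
    then have "ln z powr (-1) \<le> 1" by (simp add: powr_minus_divide)
    then have "powlog a (-1) z \<le> z powr a * 1"
      unfolding powlog_def by (intro mult_left_mono) auto
    also have "\<dots> \<le> z powr p" using z a_le_p by (simp add: powr_mono)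
    also have "\<dots> \<le> ((b + Q) + \<bar>d\<bar>) powr p" using z p_gt2 by (intro powr_mono2) auto
    also have "\<dots> \<le> (2 * max (b + Q) \<bar>d\<bar>) powr p" using z p_gt2 b that by (intro powr_mono2) (auto simp: max_def)
    also have "\<dots> = 2 powr p * max (b + Q) \<bar>d\<bar> powr p" by (simp add: powr_mult)
    also have "\<dots> \<le> 2 powr p * ((b + Q) powr p * (1 + \<bar>d\<bar> powr p))"
    proof (intro mult_left_mono)
      have "1 powr p \<le> (b + Q) powr p" using b that p_gt2 by (intro powr_mono2) auto
      then have "\<bar>d\<bar> powr p \<le> (b + Q) powr p * \<bar>d\<bar> powr p" using mult_right_mono[of 1 "(b + Q) powr p" "\<bar>d\<bar> powr p"] by simp
      then show "max (b + Q) \<bar>d\<bar> powr p \<le> (b + Q) powr p * (1 + \<bar>d\<bar> powr p)"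
        by (simp add: max_def algebra_simps add_increasing)
    qed simp
    finally show ?thesis by (simp add: h_def z_def)
  qed
  define q where "q = p - 2 - \<delta>"
  define K0 where "K0 = 2 powr p * (b + A) powr p"
  define K1 where "K1 = K0 * (1 + C * (1 + A) powr \<bar>q\<bar>)"
  have K: "0 \<le> K0" "0 \<le> K1" using C_nonneg by (auto simp: K0_def K1_def)
  obtain V where V: "\<And>n. (\<Sum>t=1..n. prob {\<omega> \<in> surv t. X t \<omega> \<le> A}) \<le> V"
    using visits_bounded[of A] by blast
  have main: "powlog a (-1) R * prob (peak R (Suc k)) \<le> h 0 + K1 * V" if R: "b \<le> R" for R k
  proof -
    let ?inc = "\<lambda>k \<omega>. h (X (Suc (Suc k)) \<omega>) - h (X (Suc k) \<omega>)"
    have intB: "integrable M (\<lambda>\<omega>. indicator B \<omega> * ?inc k \<omega>)"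
      if B: "B \<in> sets (F (Suc k))" "B \<subseteq> alive R (Suc k)" for B k
    proof -
      have le: "\<And>\<omega>. \<omega> \<in> B \<Longrightarrow> X (Suc k) \<omega> \<le> R" using B alive_below by blast
      have [measurable]: "X (Suc (Suc k)) \<in> borel_measurable M" by (rule X_measurable) simp
      have Bs: "\<omega> \<in> space M" if "\<omega> \<in> B" for \<omega> using B that by (auto simp: alive_def surv_def)
      have "integrable M (\<lambda>\<omega>. indicator B \<omega> * h (X (Suc (Suc k)) \<omega>))"
      proof (rule jump_integrable[OF _ B(1) le, of "\<lambda>\<omega>. h (X (Suc (Suc k)) \<omega>)" "2 powr p * (b + R) powr p"])
        fix \<omega> assume "\<omega> \<in> B"
        then show "\<bar>h (X (Suc (Suc k)) \<omega>)\<bar> \<le> 2 powr p * (b + R) powr p * (1 + \<bar>X (Suc (Suc k)) \<omega> - X (Suc k) \<omega>\<bar> powr p)"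
          using h_growth[of "X (Suc k) \<omega>" R "X (Suc (Suc k)) \<omega> - X (Suc k) \<omega>"] le[of \<omega>] Bs[of \<omega>] X_nonneg[of "Suc k" \<omega>] h0 by simp
      qed auto
      moreover have "integrable M (\<lambda>\<omega>. indicator B \<omega> * h (X (Suc k) \<omega>))"
        by (rule bounded_integrable[OF _ B(1) le]) auto
      ultimately have "integrable M (\<lambda>\<omega>. indicator B \<omega> * h (X (Suc (Suc k)) \<omega>) - indicator B \<omega> * h (X (Suc k) \<omega>))"
        by (rule Bochner_Integration.integrable_diff)
      then show ?thesis by (simp add: right_diff_distrib)
    qed
    have int: "integrable M (\<lambda>\<omega>. indicator (alive R (Suc k)) \<omega> * ?inc k \<omega>)" for k
      by (rule intB[OF alive_F]) auto
    have step: "(\<integral>\<omega>. indicator (alive R (Suc k)) \<omega> * ?inc k \<omega> \<partial>M) \<le> K1 * prob {\<omega> \<in> surv (Suc k). X (Suc k) \<omega> \<le> A}" for k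
    proof -
      let ?B1 = "{\<omega> \<in> alive R (Suc k). A \<le> X (Suc k) \<omega>}"
      let ?B2 = "{\<omega> \<in> alive R (Suc k). X (Suc k) \<omega> < A}"
      have i1: "integrable M (\<lambda>\<omega>. indicator ?B1 \<omega> * ?inc k \<omega>)" by (rule intB[OF alive_lower_F]) auto
      have i2: "integrable M (\<lambda>\<omega>. indicator ?B2 \<omega> * ?inc k \<omega>)" by (rule intB[OF alive_upper_F]) auto
      have s: "1 \<le> Suc k" by simp
      have B2M [measurable]: "?B2 \<in> sets M" using F_sets[OF s alive_upper_F] .
      have b1: "(\<integral>\<omega>. indicator ?B1 \<omega> * ?inc k \<omega> \<partial>M) \<le> 0"
      proof (rule expected_increment_nonpos[OF s alive_lower_F _ ddA[folded h_def]])
        show "AE \<omega> in M. X (Suc k) \<omega> \<in> {A..} \<longrightarrow> \<bar>real_cond_exp M (F (Suc k)) (\<lambda>\<omega>'. X (Suc (Suc k)) \<omega>' - X (Suc k) \<omega>') \<omega> - c / X (Suc k) \<omega>\<bar>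
                \<le> e / (X (Suc k) \<omega> * ln (X (Suc k) \<omega>))"
          using x0(1)[OF s] by eventually_elim (use A in auto)
        show "AE \<omega> in M. X (Suc k) \<omega> \<in> {A..} \<longrightarrow> \<bar>real_cond_exp M (F (Suc k)) (\<lambda>\<omega>'. (X (Suc (Suc k)) \<omega>' - X (Suc k) \<omega>')\<^sup>2) \<omega> - s2\<bar>
                \<le> e / ln (X (Suc k) \<omega>)"
          using x0(2)[OF s] by eventually_elim (use A in auto)
      qed (use i1 alive_below in auto)
      have le2: "\<And>\<omega>. \<omega> \<in> ?B2 \<Longrightarrow> X (Suc k) \<omega> \<le> A" by auto
      have im: "integrable M (\<lambda>\<omega>. indicator ?B2 \<omega> * K0 * \<bar>X (Suc (Suc k)) \<omega> - X (Suc k) \<omega>\<bar> powr p)"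
        by (rule jump_moment(1)[OF s alive_upper_F le2]) (use K in auto)
      have "(\<integral>\<omega>. indicator ?B2 \<omega> * ?inc k \<omega> \<partial>M)
         \<le> (\<integral>\<omega>. indicator ?B2 \<omega> * K0 + indicator ?B2 \<omega> * K0 * \<bar>X (Suc (Suc k)) \<omega> - X (Suc k) \<omega>\<bar> powr p \<partial>M)"
      proof (rule integral_mono[OF i2])
        show "integrable M (\<lambda>\<omega>. indicator ?B2 \<omega> * K0 + indicator ?B2 \<omega> * K0 * \<bar>X (Suc (Suc k)) \<omega> - X (Suc k) \<omega>\<bar> powr p)"
          by (intro Bochner_Integration.integrable_add im bounded_integrable[OF s alive_upper_F le2]) auto
        fix \<omega> assume "\<omega> \<in> space M"
        then show "indicator ?B2 \<omega> * ?inc k \<omega> \<le> indicator ?B2 \<omega> * K0 + indicator ?B2 \<omega> * K0 * \<bar>X (Suc (Suc k)) \<omega> - X (Suc k) \<omega>\<bar> powr p"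
          using h_growth[of "X (Suc k) \<omega>" A "X (Suc (Suc k)) \<omega> - X (Suc k) \<omega>"] h0[of "X (Suc k) \<omega>"] X_nonneg[of "Suc k" \<omega>]
          by (cases "\<omega> \<in> ?B2") (auto simp: K0_def algebra_simps)
      qed
      also have "\<dots> = (\<integral>\<omega>. indicator ?B2 \<omega> * K0 \<partial>M) + (\<integral>\<omega>. indicator ?B2 \<omega> * K0 * \<bar>X (Suc (Suc k)) \<omega> - X (Suc k) \<omega>\<bar> powr p \<partial>M)"
        by (intro Bochner_Integration.integral_add im bounded_integrable[OF s alive_upper_F le2]) auto
      also have "(\<integral>\<omega>. indicator ?B2 \<omega> * K0 * \<bar>X (Suc (Suc k)) \<omega> - X (Suc k) \<omega>\<bar> powr p \<partial>M)
         \<le> (\<integral>\<omega>. indicator ?B2 \<omega> * (K0 * (C * (1 + X (Suc k) \<omega>) powr (p - 2 - \<delta>))) \<partial>M)"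
        by (rule jump_moment(2)[OF s alive_upper_F le2]) (use K in auto)
      also have "\<dots> \<le> (\<integral>\<omega>. indicator ?B2 \<omega> * (K0 * (C * (1 + A) powr \<bar>q\<bar>)) \<partial>M)"
      proof (rule integral_mono)
        show "integrable M (\<lambda>\<omega>. indicator ?B2 \<omega> * (K0 * (C * (1 + X (Suc k) \<omega>) powr (p - 2 - \<delta>))))"
          by (rule bounded_integrable[OF s alive_upper_F le2]) auto
        show "integrable M (\<lambda>\<omega>. indicator ?B2 \<omega> * (K0 * (C * (1 + A) powr \<bar>q\<bar>)))"
          by (rule bounded_integrable[OF s alive_upper_F le2]) auto
        fix \<omega> assume om: "\<omega> \<in> space M"
        show "indicator ?B2 \<omega> * (K0 * (C * (1 + X (Suc k) \<omega>) powr (p - 2 - \<delta>))) \<le> indicator ?B2 \<omega> * (K0 * (C * (1 + A) powr \<bar>q\<bar>))"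
        proof (cases "\<omega> \<in> ?B2")
          case True
          have "(1 + X (Suc k) \<omega>) powr q \<le> (1 + X (Suc k) \<omega>) powr \<bar>q\<bar>"
            using X_nonneg[of "Suc k" \<omega>] om by (intro powr_mono) auto
          also have "\<dots> \<le> (1 + A) powr \<bar>q\<bar>" using True X_nonneg[of "Suc k" \<omega>] om by (intro powr_mono2) auto
          finally have "(1 + X (Suc k) \<omega>) powr q \<le> (1 + A) powr \<bar>q\<bar>" .
          then have "K0 * (C * (1 + X (Suc k) \<omega>) powr (p - 2 - \<delta>)) \<le> K0 * (C * (1 + A) powr \<bar>q\<bar>)"
            using K C_nonneg by (intro mult_left_mono) (auto simp: q_def)
          then show ?thesis using True by simp
        qed simp
      qed
      finally have b2: "(\<integral>\<omega>. indicator ?B2 \<omega> * ?inc k \<omega> \<partial>M) \<le> K1 * prob ?B2"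
        by (simp add: K1_def algebra_simps)
      have "(\<integral>\<omega>. indicator (alive R (Suc k)) \<omega> * ?inc k \<omega> \<partial>M)
         = (\<integral>\<omega>. indicator ?B1 \<omega> * ?inc k \<omega> + indicator ?B2 \<omega> * ?inc k \<omega> \<partial>M)"
        by (intro Bochner_Integration.integral_cong) (auto simp: indicator_def)
      also have "\<dots> = (\<integral>\<omega>. indicator ?B1 \<omega> * ?inc k \<omega> \<partial>M) + (\<integral>\<omega>. indicator ?B2 \<omega> * ?inc k \<omega> \<partial>M)"
        by (rule Bochner_Integration.integral_add[OF i1 i2])
      also have "\<dots> \<le> K1 * prob ?B2" using b1 b2 by simp
      also have "\<dots> \<le> K1 * prob {\<omega> \<in> surv (Suc k). X (Suc k) \<omega> \<le> A}"
      proof (intro mult_left_mono finite_measure_mono K)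
        have [measurable]: "X (Suc k) \<in> borel_measurable M" by (rule X_measurable) simp
        have "{\<omega> \<in> surv (Suc k). X (Suc k) \<omega> \<le> A} = {\<omega> \<in> space M. \<omega> \<in> surv (Suc k) \<and> X (Suc k) \<omega> \<le> A}"
          by (auto simp: surv_def)
        also have "\<dots> \<in> sets M" by measurable
        finally show "{\<omega> \<in> surv (Suc k). X (Suc k) \<omega> \<le> A} \<in> sets M" .
      qed (use alive_subset_surv in fastforce)
      finally show ?thesis .
    qed
    note st = expectation_stopped_Suc[where h = h and R = R, OF \<open>h \<in> borel_measurable borel\<close> int]
    have "(\<integral>\<omega>. h (stopped R k \<omega>) \<partial>M) \<le> h 0 + K1 * (\<Sum>t=1..k. prob {\<omega> \<in> surv t. X t \<omega> \<le> A})" for k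
    proof (induction k)
      case 0
      have "(\<integral>\<omega>. h (stopped R 0 \<omega>) \<partial>M) = (\<integral>\<omega>. h 0 \<partial>M)"
        by (rule integral_cong_AE) (use X_start in \<open>auto elim: eventually_mono intro!: X_measurable\<close>)
      then show ?case by (simp add: prob_space)
    next
      case (Suc k)
      show ?case using Suc step[of k] unfolding st(2) by (simp add: algebra_simps)
    qed
    then have "(\<integral>\<omega>. h (stopped R k \<omega>) \<partial>M) \<le> h 0 + K1 * (\<Sum>t=1..k. prob {\<omega> \<in> surv t. X t \<omega> \<le> A})" .
    also have "\<dots> \<le> h 0 + K1 * V" using V K by (intro add_left_mono mult_left_mono) auto
    finally have E: "(\<integral>\<omega>. h (stopped R k \<omega>) \<partial>M) \<le> h 0 + K1 * V" .
    have "powlog a (-1) R * prob (peak R (Suc k)) = (\<integral>\<omega>. powlog a (-1) R * indicator (peak R (Suc k)) \<omega> \<partial>M)"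
      by simp
    also have "\<dots> \<le> (\<integral>\<omega>. h (stopped R k \<omega>) \<partial>M)"
    proof (rule integral_mono)
      show "integrable M (\<lambda>\<omega>. powlog a (-1) R * indicat_real (peak R (Suc k)) \<omega>)"
        by (intro integrable_mult_right integrable_const_bound[of _ 1]) auto
      show "integrable M (\<lambda>\<omega>. h (stopped R k \<omega>))" by (rule st(1))
      fix \<omega> show "powlog a (-1) R * indicat_real (peak R (Suc k)) \<omega> \<le> h (stopped R k \<omega>)"
        using mono[OF R] stopped_peak[of \<omega> R k] h0 R
        by (cases "\<omega> \<in> peak R (Suc k)") (auto simp: h_def)
    qed
    finally show ?thesis using E by simp
  qed
  have "0 \<le> h 0 + K1 * V" using main[of b 0] powlog_nonneg[of a "-1" b]
    by (smt (verit) measure_nonneg mult_nonneg_nonneg order_refl)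
  then have "powlog a (-1) R * prob (peak R t) \<le> h 0 + K1 * V" if "b \<le> R" for R t
    using main[OF that, of "t - 1"] by (cases t) (auto simp: peak_def)
  then show thesis using that by blast
qed

definition exc_above :: "real \<Rightarrow> 'a set" where
  "exc_above R = (\<Union>t\<in>{1..}. {\<omega> \<in> surv t. R \<le> X t \<omega>})"

lemma exc_above_eq: "exc_above R = (\<Union>t. peak R t)"
proof (intro equalityI subsetI)
  fix \<omega> assume "\<omega> \<in> exc_above R"
  then obtain t where "1 \<le> t" "\<omega> \<in> surv t" "R \<le> X t \<omega>" by (auto simp: exc_above_def)
  then have "\<omega> \<in> peak R t" by (auto simp: peak_def)
  then show "\<omega> \<in> (\<Union>t. peak R t)" by blast
qed (auto simp: exc_above_def peak_def)

lemma exc_above_meas [measurable]: "exc_above R \<in> sets M"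
  unfolding exc_above_eq by measurable

lemma peak_le_exc_above: "prob (peak R t) \<le> prob (exc_above R)"
  by (rule finite_measure_mono) (auto simp: exc_above_eq)

lemma exc_above_upper_bound:
  obtains K R0 where "\<And>R. R0 \<le> R \<Longrightarrow> powlog a (-1) R * prob (exc_above R) \<le> K"
proof -
  obtain K R0 where K: "\<And>R t. R0 \<le> R \<Longrightarrow> powlog a (-1) R * prob (peak R t) \<le> K"
    by (rule peak_upper_bound) blast
  show thesis
  proof (rule that)
    fix R assume R: "R0 \<le> R"
    have "(\<lambda>t. prob (peak R t)) \<longlonglongrightarrow> prob (exc_above R)"
      unfolding exc_above_eq
      by (intro finite_Lim_measure_incseq) (simp_all add: incseq_def peak_mono image_subset_iff)
    then have "(\<lambda>t. powlog a (-1) R * prob (peak R t)) \<longlonglongrightarrow> powlog a (-1) R * prob (exc_above R)"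
      by (intro tendsto_intros)
    then show "powlog a (-1) R * prob (exc_above R) \<le> K"
      by (rule LIMSEQ_le_const2) (use K[OF R] in auto)
  qed
qed

lemma exc_above_tendsto_0: "((\<lambda>R. prob (exc_above R)) \<longlongrightarrow> 0) at_top"
proof -
  obtain K R0 where K: "\<And>R. R0 \<le> R \<Longrightarrow> powlog a (-1) R * prob (exc_above R) \<le> K"
    by (rule exc_above_upper_bound) blast
  have lim: "((\<lambda>R. K / powlog a (-1) R) \<longlongrightarrow> 0) at_top"
    unfolding powlog_def using a_pos by real_asymp
  show ?thesis
  proof (rule tendsto_sandwich[OF _ _ tendsto_const lim])
    show "eventually (\<lambda>R. prob (exc_above R) \<le> K / powlog a (-1) R) at_top"
      using eventually_ge_at_top[of R0] eventually_gt_at_top[of 1]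
    proof eventually_elim
      case (elim R)
      then have "0 < powlog a (-1) R" by (simp add: powlog_def)
      then show ?case using K[OF elim(1)] by (simp add: field_simps)
    qed
  qed simp
qed

lemma surv_tendsto_0: "(\<lambda>t. prob (surv t)) \<longlonglongrightarrow> 0"
proof (rule LIMSEQ_I)
  fix \<epsilon> :: real assume "0 < \<epsilon>"
  then have "eventually (\<lambda>R. prob (exc_above R) < \<epsilon> / 2) at_top"
    using order_tendstoD(2)[OF exc_above_tendsto_0, of "\<epsilon> / 2"] by simp
  then obtain R where R: "prob (exc_above R) < \<epsilon> / 2"
    using eventually_happens[of _ at_top] trivial_limit_at_top_linorder by (metis (no_types, lifting))
  obtain V where V: "\<And>n. (\<Sum>t=1..n. prob {\<omega> \<in> surv t. X t \<omega> \<le> R}) \<le> V"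
    using visits_bounded[of R] by blast
  have "summable (\<lambda>t. prob {\<omega> \<in> surv (Suc t). X (Suc t) \<omega> \<le> R})"
  proof (rule summableI_nonneg_bounded)
    fix n
    have "(\<Sum>i<n. prob {\<omega> \<in> surv (Suc i). X (Suc i) \<omega> \<le> R}) = (\<Sum>t=1..n. prob {\<omega> \<in> surv t. X t \<omega> \<le> R})"
      by (rule sum.reindex_bij_witness[of _ "\<lambda>t. t - 1" Suc]) auto
    then show "(\<Sum>i<n. prob {\<omega> \<in> surv (Suc i). X (Suc i) \<omega> \<le> R}) \<le> V" using V by simp
  qed auto
  then have "(\<lambda>t. prob {\<omega> \<in> surv (Suc t). X (Suc t) \<omega> \<le> R}) \<longlonglongrightarrow> 0" by (rule summable_LIMSEQ_zero)
  then obtain n0 where n0: "\<And>n. n \<ge> n0 \<Longrightarrow> prob {\<omega> \<in> surv (Suc n). X (Suc n) \<omega> \<le> R} < \<epsilon> / 2"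
    using \<open>0 < \<epsilon>\<close> LIMSEQ_D[of _ 0 "\<epsilon> / 2"] by (fastforce simp: abs_less_iff)
  have "prob (surv (Suc n)) < \<epsilon>" if "n \<ge> n0" for n
  proof -
    have [measurable]: "X (Suc n) \<in> borel_measurable M" by (rule X_measurable) simp
    have "{\<omega> \<in> surv (Suc n). X (Suc n) \<omega> \<le> R} = {\<omega> \<in> space M. \<omega> \<in> surv (Suc n) \<and> X (Suc n) \<omega> \<le> R}"
      by (auto simp: surv_def)
    also have "\<dots> \<in> sets M" by measurable
    finally have [measurable]: "{\<omega> \<in> surv (Suc n). X (Suc n) \<omega> \<le> R} \<in> sets M" .
    have "surv (Suc n) \<subseteq> exc_above R \<union> {\<omega> \<in> surv (Suc n). X (Suc n) \<omega> \<le> R}"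
    proof
      fix \<omega> assume s: "\<omega> \<in> surv (Suc n)"
      show "\<omega> \<in> exc_above R \<union> {\<omega> \<in> surv (Suc n). X (Suc n) \<omega> \<le> R}"
      proof (cases "R \<le> X (Suc n) \<omega>")
        case True
        then have "\<omega> \<in> exc_above R" unfolding exc_above_def using s by (intro UN_I[of "Suc n"]) auto
        then show ?thesis by simp
      qed (use s in auto)
    qed
    then have "prob (surv (Suc n)) \<le> prob (exc_above R \<union> {\<omega> \<in> surv (Suc n). X (Suc n) \<omega> \<le> R})"
      by (intro finite_measure_mono) auto
    also have "\<dots> \<le> prob (exc_above R) + prob {\<omega> \<in> surv (Suc n). X (Suc n) \<omega> \<le> R}"
      by (rule measure_Un_le) auto
    finally show ?thesis using R n0[OF that] by simp
  qed
  then have "norm (prob (surv n) - 0) < \<epsilon>" if "Suc n0 \<le> n" for n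
    using that by (cases n) auto
  then show "\<exists>no. \<forall>n\<ge>no. norm (prob (surv n) - 0) < \<epsilon>" by blast
qed

end

section \<open>Lower tail bound\<close>

lemma exc_time_1_iff:
  assumes "1 \<le> t"
  shows "enat t < exc_time X 1 \<omega> \<longleftrightarrow> (\<forall>s\<in>{2..t}. X s \<omega> \<noteq> 0)"
proof (cases "\<exists>s>1. X s \<omega> = 0")
  case True
  define L where "L = (LEAST s. 1 < s \<and> X s \<omega> = 0)"
  have L: "1 < L" "X L \<omega> = 0" "\<And>s. 1 < s \<Longrightarrow> X s \<omega> = 0 \<Longrightarrow> L \<le> s"
    using LeastI_ex[of "\<lambda>s. 1 < s \<and> X s \<omega> = 0"] True
    by (auto simp: L_def intro!: Least_le)
  have "exc_time X 1 \<omega> = enat L" using True by (auto simp: L_def)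
  moreover have "t < L \<longleftrightarrow> (\<forall>s\<in>{2..t}. X s \<omega> \<noteq> 0)"
  proof
    show "\<forall>s\<in>{2..t}. X s \<omega> \<noteq> 0" if "t < L"
    proof
      fix s assume "s \<in> {2..t}"
      then show "X s \<omega> \<noteq> 0" using L(3)[of s] that by auto
    qed
    show "t < L" if "\<forall>s\<in>{2..t}. X s \<omega> \<noteq> 0"
      using that L(1,2) by (metis Suc_1 Suc_leI atLeastAtMost_iff not_le)
  qed
  ultimately show ?thesis by simp
next
  case False
  then have "exc_time X 1 \<omega> = \<infinity>" by auto
  moreover have "X s \<omega> \<noteq> 0" if "s \<in> {2..t}" for s
    using False that by auto
  ultimately show ?thesis by simp
qed

lemma exc_time_Suc_eq_enat:
  "exc_time X (Suc n) \<omega> = enat t \<longleftrightarrow>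
     (\<exists>s<t. exc_time X n \<omega> = enat s \<and> X t \<omega> = 0 \<and> (\<forall>u\<in>{s<..<t}. X u \<omega> \<noteq> 0))"
proof (cases "exc_time X n \<omega>")
  case (enat s)
  show ?thesis
  proof (cases "\<exists>t>s. X t \<omega> = 0")
    case True
    define L where "L = (LEAST t. s < t \<and> X t \<omega> = 0)"
    have L: "s < L" "X L \<omega> = 0" "\<And>t. s < t \<Longrightarrow> X t \<omega> = 0 \<Longrightarrow> L \<le> t"
      using LeastI_ex[of "\<lambda>t. s < t \<and> X t \<omega> = 0"] True
      by (auto simp: L_def intro!: Least_le)
    have "exc_time X (Suc n) \<omega> = enat L" using True enat by (auto simp: L_def)
    moreover have "L = t \<longleftrightarrow> s < t \<and> X t \<omega> = 0 \<and> (\<forall>u\<in>{s<..<t}. X u \<omega> \<noteq> 0)"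
    proof
      assume "s < t \<and> X t \<omega> = 0 \<and> (\<forall>u\<in>{s<..<t}. X u \<omega> \<noteq> 0)"
      then have "L \<le> t" "\<not> L < t" using L by auto
      then show "L = t" by simp
    next
      assume "L = t"
      then show "s < t \<and> X t \<omega> = 0 \<and> (\<forall>u\<in>{s<..<t}. X u \<omega> \<noteq> 0)"
        using L by (metis greaterThanLessThan_iff leD)
    qed
    ultimately show ?thesis using enat by auto
  next
    case False
    then show ?thesis using enat by auto
  qed
qed auto

lemma exc_time_gt: "enat n < exc_time X n \<omega>"
proof (induction n)
  case (Suc n)
  show ?case
  proof (cases "exc_time X (Suc n) \<omega>")
    case (enat t)
    then obtain s where "s < t" "exc_time X n \<omega> = enat s" by (auto simp only: exc_time_Suc_eq_enat)
    then show ?thesis using Suc enat by simp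
  qed simp
qed (simp add: zero_enat_def)

lemma exc_time_finite_Suc: "exc_time X (Suc n) \<omega> \<noteq> \<infinity> \<Longrightarrow> exc_time X n \<omega> \<noteq> \<infinity>"
  by (cases "exc_time X n \<omega>") auto

lemma mem_excursion:
  assumes fin: "\<And>n. exc_time X n \<omega> \<noteq> \<infinity>" and t: "1 \<le> t"
  shows "\<exists>n\<ge>1. X t \<omega> \<in> set (excursion X n \<omega>)"
proof -
  define P where "P n \<longleftrightarrow> exc_time X n \<omega> \<le> enat t" for n
  have "P 0" using t by (simp add: P_def one_enat_def)
  moreover have "n < t" if "P n" for n
    using exc_time_gt[of n X \<omega>] that unfolding P_def by (metis enat_ord_simps(2) less_le_trans)
  then have "\<forall>n. P n \<longrightarrow> n \<le> t" by (simp add: less_imp_le)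
  ultimately obtain n where n: "P n" "\<And>k. P k \<Longrightarrow> k \<le> n"
    using GreatestI_nat[of P 0 t] Greatest_le_nat[of P _ t] by metis
  then have "\<not> P (Suc n)" by force
  moreover obtain a b where "exc_time X n \<omega> = enat a" "exc_time X (Suc n) \<omega> = enat b"
    using fin by (metis not_infinity_eq)
  ultimately have "a \<le> t" "t < b" "excursion X (Suc n) \<omega> = map (\<lambda>t. X t \<omega>) [a..<b]"
    using n unfolding P_def excursion_def by (auto simp del: exc_time.simps)
  then have "X t \<omega> \<in> set (excursion X (Suc n) \<omega>)" by auto
  then show ?thesis by (intro exI[of _ "Suc n"]) auto
qed

lemma powlog_at_top: "0 < a \<Longrightarrow> filterlim (powlog a g) at_top at_top"
  unfolding powlog_def by real_asymp

context lamperti_process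
begin

lemma exc_above_witness:
  assumes "0 < prob (exc_above y)"
  obtains t where "1 \<le> t" "0 < prob {\<omega> \<in> surv t. y \<le> X t \<omega>}"
proof -
  have "\<exists>t\<ge>1. 0 < prob {\<omega> \<in> surv t. y \<le> X t \<omega>}"
  proof (rule ccontr)
    assume "\<not> ?thesis"
    then have z: "prob {\<omega> \<in> surv t. y \<le> X t \<omega>} = 0" if "1 \<le> t" for t
      using that by (meson measure_nonneg order_le_less not_less)
    have "(\<Union>t\<in>{1..}. {\<omega> \<in> surv t. y \<le> X t \<omega>}) \<in> null_sets M"
    proof (rule null_sets_UN')
      fix t :: nat assume "t \<in> {1..}"
      then show "{\<omega> \<in> surv t. y \<le> X t \<omega>} \<in> null_sets M"
        using z[of t] survX_meas[of t y] by (auto simp: null_sets_def emeasure_eq_measure)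
    qed simp
    then have "prob (exc_above y) = 0" unfolding exc_above_def by (rule measure_eq_0_null_sets)
    then show False using assms by simp
  qed
  then show thesis using that by blast
qed

lemma exc_above_lower_bound:
  assumes g: "0 < g" and pos: "\<And>y. 0 < prob (exc_above y)"
  obtains \<kappa> R0 where "0 < \<kappa>" "\<And>R. R0 \<le> R \<Longrightarrow> \<kappa> \<le> powlog a g (2 * R) * prob (exc_above R)"
proof -
  obtain A0 e where A0: "3 \<le> A0" and e: "0 < e" and
    mono: "\<And>x y. A0 \<le> x \<Longrightarrow> x \<le> y \<Longrightarrow> powlog a g x \<le> powlog a g y" and
    dd: "\<And>A R. A0 \<le> A \<Longrightarrow> drift_dominated c s2 p \<delta> C e {A..R} (\<lambda>z. - powlog a g (max A (min z (2 * R))))"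
    by (rule powlog_sub[OF a_pos s2_pos c_eq p_gt2 \<delta>_pos C_nonneg g]) blast
  obtain x0 where
    x0: "\<And>t. 1 \<le> t \<Longrightarrow> AE \<omega> in M. x0 \<le> X t \<omega> \<longrightarrow>
              \<bar>real_cond_exp M (F t) (\<lambda>\<omega>'. X (Suc t) \<omega>' - X t \<omega>') \<omega> - c / X t \<omega>\<bar>
                \<le> e / (X t \<omega> * ln (X t \<omega>))"
    "\<And>t. 1 \<le> t \<Longrightarrow> AE \<omega> in M. x0 \<le> X t \<omega> \<longrightarrow>
              \<bar>real_cond_exp M (F t) (\<lambda>\<omega>'. (X (Suc t) \<omega>' - X t \<omega>')\<^sup>2) \<omega> - s2\<bar>
                \<le> e / ln (X t \<omega>)"
    by (rule A2_threshold[OF e]) blast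
  define A where "A = max A0 x0"
  have A: "A0 \<le> A" "x0 \<le> A" "3 \<le> A" using A0 by (auto simp: A_def)
  have "eventually (\<lambda>y. powlog a g A + 1 \<le> powlog a g y \<and> A \<le> y) at_top"
    using powlog_at_top[OF a_pos, of g] by (intro eventually_conj eventually_ge_at_top) (simp add: filterlim_at_top)
  then obtain y0 where y0: "powlog a g A + 1 \<le> powlog a g y0" "A \<le> y0"
    by (auto simp: eventually_at_top_linorder)
  obtain t0 where t0: "1 \<le> t0" "0 < prob {\<omega> \<in> surv t0. y0 \<le> X t0 \<omega>}"
    using exc_above_witness[OF pos] by blast
  define k0 where "k0 = t0 - 1"
  have t0k: "t0 = Suc k0" using t0 by (simp add: k0_def)
  define \<kappa> where "\<kappa> = prob {\<omega> \<in> surv t0. y0 \<le> X t0 \<omega>}"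
  have main: "\<kappa> \<le> powlog a g (2 * R) * prob (exc_above R)" if R: "y0 \<le> R" for R
  proof -
    define h where "h z = powlog a g (max A (min z (2 * R))) - powlog a g A" for z
    have [measurable]: "h \<in> borel_measurable borel" unfolding h_def by measurable
    have h0: "0 \<le> h z" for z using mono[of A "max A (min z (2 * R))"] A by (simp add: h_def)
    have h_le: "h z \<le> powlog a g (2 * R)" for z
    proof -
      have "A0 \<le> max A (min z (2 * R))" "max A (min z (2 * R)) \<le> 2 * R" using A y0 R by auto
      then show ?thesis using mono powlog_nonneg[of a g A] by (fastforce simp: h_def)
    qed
    have h_A: "h z = 0" if "z \<le> A" for z using that y0 R A by (simp add: h_def min_def)
    have h_y0: "1 \<le> h z" if "y0 \<le> z" for z
      using mono[of y0 "max A (min z (2 * R))"] A y0 R that by (simp add: h_def)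
    let ?inc = "\<lambda>k \<omega>. h (X (Suc (Suc k)) \<omega>) - h (X (Suc k) \<omega>)"
    have intB: "integrable M (\<lambda>\<omega>. indicator B \<omega> * ?inc k \<omega>)" if "B \<in> sets M" for B k
    proof (rule integrable_const_bound[of _ "powlog a g (2 * R)"])
      have [measurable]: "X (Suc (Suc k)) \<in> borel_measurable M" "X (Suc k) \<in> borel_measurable M"
        by (rule X_measurable, simp)+
      note [measurable] = that
      show "(\<lambda>\<omega>. indicator B \<omega> * ?inc k \<omega>) \<in> borel_measurable M" by measurable
      have "\<bar>?inc k \<omega>\<bar> \<le> powlog a g (2 * R)" for \<omega>
        using h0[of "X (Suc (Suc k)) \<omega>"] h0[of "X (Suc k) \<omega>"] h_le[of "X (Suc (Suc k)) \<omega>"] h_le[of "X (Suc k) \<omega>"]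
        by linarith
      then show "AE \<omega> in M. norm (indicator B \<omega> * ?inc k \<omega>) \<le> powlog a g (2 * R)"
        by (intro AE_I2) (auto simp: indicator_def powlog_nonneg)
    qed
    have step: "0 \<le> (\<integral>\<omega>. indicator (alive R (Suc k)) \<omega> * ?inc k \<omega> \<partial>M)" for k
    proof -
      let ?B1 = "{\<omega> \<in> alive R (Suc k). A \<le> X (Suc k) \<omega>}"
      let ?B2 = "{\<omega> \<in> alive R (Suc k). X (Suc k) \<omega> < A}"
      have s: "1 \<le> Suc k" by simp
      have i1: "integrable M (\<lambda>\<omega>. indicator ?B1 \<omega> * ?inc k \<omega>)" by (rule intB[OF F_sets[OF s alive_lower_F]])
      have i2: "integrable M (\<lambda>\<omega>. indicator ?B2 \<omega> * ?inc k \<omega>)" by (rule intB[OF F_sets[OF s alive_upper_F]])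
      let ?g = "\<lambda>z. - powlog a g (max A (min z (2 * R)))"
      have eq: "indicator ?B1 \<omega> * (?g (X (Suc (Suc k)) \<omega>) - ?g (X (Suc k) \<omega>)) = - (indicator ?B1 \<omega> * ?inc k \<omega>)" for \<omega>
        by (simp add: h_def algebra_simps)
      have "(\<integral>\<omega>. indicator ?B1 \<omega> * (?g (X (Suc (Suc k)) \<omega>) - ?g (X (Suc k) \<omega>)) \<partial>M) \<le> 0"
      proof (rule expected_increment_nonpos[OF s alive_lower_F _ dd[OF A(1), of R]])
        show "AE \<omega> in M. X (Suc k) \<omega> \<in> {A..R} \<longrightarrow> \<bar>real_cond_exp M (F (Suc k)) (\<lambda>\<omega>'. X (Suc (Suc k)) \<omega>' - X (Suc k) \<omega>') \<omega> - c / X (Suc k) \<omega>\<bar>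
                \<le> e / (X (Suc k) \<omega> * ln (X (Suc k) \<omega>))"
          using x0(1)[OF s] by eventually_elim (use A in auto)
        show "AE \<omega> in M. X (Suc k) \<omega> \<in> {A..R} \<longrightarrow> \<bar>real_cond_exp M (F (Suc k)) (\<lambda>\<omega>'. (X (Suc (Suc k)) \<omega>' - X (Suc k) \<omega>')\<^sup>2) \<omega> - s2\<bar>
                \<le> e / ln (X (Suc k) \<omega>)"
          using x0(2)[OF s] by eventually_elim (use A in auto)
        show "integrable M (\<lambda>\<omega>. indicator ?B1 \<omega> * (?g (X (Suc (Suc k)) \<omega>) - ?g (X (Suc k) \<omega>)))"
          unfolding eq using i1 by (rule Bochner_Integration.integrable_minus)
      qed (use alive_below in auto)
      then have b1: "0 \<le> (\<integral>\<omega>. indicator ?B1 \<omega> * ?inc k \<omega> \<partial>M)"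
        unfolding eq by (simp only: integral_minus neg_le_0_iff_le)
      have b2: "0 \<le> (\<integral>\<omega>. indicator ?B2 \<omega> * ?inc k \<omega> \<partial>M)"
        by (intro integral_nonneg_AE AE_I2) (auto simp: indicator_def h_A h0)
      have "(\<integral>\<omega>. indicator (alive R (Suc k)) \<omega> * ?inc k \<omega> \<partial>M)
         = (\<integral>\<omega>. indicator ?B1 \<omega> * ?inc k \<omega> + indicator ?B2 \<omega> * ?inc k \<omega> \<partial>M)"
        by (intro Bochner_Integration.integral_cong) (auto simp: indicator_def)
      also have "\<dots> = (\<integral>\<omega>. indicator ?B1 \<omega> * ?inc k \<omega> \<partial>M) + (\<integral>\<omega>. indicator ?B2 \<omega> * ?inc k \<omega> \<partial>M)"
        by (rule Bochner_Integration.integral_add[OF i1 i2])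
      finally show ?thesis using b1 b2 by simp
    qed
    note st = expectation_stopped_Suc[where h = h and R = R, OF \<open>h \<in> borel_measurable borel\<close> intB[OF alive_Suc_meas]]
    have [measurable]: "{\<omega> \<in> surv t0. y0 \<le> X t0 \<omega>} \<in> sets M" by (rule survX_meas[OF t0(1)])
    have "\<kappa> = (\<integral>\<omega>. indicator {\<omega> \<in> surv t0. y0 \<le> X t0 \<omega>} \<omega> \<partial>M)"
      by (simp add: \<kappa>_def)
    also have "\<dots> \<le> (\<integral>\<omega>. h (stopped R k0 \<omega>) \<partial>M)"
    proof (rule integral_mono)
      show "integrable M (indicat_real {\<omega> \<in> surv t0. y0 \<le> X t0 \<omega>})"
        by (intro integrable_const_bound[of _ 1]) auto
      show "integrable M (\<lambda>\<omega>. h (stopped R k0 \<omega>))" by (rule st(1))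
      fix \<omega>
      have "y0 \<le> stopped R k0 \<omega>" if "\<omega> \<in> surv t0" "y0 \<le> X t0 \<omega>"
      proof (cases "\<omega> \<in> peak R t0")
        case True
        then show ?thesis using stopped_peak[of \<omega> R k0] R by (simp add: t0k)
      next
        case False
        then have "\<omega> \<in> alive R (Suc k0)" using alive_not_peak[of \<omega> t0 R] that t0k by simp
        then show ?thesis using stopped_alive that by (simp add: t0k)
      qed
      then show "indicat_real {\<omega> \<in> surv t0. y0 \<le> X t0 \<omega>} \<omega> \<le> h (stopped R k0 \<omega>)"
        using h_y0 h0 by (auto simp: indicator_def)
    qed
    finally have k0: "\<kappa> \<le> (\<integral>\<omega>. h (stopped R k0 \<omega>) \<partial>M)" .
    have grow: "\<kappa> \<le> (\<integral>\<omega>. h (stopped R k \<omega>) \<partial>M)" if "k0 \<le> k" for k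
      using that
    proof (induction rule: dec_induct)
      case (step k)
      then show ?case using \<open>\<And>k. 0 \<le> (\<integral>\<omega>. indicator (alive R (Suc k)) \<omega> * ?inc k \<omega> \<partial>M)\<close>[of k] st(2)[of k] by linarith
    qed (rule k0)
    have upper: "(\<integral>\<omega>. h (stopped R k \<omega>) \<partial>M) \<le> powlog a g (2 * R) * (prob (exc_above R) + prob (surv (Suc k)))" for k
    proof -
      have "(\<integral>\<omega>. h (stopped R k \<omega>) \<partial>M)
         \<le> (\<integral>\<omega>. powlog a g (2 * R) * (indicator (peak R (Suc k)) \<omega> + indicator (surv (Suc k)) \<omega>) \<partial>M)"
      proof (rule integral_mono)
        show "integrable M (\<lambda>\<omega>. h (stopped R k \<omega>))" by (rule st(1))
        show "integrable M (\<lambda>\<omega>. powlog a g (2 * R) * (indicator (peak R (Suc k)) \<omega> + indicator (surv (Suc k)) \<omega>))"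
          by (intro integrable_mult_right Bochner_Integration.integrable_add integrable_const_bound[of _ 1]) auto
        fix \<omega> assume "\<omega> \<in> space M"
        then show "h (stopped R k \<omega>) \<le> powlog a g (2 * R) * (indicator (peak R (Suc k)) \<omega> + indicator (surv (Suc k)) \<omega>)"
          using stopped_cases[of \<omega> R k] alive_subset_surv[of R "Suc k"] h_le[of "stopped R k \<omega>"] h_A[of 0] A
            powlog_nonneg[of a g "2 * R"]
          by (auto simp: indicator_def)
      qed
      also have "\<dots> = powlog a g (2 * R) * (prob (peak R (Suc k)) + prob (surv (Suc k)))"
        by (simp add: integrable_const_bound[of _ 1])
      also have "\<dots> \<le> powlog a g (2 * R) * (prob (exc_above R) + prob (surv (Suc k)))"
        by (intro mult_left_mono add_mono peak_le_exc_above powlog_nonneg) auto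
      finally show ?thesis .
    qed
    have "(\<lambda>k. powlog a g (2 * R) * (prob (exc_above R) + prob (surv (Suc k)))) \<longlonglongrightarrow> powlog a g (2 * R) * (prob (exc_above R) + 0)"
      by (intro tendsto_intros LIMSEQ_Suc surv_tendsto_0)
    then have "\<kappa> \<le> powlog a g (2 * R) * (prob (exc_above R) + 0)"
      by (rule LIMSEQ_le_const) (use grow upper in \<open>auto intro!: exI[of _ k0] intro: order_trans\<close>)
    then show ?thesis by simp
  qed
  show thesis by (rule that[of \<kappa> y0]) (use main t0 in \<open>auto simp: \<kappa>_def\<close>)
qed

end

section \<open>Moments and the first excursion\<close>

lemma dyadic_level:
  fixes z :: real
  assumes "2 ^ n0 \<le> z"
  obtains k where "2 ^ (k + n0) \<le> z" "z < 2 ^ (Suc (k + n0))"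
proof -
  obtain m where m: "z < 2 ^ m" using real_arch_pow[of 2 z] by auto
  define L where "L = (LEAST m. z < 2 ^ m)"
  have L: "z < 2 ^ L" "\<And>m. z < 2 ^ m \<Longrightarrow> L \<le> m"
    using m by (auto simp: L_def intro: LeastI Least_le)
  have "n0 < L"
  proof (rule ccontr)
    assume "\<not> n0 < L"
    then have "(2::real) ^ L \<le> 2 ^ n0" by (intro power_increasing) auto
    then show False using L(1) assms by linarith
  qed
  then obtain j where j: "L = Suc (j + n0)" by (metis add.commute add_Suc_right less_imp_Suc_add)
  have "2 ^ (j + n0) \<le> z" using L(2)[of "j + n0"] j not_less_eq_eq by (meson dual_order.refl not_le)
  then show thesis using that[of j] L(1) j by simp
qed

lemma (in prob_space) moment_finite_of_tail:
  assumes [measurable]: "Z \<in> borel_measurable M" and Z: "\<And>\<omega>. \<omega> \<in> space M \<Longrightarrow> 0 \<le> Z \<omega>"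
    and q: "0 < q" "q < \<rho>"
    and tail: "eventually (\<lambda>x. prob {\<omega> \<in> space M. x \<le> Z \<omega>} \<le> x powr (-\<rho>)) at_top"
  shows "(\<integral>\<^sup>+\<omega>. ennreal (Z \<omega> powr q) \<partial>M) < \<infinity>"
proof -
  obtain x0 where x0: "\<And>x. x \<ge> x0 \<Longrightarrow> prob {\<omega> \<in> space M. x \<le> Z \<omega>} \<le> x powr (-\<rho>)"
    using tail by (auto simp: eventually_at_top_linorder)
  obtain n0 where n0: "x0 < 2 ^ n0" using real_arch_pow[of 2 x0] by auto
  define T where "T k = {\<omega> \<in> space M. 2 ^ (k + n0) \<le> Z \<omega>}" for k
  have [measurable]: "T k \<in> sets M" for k unfolding T_def by measurable
  define w :: "nat \<Rightarrow> real" where "w k = (2 ^ Suc (k + n0)) powr q" for k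
  have pt: "ennreal (Z \<omega> powr q) \<le> ennreal ((2 ^ n0) powr q) + (\<Sum>k. ennreal (w k) * indicator (T k) \<omega>)"
    if "\<omega> \<in> space M" for \<omega>
  proof (cases "2 ^ n0 \<le> Z \<omega>")
    case True
    then obtain k where k: "2 ^ (k + n0) \<le> Z \<omega>" "Z \<omega> < 2 ^ (Suc (k + n0))" by (rule dyadic_level)
    have "Z \<omega> powr q \<le> w k" unfolding w_def using k q Z[OF that] by (intro powr_mono2) auto
    then have "ennreal (Z \<omega> powr q) \<le> (\<Sum>j\<in>{k}. ennreal (w j) * indicator (T j) \<omega>)"
      using k that by (simp add: T_def ennreal_leI)
    also have "\<dots> \<le> (\<Sum>k. ennreal (w k) * indicator (T k) \<omega>)"
      by (intro sum_le_suminf summableI) auto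
    finally show ?thesis by (simp add: add_increasing)
  next
    case False
    then have "Z \<omega> powr q \<le> (2 ^ n0) powr q" using q Z[OF that] by (intro powr_mono2) auto
    then have "ennreal (Z \<omega> powr q) \<le> ennreal ((2 ^ n0) powr q)" by (rule ennreal_leI)
    then show ?thesis by (rule order_trans) (simp add: add_increasing2)
  qed
  define f where "f k = 2 powr q * (2 powr (q - \<rho>)) ^ (k + n0)" for k :: nat
  have wk: "w k * prob (T k) \<le> f k" for k
  proof -
    have "2 ^ (k + n0) \<ge> x0" using n0 power_increasing[of n0 "k + n0" "2::real"] by linarith
    then have "prob (T k) \<le> (2 ^ (k + n0)) powr (-\<rho>)" using x0 by (simp add: T_def)
    then have "w k * prob (T k) \<le> w k * (2 ^ (k + n0)) powr (-\<rho>)"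
      by (intro mult_left_mono) (auto simp: w_def)
    also have "\<dots> = f k"
      unfolding w_def f_def
      by (simp add: powr_realpow[symmetric] powr_powr powr_mult powr_add powr_diff powr_minus field_simps)
    finally show ?thesis .
  qed
  have sumf: "summable f"
  proof -
    have "norm (2 powr (q - \<rho>)) < 1" using q powr_less_mono[of "q - \<rho>" 0 2] by simp
    then have "summable (\<lambda>k. (2 powr q * (2 powr (q - \<rho>)) ^ n0) * (2 powr (q - \<rho>)) ^ k)"
      by (intro summable_mult summable_geometric)
    then show ?thesis unfolding f_def by (simp add: power_add mult_ac)
  qed
  have "(\<integral>\<^sup>+\<omega>. ennreal (Z \<omega> powr q) \<partial>M)
      \<le> (\<integral>\<^sup>+\<omega>. ennreal ((2 ^ n0) powr q) + (\<Sum>k. ennreal (w k) * indicator (T k) \<omega>) \<partial>M)"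
    using pt by (intro nn_integral_mono) auto
  also have "\<dots> = ennreal ((2 ^ n0) powr q) + (\<Sum>k. \<integral>\<^sup>+\<omega>. ennreal (w k) * indicator (T k) \<omega> \<partial>M)"
    by (subst nn_integral_add; simp add: nn_integral_suminf emeasure_space_1)
  also have "(\<Sum>k. \<integral>\<^sup>+\<omega>. ennreal (w k) * indicator (T k) \<omega> \<partial>M) = (\<Sum>k. ennreal (w k * prob (T k)))"
    by (simp add: nn_integral_cmult emeasure_eq_measure ennreal_mult w_def)
  also have "\<dots> \<le> (\<Sum>k. ennreal (f k))"
    by (intro suminf_le summableI ennreal_leI wk)
  also have "\<dots> = ennreal (\<Sum>k. f k)"
    by (rule suminf_ennreal2[OF _ sumf]) (simp add: f_def)
  finally have "(\<integral>\<^sup>+\<omega>. ennreal (Z \<omega> powr q) \<partial>M) \<le> ennreal ((2 ^ n0) powr q) + ennreal (\<Sum>k. f k)"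
    by (simp add: add_left_mono)
  also have "\<dots> < \<infinity>" by simp
  finally show ?thesis .
qed

lemma (in prob_space) moment_infinite_of_tail:
  assumes [measurable]: "Z \<in> borel_measurable M" and Z: "\<And>\<omega>. \<omega> \<in> space M \<Longrightarrow> 0 \<le> Z \<omega>"
    and q: "0 < q"
    and tail: "eventually (\<lambda>x. x powr (-q) * ln x powr (-1) \<le> prob {\<omega> \<in> space M. x \<le> Z \<omega>}) at_top"
  shows "(\<integral>\<^sup>+\<omega>. ennreal (Z \<omega> powr q) \<partial>M) = \<infinity>"
proof (rule ccontr)
  assume "(\<integral>\<^sup>+\<omega>. ennreal (Z \<omega> powr q) \<partial>M) \<noteq> \<infinity>"
  then have int: "integrable M (\<lambda>\<omega>. Z \<omega> powr q)"
    by (intro integrableI_nonneg) (auto simp: less_top)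
  define T where "T k = {\<omega> \<in> space M. 2 ^ k \<le> Z \<omega>}" for k :: nat
  have [measurable]: "T k \<in> sets M" for k unfolding T_def by measurable
  define b where "b = (2::real) powr q"
  have b: "b > 1" using q powr_less_mono[of 0 q 2] by (simp add: b_def)
  have bk: "b ^ k = (2 ^ k) powr q" for k
    by (simp add: b_def powr_realpow[symmetric] powr_powr mult.commute)
  have pt: "(\<Sum>k<n. b ^ k * indicator (T k) \<omega>) \<le> b / (b - 1) * Z \<omega> powr q" if om: "\<omega> \<in> space M" for n \<omega>
  proof (induction n)
    case 0
    show ?case using b by simp
  next
    case (Suc n)
    show ?case
    proof (cases "\<omega> \<in> T n")
      case True
      have "(\<Sum>k<Suc n. b ^ k * indicator (T k) \<omega>) \<le> (\<Sum>k<Suc n. b ^ k)"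
        using b by (intro sum_mono) (auto simp: indicator_def)
      also have "\<dots> = (b ^ Suc n - 1) / (b - 1)" using b by (subst geometric_sum) auto
      also have "\<dots> \<le> b / (b - 1) * b ^ n" using b by (simp add: divide_right_mono)
      also have "\<dots> \<le> b / (b - 1) * Z \<omega> powr q"
        unfolding bk using True b q by (intro mult_left_mono powr_mono2) (auto simp: T_def)
      finally show ?thesis .
    next
      case False
      then show ?thesis using Suc by simp
    qed
  qed
  have part: "(\<Sum>k<n. b ^ k * prob (T k)) \<le> b / (b - 1) * (\<integral>\<omega>. Z \<omega> powr q \<partial>M)" for n
  proof -
    have i: "integrable M (\<lambda>\<omega>. b ^ k * indicat_real (T k) \<omega>)" for k
      by (intro integrable_mult_right integrable_const_bound[of _ 1]) auto
    have "(\<Sum>k<n. b ^ k * prob (T k)) = (\<Sum>k<n. \<integral>\<omega>. b ^ k * indicat_real (T k) \<omega> \<partial>M)" by simp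
    also have "\<dots> = (\<integral>\<omega>. (\<Sum>k<n. b ^ k * indicat_real (T k) \<omega>) \<partial>M)"
      by (rule Bochner_Integration.integral_sum[symmetric]) (rule i)
    also have "\<dots> \<le> (\<integral>\<omega>. b / (b - 1) * Z \<omega> powr q \<partial>M)"
      by (intro integral_mono Bochner_Integration.integrable_sum i integrable_mult_right int pt)
    finally show ?thesis by simp
  qed
  have sm: "summable (\<lambda>k. b ^ k * prob (T k))"
    by (rule summableI_nonneg_bounded[OF _ part]) (use b in auto)
  obtain x0 where x0: "\<And>x. x \<ge> x0 \<Longrightarrow> x powr (-q) * ln x powr (-1) \<le> prob {\<omega> \<in> space M. x \<le> Z \<omega>}"
    using tail by (auto simp: eventually_at_top_linorder)
  obtain n0 where n0: "x0 < 2 ^ n0" using real_arch_pow[of 2 x0] by auto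
  have "summable (\<lambda>k. 1 / (real k * ln 2))"
  proof (rule summable_comparison_test'[OF sm, of "max 1 n0"])
    fix k assume k: "max 1 n0 \<le> k"
    then have "(2::real) ^ n0 \<le> 2 ^ k" by (intro power_increasing) auto
    then have "2 ^ k \<ge> x0" using n0 by linarith
    then have "(2 ^ k) powr (-q) * ln (2 ^ k) powr (-1) \<le> prob (T k)" unfolding T_def by (rule x0)
    then have "b ^ k * ((2 ^ k) powr (-q) * ln (2 ^ k) powr (-1)) \<le> b ^ k * prob (T k)"
      using b by (intro mult_left_mono) auto
    also have "b ^ k * ((2 ^ k) powr (-q) * ln (2 ^ k) powr (-1)) = 1 / (real k * ln 2)"
      unfolding bk using k by (simp add: powr_minus_divide ln_realpow)
    finally show "norm (1 / (real k * ln 2)) \<le> b ^ k * prob (T k)" by simp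
  qed
  then have "summable (\<lambda>k. ln 2 * (1 / (real k * ln 2)))" by (rule summable_mult)
  then show False using not_summable_harmonic[where 'a = real] by (simp add: inverse_eq_divide)
qed

context lamperti_process
begin

lemma exc_time_meas [measurable]: "{\<omega> \<in> space M. exc_time X n \<omega> = enat t} \<in> sets M"
proof (induction n arbitrary: t)
  case 0
  show ?case by simp
next
  case (Suc n)
  have "{\<omega> \<in> space M. exc_time X (Suc n) \<omega> = enat t} =
    (\<Union>s\<in>{1..<t}. {\<omega> \<in> space M. exc_time X n \<omega> = enat s} \<inter> {\<omega> \<in> space M. X t \<omega> = 0}
       \<inter> {\<omega> \<in> space M. \<forall>u\<in>{s<..<t}. X u \<omega> \<noteq> 0})" (is "?L = ?R")
  proof (intro equalityI subsetI)
    fix \<omega> assume "\<omega> \<in> ?L"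
    then have om: "\<omega> \<in> space M" and "exc_time X (Suc n) \<omega> = enat t" by auto
    then obtain s where s: "s < t" "exc_time X n \<omega> = enat s" "X t \<omega> = 0" "\<forall>u\<in>{s<..<t}. X u \<omega> \<noteq> 0"
      by (auto simp only: exc_time_Suc_eq_enat)
    then have "1 \<le> s" using exc_time_gt[of n X \<omega>] by auto
    then show "\<omega> \<in> ?R" using s om by auto
  next
    fix \<omega> assume "\<omega> \<in> ?R"
    then show "\<omega> \<in> ?L" unfolding mem_Collect_eq exc_time_Suc_eq_enat by auto
  qed
  also have "\<dots> \<in> sets M"
  proof (intro sets.finite_UN sets.Int Suc sets.sets_Collect_finite_All)
    fix s assume "s \<in> {1..<t}"
    then have [measurable]: "X t \<in> borel_measurable M" by (intro X_measurable) auto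
    show "{\<omega> \<in> space M. X t \<omega> = 0} \<in> sets M" by measurable
    fix u assume "u \<in> {s<..<t}"
    then have [measurable]: "X u \<in> borel_measurable M" by (intro X_measurable) auto
    show "{\<omega> \<in> space M. X u \<omega> \<noteq> 0} \<in> sets M" by measurable
  qed auto
  finally show ?case .
qed

lemma exc_time_finite_meas [measurable]: "{\<omega> \<in> space M. exc_time X n \<omega> < \<infinity>} \<in> sets M"
proof -
  have "{\<omega> \<in> space M. exc_time X n \<omega> < \<infinity>} = (\<Union>t. {\<omega> \<in> space M. exc_time X n \<omega> = enat t})"
    by (auto simp: less_infinityE)
  also have "\<dots> \<in> sets M" by measurable
  finally show ?thesis .
qed

lemma AE_exc_time_1_finite: "AE \<omega> in M. exc_time X 1 \<omega> < \<infinity>"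
proof -
  have le: "prob (\<Inter>t. surv t) \<le> prob (surv t)" for t
    by (rule finite_measure_mono) auto
  have "prob (\<Inter>t. surv t) \<le> 0"
    using LIMSEQ_le_const[OF surv_tendsto_0, of "prob (\<Inter>t. surv t)"] le by blast
  then have "prob (\<Inter>t. surv t) = 0" by (simp add: antisym)
  then have "(\<Inter>t. surv t) \<in> null_sets M"
    by (intro null_setsI) (auto simp: emeasure_eq_measure)
  then show ?thesis
  proof (rule AE_I')
    show "{\<omega> \<in> space M. \<not> exc_time X 1 \<omega> < \<infinity>} \<subseteq> (\<Inter>t. surv t)"
    proof safe
      fix \<omega> t assume *: "\<omega> \<in> space M" "\<not> exc_time X 1 \<omega> < \<infinity>"
      have "\<forall>s\<in>{2..Suc t}. X s \<omega> \<noteq> 0"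
        using exc_time_1_iff[of "Suc t" X \<omega>] *(2) by (simp del: exc_time.simps)
      then show "\<omega> \<in> surv t" using * by (auto simp: surv_def)
    qed
  qed
qed

lemma prob_exc_time_finite:
  assumes A3b: "\<forall>n\<ge>1. measure M {\<omega> \<in> space M. exc_time X n \<omega> < \<infinity>} > 0 \<longrightarrow>
              measure M {\<omega> \<in> space M. exc_len X (Suc n) \<omega> < \<infinity> \<and> exc_time X n \<omega> < \<infinity>}
                / measure M {\<omega> \<in> space M. exc_time X n \<omega> < \<infinity>}
              = measure M {\<omega> \<in> space M. exc_len X 1 \<omega> < \<infinity>}"
  shows "prob {\<omega> \<in> space M. exc_time X n \<omega> < \<infinity>} = 1"
proof -
  have one: "prob {\<omega> \<in> space M. exc_time X 1 \<omega> < \<infinity>} = 1"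
    using AE_exc_time_1_finite by (subst prob_Collect_eq_1) auto
  have len1: "exc_len X 1 \<omega> < \<infinity> \<longleftrightarrow> exc_time X 1 \<omega> < \<infinity>" for \<omega>
    unfolding exc_len_def by (cases "exc_time X 1 \<omega>") (auto simp del: exc_time.simps(2))
  have len: "exc_len X (Suc n) \<omega> < \<infinity> \<and> exc_time X n \<omega> < \<infinity> \<longleftrightarrow> exc_time X (Suc n) \<omega> < \<infinity>" for n \<omega>
    using exc_time_finite_Suc[of X n \<omega>] unfolding exc_len_def
    by (cases "exc_time X (Suc n) \<omega>"; cases "exc_time X n \<omega>") (auto simp del: exc_time.simps(2))
  have "prob {\<omega> \<in> space M. exc_time X (Suc n) \<omega> < \<infinity>} = 1" for n
  proof (induction n)
    case 0
    then show ?case using one by simp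
  next
    case (Suc n)
    have pos: "prob {\<omega> \<in> space M. exc_time X (Suc n) \<omega> < \<infinity>} > 0" unfolding Suc by simp
    have "prob {\<omega> \<in> space M. exc_len X (Suc (Suc n)) \<omega> < \<infinity> \<and> exc_time X (Suc n) \<omega> < \<infinity>}
        / prob {\<omega> \<in> space M. exc_time X (Suc n) \<omega> < \<infinity>} = prob {\<omega> \<in> space M. exc_len X 1 \<omega> < \<infinity>}"
      by (rule A3b[rule_format, OF _ pos]) simp
    then show ?case unfolding len len1 one Suc by (simp only: div_by_1)
  qed
  then show ?thesis by (cases n) (auto simp: prob_space simp del: exc_time.simps(2))
qed

lemma exc_above_pos:
  assumes S_unbdd: "\<not> bounded S"
    and A3a: "measure M {\<omega> \<in> space M. num_exc X \<omega> = \<infinity>} > 0 \<longrightarrow>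
              (let Q = uniform_measure M {\<omega> \<in> space M. num_exc X \<omega> = \<infinity>} in
                 prob_space.indep_vars Q (\<lambda>_. count_space UNIV) (\<lambda>n. excursion X n) {1..} \<and>
                 (\<forall>n\<ge>1. distr Q (count_space UNIV) (excursion X n)
                          = distr Q (count_space UNIV) (excursion X 1)))"
    and A3b: "\<forall>n\<ge>1. measure M {\<omega> \<in> space M. exc_time X n \<omega> < \<infinity>} > 0 \<longrightarrow>
              measure M {\<omega> \<in> space M. exc_len X (Suc n) \<omega> < \<infinity> \<and> exc_time X n \<omega> < \<infinity>}
                / measure M {\<omega> \<in> space M. exc_time X n \<omega> < \<infinity>}
              = measure M {\<omega> \<in> space M. exc_len X 1 \<omega> < \<infinity>}"
  shows "0 < prob (exc_above y)"
proof (rule ccontr)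
  assume "\<not> ?thesis"
  then have zero: "exc_above y \<in> null_sets M"
    using measure_nonneg[of M "exc_above y"] by (intro null_setsI) (auto simp: emeasure_eq_measure)
  have fin: "AE \<omega> in M. exc_time X n \<omega> < \<infinity>" for n
    using prob_exc_time_finite[OF A3b, of n] by (subst (asm) prob_Collect_eq_1) auto
  then have fin_all: "AE \<omega> in M. \<forall>n. exc_time X n \<omega> < \<infinity>" by (simp add: AE_all_countable)
  define G where "G = {\<omega> \<in> space M. num_exc X \<omega> = \<infinity>}"
  have G_eq: "G = {\<omega> \<in> space M. \<forall>n. exc_time X n \<omega> < \<infinity>}"
    by (auto simp: G_def num_exc_def)
  have G [measurable]: "G \<in> sets M" unfolding G_eq
    by (intro sets.sets_Collect_countable_All exc_time_finite_meas)
  have G1: "prob G = 1" using fin_all by (subst prob_eq_1) (auto simp: G_eq)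
  define Q where "Q = uniform_measure M G"
  have Qprob: "prob_space Q" unfolding Q_def using G1
    by (intro prob_space_uniform_measure) (auto simp: emeasure_eq_measure)
  have Q: "prob_space.indep_vars Q (\<lambda>_. count_space UNIV) (\<lambda>n. excursion X n) {1..}"
    "\<And>n. n \<ge> 1 \<Longrightarrow> distr Q (count_space UNIV) (excursion X n) = distr Q (count_space UNIV) (excursion X 1)"
  proof -
    have "0 < prob G" using G1 by simp
    note A3a[folded G_def, unfolded Let_def, folded Q_def, rule_format, OF this]
    then show "prob_space.indep_vars Q (\<lambda>_. count_space UNIV) (\<lambda>n. excursion X n) {1..}"
      "\<And>n. n \<ge> 1 \<Longrightarrow> distr Q (count_space UNIV) (excursion X n) = distr Q (count_space UNIV) (excursion X 1)"
      by blast+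
  qed
  have rv: "excursion X n \<in> measurable Q (count_space UNIV)" if "n \<ge> 1" for n
    using Q(1) that unfolding prob_space.indep_vars_def[OF Qprob] by auto
  define BB where "BB = {xs :: real list. \<exists>x\<in>set xs. y \<le> x}"
  define EB where "EB n = excursion X n -` BB \<inter> space M" for n
  have sQ: "space Q = space M" "sets Q = sets M" by (auto simp: Q_def)
  have EBm [measurable]: "EB n \<in> sets M" if "n \<ge> 1" for n
    using measurable_sets[OF rv[OF that], of BB] by (simp add: EB_def sQ)
  have EBQ: "emeasure Q (EB n) = emeasure Q (EB 1)" if "n \<ge> 1" for n
    using arg_cong[OF Q(2)[OF that], of "\<lambda>D. emeasure D BB"] rv[OF that] rv[of 1]
    by (simp add: emeasure_distr EB_def sQ)
  have Qe: "emeasure Q B = emeasure M B" if [measurable]: "B \<in> sets M" for B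
  proof -
    have "emeasure Q B = emeasure M (G \<inter> B) / emeasure M G"
      unfolding Q_def by (rule emeasure_uniform_measure) auto
    also have "\<dots> = emeasure M (G \<inter> B)" unfolding emeasure_eq_measure G1 by (subst divide_ennreal) auto
    also have "\<dots> = emeasure M B"
      using fin_all by (intro emeasure_eq_AE) (auto simp: G_eq elim!: eventually_mono dest: sets.sets_into_space)
    finally show ?thesis .
  qed
  have "EB 1 \<subseteq> exc_above y"
  proof
    fix \<omega> assume "\<omega> \<in> EB 1"
    then have om: "\<omega> \<in> space M" and "\<exists>x\<in>set (excursion X 1 \<omega>). y \<le> x" by (auto simp: EB_def BB_def)
    then obtain x where x: "x \<in> set (excursion X 1 \<omega>)" "y \<le> x" by blast
    show "\<omega> \<in> exc_above y"
    proof (cases "exc_time X 1 \<omega>")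
      case (enat b)
      then have "excursion X 1 \<omega> = map (\<lambda>t. X t \<omega>) [1..<b]"
        by (simp add: excursion_def del: exc_time.simps(2))
      then obtain t where t: "1 \<le> t" "t < b" "x = X t \<omega>" using x by auto
      then have "\<forall>s\<in>{2..t}. X s \<omega> \<noteq> 0" using exc_time_1_iff[of t X \<omega>] enat by simp
      then show ?thesis using t x om by (auto simp: exc_above_def surv_def)
    next
      case infinity
      then show ?thesis using x by (simp add: excursion_def del: exc_time.simps(2))
    qed
  qed
  then have "EB 1 \<in> null_sets M" using null_sets_subset[OF zero EBm[of 1]] by simp
  then have EB0: "EB n \<in> null_sets M" if "n \<ge> 1" for n
    using EBQ[OF that] EBm[OF that] EBm[of 1] by (auto simp: null_sets_def Qe)
  have "AE \<omega> in M. \<forall>n\<in>{1..}. \<omega> \<notin> EB n"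
    by (subst AE_ball_countable) (auto intro!: AE_not_in EB0)
  with fin_all AE_space have below: "AE \<omega> in M. \<forall>t\<ge>1. X t \<omega> < y"
  proof eventually_elim
    case (elim \<omega>)
    show ?case
    proof (intro allI impI)
      fix t :: nat assume t: "1 \<le> t"
      have "\<omega> \<in> space M" using elim by simp
      obtain n where "n \<ge> 1" "X t \<omega> \<in> set (excursion X n \<omega>)"
        using mem_excursion[of X \<omega> t] elim t by auto
      then show "X t \<omega> < y" using elim \<open>\<omega> \<in> space M\<close> by (force simp: EB_def BB_def)
    qed
  qed
  obtain m :: "real \<Rightarrow> real \<Rightarrow> nat" and \<phi> :: "real \<Rightarrow> real \<Rightarrow> real" where
    \<phi>: "\<And>x y. x \<in> S \<Longrightarrow> y \<in> S \<Longrightarrow> 0 < \<phi> x y"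
    and hit_meas: "\<And>y t. y \<in> S \<Longrightarrow> 1 \<le> t \<Longrightarrow> {\<omega> \<in> space M. X (t + m (X t \<omega>) y) \<omega> = y} \<in> sets M"
    and hit: "\<And>y t B \<phi>0. y \<in> S \<Longrightarrow> 1 \<le> t \<Longrightarrow> B \<in> sets (F t) \<Longrightarrow> (\<And>\<omega>. \<omega> \<in> B \<Longrightarrow> \<phi>0 \<le> \<phi> (X t \<omega>) y) \<Longrightarrow>
       \<phi>0 * prob B \<le> prob (B \<inter> {\<omega> \<in> space M. X (t + m (X t \<omega>) y) \<omega> = y})"
    by (rule irreducible) blast
  obtain y' where y': "y' \<in> S" "y \<le> y'"
  proof -
    have "\<not> S \<subseteq> {0..y}" using S_unbdd bounded_subset[of "{0..y}" S] by auto
    then show thesis using S_nonneg that by force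
  qed
  define B where "B = {\<omega> \<in> space M. X 1 \<omega> = 0}"
  have B: "B \<in> sets (F 1)"
  proof -
    have [measurable]: "X 1 \<in> borel_measurable (F 1)" using X_adapted by simp
    have "B = {\<omega> \<in> space (F 1). X 1 \<omega> = 0}" by (simp add: B_def space_F)
    also have "\<dots> \<in> sets (F 1)" by measurable
    finally show ?thesis .
  qed
  have "prob B = 1" unfolding B_def using X_start
    by (subst prob_Collect_eq_1) (use F_sets[OF _ B] in \<open>auto simp: B_def\<close>)
  moreover have "\<phi> 0 y' * prob B \<le> prob (B \<inter> {\<omega> \<in> space M. X (1 + m (X 1 \<omega>) y') \<omega> = y'})"
    by (rule hit[OF y'(1) _ B]) (auto simp: B_def)
  moreover have "prob (B \<inter> {\<omega> \<in> space M. X (1 + m (X 1 \<omega>) y') \<omega> = y'}) = 0"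
  proof -
    have "AE \<omega> in M. \<omega> \<notin> B \<inter> {\<omega> \<in> space M. X (1 + m (X 1 \<omega>) y') \<omega> = y'}"
      using below
    proof eventually_elim
      case (elim \<omega>)
      then have "X (1 + m (X 1 \<omega>) y') \<omega> < y" by simp
      then show ?case using y' by auto
    qed
    then show ?thesis
      by (subst (asm) AE_iff_null_sets[symmetric]) (use hit_meas[OF y'(1), of 1] F_sets[OF _ B] in \<open>auto simp: measure_eq_0_null_sets\<close>)
  qed
  ultimately show False using \<phi>[OF S_zero y'(1)] by simp
qed

lemma mem_surv_iff: "\<omega> \<in> space M \<Longrightarrow> 1 \<le> t \<Longrightarrow> enat t < exc_time X 1 \<omega> \<longleftrightarrow> \<omega> \<in> surv t"
  using exc_time_1_iff[of t X \<omega>] by (auto simp: surv_def simp del: exc_time.simps)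

lemma first_exc_max_eq:
  assumes om: "\<omega> \<in> space M"
  shows "first_exc_max X \<omega> = (SUP t\<in>{1..}. if \<omega> \<in> surv t then ereal (X t \<omega>) else 0)"
  unfolding first_exc_max_def
proof (rule antisym)
  show "(SUP t\<in>{t. 1 \<le> t \<and> enat t < exc_time X 1 \<omega>}. ereal (X t \<omega>))
      \<le> (SUP t\<in>{1..}. if \<omega> \<in> surv t then ereal (X t \<omega>) else 0)"
  proof (rule SUP_least)
    fix t assume "t \<in> {t. 1 \<le> t \<and> enat t < exc_time X 1 \<omega>}"
    then show "ereal (X t \<omega>) \<le> (SUP t\<in>{1..}. if \<omega> \<in> surv t then ereal (X t \<omega>) else 0)"
      using mem_surv_iff[OF om, of t] by (intro SUP_upper2[of t]) auto
  qed
  have s1: "\<omega> \<in> surv 1" using om by (auto simp: surv_def)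
  show "(SUP t\<in>{1..}. if \<omega> \<in> surv t then ereal (X t \<omega>) else 0)
      \<le> (SUP t\<in>{t. 1 \<le> t \<and> enat t < exc_time X 1 \<omega>}. ereal (X t \<omega>))"
  proof (rule SUP_least)
    fix t :: nat assume t: "t \<in> {1..}"
    show "(if \<omega> \<in> surv t then ereal (X t \<omega>) else 0) \<le> (SUP t\<in>{t. 1 \<le> t \<and> enat t < exc_time X 1 \<omega>}. ereal (X t \<omega>))"
    proof (cases "\<omega> \<in> surv t")
      case True
      then show ?thesis using t mem_surv_iff[OF om, of t] by (intro SUP_upper2[of t]) auto
    next
      case False
      then show ?thesis using s1 mem_surv_iff[OF om, of 1] X_nonneg[OF _ om, of 1]
        by (intro SUP_upper2[of 1]) (auto simp: zero_ereal_def)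
    qed
  qed
qed

lemma first_exc_max_measurable [measurable]: "first_exc_max X \<in> borel_measurable M"
proof -
  have "(\<lambda>\<omega>. SUP t\<in>{1..}. if \<omega> \<in> surv t then ereal (X t \<omega>) else 0) \<in> borel_measurable M"
  proof (rule borel_measurable_SUP)
    fix t :: nat assume "t \<in> {1..}"
    then have [measurable]: "X t \<in> borel_measurable M" by (intro X_measurable) auto
    show "(\<lambda>\<omega>. if \<omega> \<in> surv t then ereal (X t \<omega>) else 0) \<in> borel_measurable M" by measurable
  qed simp
  then show ?thesis by (subst measurable_cong[OF first_exc_max_eq])
qed

lemma first_exc_max_nonneg:
  assumes om: "\<omega> \<in> space M"
  shows "0 \<le> first_exc_max X \<omega>"
  unfolding first_exc_max_eq[OF om]
  by (rule SUP_upper2[of 1]) (use X_nonneg[OF _ om, of 1] in auto)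

lemma first_exc_max_finite:
  assumes om: "\<omega> \<in> space M" and fin: "exc_time X 1 \<omega> < \<infinity>"
  obtains z where "z \<in> S" "first_exc_max X \<omega> = ereal z" "\<And>x. x \<le> z \<longleftrightarrow> \<omega> \<in> exc_above x"
proof -
  obtain b where b: "exc_time X 1 \<omega> = enat b" using fin by (auto simp del: exc_time.simps)
  have b1: "1 < b" using exc_time_gt[of 1 X \<omega>] b by (simp del: exc_time.simps)
  define T where "T = (\<lambda>t. X t \<omega>) ` {1..<b}"
  have T: "finite T" "T \<noteq> {}" using b1 by (auto simp: T_def)
  have Teq: "{t. 1 \<le> t \<and> enat t < exc_time X 1 \<omega>} = {1..<b}" using b by (auto simp del: exc_time.simps)
  obtain t where t: "t \<in> {1..<b}" "Max T = X t \<omega>" using Max_in[OF T] by (auto simp: T_def)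
  show thesis
  proof (rule that[of "Max T"])
    show "Max T \<in> S" using t X_in_S[OF _ om, of t] by simp
    show "first_exc_max X \<omega> = ereal (Max T)"
      unfolding first_exc_max_def Teq
    proof (rule antisym)
      show "(SUP t\<in>{1..<b}. ereal (X t \<omega>)) \<le> ereal (Max T)"
        using T by (intro SUP_least) (auto simp: T_def)
      show "ereal (Max T) \<le> (SUP t\<in>{1..<b}. ereal (X t \<omega>))"
        using t by (intro SUP_upper2[of t]) auto
    qed
    fix x
    have "x \<le> Max T \<longleftrightarrow> (\<exists>t\<in>{1..<b}. x \<le> X t \<omega>)" using T by (subst Max_ge_iff) (auto simp: T_def)
    also have "\<dots> \<longleftrightarrow> (\<exists>t\<ge>1. \<omega> \<in> surv t \<and> x \<le> X t \<omega>)"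
    proof -
      have "t < b \<longleftrightarrow> \<omega> \<in> surv t" if "1 \<le> t" for t
        using mem_surv_iff[OF om that] b by (simp del: exc_time.simps)
      then show ?thesis by (metis atLeastLessThan_iff)
    qed
    also have "\<dots> \<longleftrightarrow> \<omega> \<in> exc_above x" by (auto simp: exc_above_def)
    finally show "x \<le> Max T \<longleftrightarrow> \<omega> \<in> exc_above x" .
  qed
qed

lemma prob_first_exc_max_ge:
  "prob {\<omega> \<in> space M. ereal x \<le> first_exc_max X \<omega>} = prob (exc_above x)"
proof (rule finite_measure_eq_AE)
  show "AE \<omega> in M. \<omega> \<in> {\<omega> \<in> space M. ereal x \<le> first_exc_max X \<omega>} \<longleftrightarrow> \<omega> \<in> exc_above x"
    using AE_exc_time_1_finite AE_space
  proof eventually_elim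
    case (elim \<omega>)
    then obtain z where "first_exc_max X \<omega> = ereal z" "\<And>x. x \<le> z \<longleftrightarrow> \<omega> \<in> exc_above x"
      using first_exc_max_finite by blast
    then show ?case using elim by simp
  qed
qed measurable

lemma prob_real_first_exc_max_ge:
  "prob {\<omega> \<in> space M. x \<le> real_of_ereal (first_exc_max X \<omega>)} = prob (exc_above x)"
proof (rule finite_measure_eq_AE)
  show "AE \<omega> in M. \<omega> \<in> {\<omega> \<in> space M. x \<le> real_of_ereal (first_exc_max X \<omega>)} \<longleftrightarrow> \<omega> \<in> exc_above x"
    using AE_exc_time_1_finite AE_space
  proof eventually_elim
    case (elim \<omega>)
    then obtain z where "first_exc_max X \<omega> = ereal z" "\<And>x. x \<le> z \<longleftrightarrow> \<omega> \<in> exc_above x"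
      using first_exc_max_finite by blast
    then show ?case using elim by simp
  qed
qed measurable

lemma nonpos_moment_finite:
  assumes q: "q \<le> 0"
  shows "(\<integral>\<^sup>+\<omega>. ennreal (real_of_ereal (first_exc_max X \<omega>) powr q) \<partial>M) < \<infinity>"
proof -
  define s0 where "s0 = Min (insert 1 ({0<..1} \<inter> S))"
  have f: "finite (insert 1 ({0<..1} \<inter> S))" using S_locfin[of "{0<..1}"] by simp
  have s0: "0 < s0" using f unfolding s0_def by (subst Min_gr_iff) auto
  have s0_le: "s0 \<le> z" if "z \<in> S" "0 < z" for z
  proof (cases "z \<le> 1")
    case True
    then show ?thesis unfolding s0_def using f that by (intro Min_le) auto
  next
    case False
    have "s0 \<le> 1" unfolding s0_def using f by (intro Min_le) auto
    then show ?thesis using False by simp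
  qed
  have "(\<integral>\<^sup>+\<omega>. ennreal (real_of_ereal (first_exc_max X \<omega>) powr q) \<partial>M) \<le> (\<integral>\<^sup>+\<omega>. ennreal (s0 powr q) \<partial>M)"
  proof (rule nn_integral_mono_AE)
    show "AE \<omega> in M. ennreal (real_of_ereal (first_exc_max X \<omega>) powr q) \<le> ennreal (s0 powr q)"
      using AE_exc_time_1_finite AE_space
    proof eventually_elim
      case (elim \<omega>)
      then obtain z where z: "z \<in> S" "first_exc_max X \<omega> = ereal z" using first_exc_max_finite by blast
      have "z powr q \<le> s0 powr q"
      proof (cases "z = 0")
        case False
        then have "0 < z" using z S_nonneg by force
        then show ?thesis using s0_le[OF z(1)] s0 q by (intro powr_mono2') auto
      qed simp
      then show ?case using z by (simp add: ennreal_leI)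
    qed
  qed
  also have "\<dots> < \<infinity>" by (simp add: emeasure_space_1)
  finally show ?thesis .
qed

end

theorem theorem2p3:
  fixes M :: "'a measure"
    and F :: "nat \<Rightarrow> 'a measure"
    and X :: "nat \<Rightarrow> 'a \<Rightarrow> real"
    and S :: "real set"
    and c s2 r p :: real
  assumes prob: "prob_space M"
    \<comment> \<open>(A0): the state space\<close>
    and S_nonneg: "S \<subseteq> {0..}"
    and S_zero: "0 \<in> S"
    and S_locfin: "\<And>B. bounded B \<Longrightarrow> finite (B \<inter> S)"
    and S_unbdd: "\<not> bounded S"
    \<comment> \<open>(A0): filtration indexed by t = 1,2,..., adapted S-valued process, X_1 = 0 a.s.\<close>
    and F_sub: "\<And>t. 1 \<le> t \<Longrightarrow> subalgebra M (F t)"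
    and F_mono: "\<And>s t. 1 \<le> s \<Longrightarrow> s \<le> t \<Longrightarrow> sets (F s) \<subseteq> sets (F t)"
    and X_adapted: "\<And>t. 1 \<le> t \<Longrightarrow> X t \<in> borel_measurable (F t)"
    and X_in_S: "\<And>t \<omega>. 1 \<le> t \<Longrightarrow> \<omega> \<in> space M \<Longrightarrow> X t \<omega> \<in> S"
    and X_start: "measure M {\<omega> \<in> space M. X 1 \<omega> = 0} = 1"
    \<comment> \<open>(A1): irreducibility\<close>
    and A1: "\<exists>(m :: real \<Rightarrow> real \<Rightarrow> nat) (\<phi> :: real \<Rightarrow> real \<Rightarrow> real).
              (\<forall>x\<in>S. \<forall>y\<in>S. 1 \<le> m x y \<and> 0 < \<phi> x y) \<and>
              (\<forall>y\<in>S. \<forall>t\<ge>1. AE \<omega> in M.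
                 real_cond_exp M (F t)
                   (indicator {\<omega>' \<in> space M. X (t + m (X t \<omega>') y) \<omega>' = y}) \<omega>
                 \<ge> \<phi> (X t \<omega>) y)"
    \<comment> \<open>(A2): Lamperti-type asymptotic drift and second moment, uniform error terms\<close>
    and s2_pos: "0 < s2"
    and A2_drift: "\<forall>e>0. \<exists>x0. \<forall>t\<ge>1. AE \<omega> in M. x0 \<le> X t \<omega> \<longrightarrow>
              \<bar>real_cond_exp M (F t) (\<lambda>\<omega>'. X (Suc t) \<omega>' - X t \<omega>') \<omega> - c / X t \<omega>\<bar>
                \<le> e / (X t \<omega> * ln (X t \<omega>))"
    and A2_var: "\<forall>e>0. \<exists>x0. \<forall>t\<ge>1. AE \<omega> in M. x0 \<le> X t \<omega> \<longrightarrow>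
              \<bar>real_cond_exp M (F t) (\<lambda>\<omega>'. (X (Suc t) \<omega>' - X t \<omega>')\<^sup>2) \<omega> - s2\<bar>
                \<le> e / ln (X t \<omega>)"
    and r_def: "r = - 2 * c / s2"
    \<comment> \<open>(A3): excursion structure\<close>
    and A3a: "measure M {\<omega> \<in> space M. num_exc X \<omega> = \<infinity>} > 0 \<longrightarrow>
              (let Q = uniform_measure M {\<omega> \<in> space M. num_exc X \<omega> = \<infinity>} in
                 prob_space.indep_vars Q (\<lambda>_. count_space UNIV) (\<lambda>n. excursion X n) {1..} \<and>
                 (\<forall>n\<ge>1. distr Q (count_space UNIV) (excursion X n)
                          = distr Q (count_space UNIV) (excursion X 1)))"
    and A3b: "\<forall>n\<ge>1. measure M {\<omega> \<in> space M. exc_time X n \<omega> < \<infinity>} > 0 \<longrightarrow>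
              measure M {\<omega> \<in> space M. exc_len X (Suc n) \<omega> < \<infinity> \<and> exc_time X n \<omega> < \<infinity>}
                / measure M {\<omega> \<in> space M. exc_time X n \<omega> < \<infinity>}
              = measure M {\<omega> \<in> space M. exc_len X 1 \<omega> < \<infinity>}"
    \<comment> \<open>hypotheses of the theorem\<close>
    and r_gt: "r > -1"
    and p_gt: "p > max 2 (1 + r)"
    and Mp: "\<exists>\<delta>>0. \<exists>C. \<forall>t\<ge>1. AE \<omega> in M.
              nn_cond_exp M (F t) (\<lambda>\<omega>'. ennreal (\<bar>X (Suc t) \<omega>' - X t \<omega>'\<bar> powr p)) \<omega>
                \<le> ennreal (C * (1 + X t \<omega>) powr (p - 2 - \<delta>))"
  shows "(\<forall>\<epsilon>>0. eventually (\<lambda>x.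
             x powr (-1 - r) * ln x powr (-\<epsilon>)
               \<le> measure M {\<omega> \<in> space M. first_exc_max X \<omega> \<ge> ereal x} \<and>
             measure M {\<omega> \<in> space M. first_exc_max X \<omega> \<ge> ereal x}
               \<le> x powr (-1 - r) * ln x powr (1 + \<epsilon>)) at_top)
       \<and> (\<integral>\<^sup>+\<omega>. ennreal (real_of_ereal (first_exc_max X \<omega>) powr (1 + r)) \<partial>M) = \<infinity>
       \<and> (\<forall>\<epsilon>>0. (\<integral>\<^sup>+\<omega>. ennreal (real_of_ereal (first_exc_max X \<omega>) powr (1 + r - \<epsilon>)) \<partial>M) < \<infinity>)"
proof -
  interpret P: prob_space M by (rule prob)
  obtain \<delta> C0 where \<delta>: "0 < \<delta>" and C0: "\<forall>t\<ge>1. AE \<omega> in M.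
              nn_cond_exp M (F t) (\<lambda>\<omega>'. ennreal (\<bar>X (Suc t) \<omega>' - X t \<omega>'\<bar> powr p)) \<omega>
                \<le> ennreal (C0 * (1 + X t \<omega>) powr (p - 2 - \<delta>))"
    using Mp by blast
  define C where "C = max 0 C0"
  define a where "a = 1 + r"
  have X1_meas: "X 1 \<in> borel_measurable M"
    using X_adapted[of 1] F_sub[of 1] measurable_from_subalg by blast
  interpret L: lamperti_process M F X S a c s2 p \<delta> C
  proof unfold_locales
    show "AE \<omega> in M. X 1 \<omega> = 0"
      using X_start X1_meas by (subst (asm) P.prob_Collect_eq_1) auto
    show "0 < a" "a \<le> p" "2 < p" "0 \<le> C" using r_gt p_gt by (auto simp: a_def C_def)
    show "c = - (a - 1) * s2 / 2" using r_def s2_pos by (simp add: a_def)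
    fix t :: nat assume t: "1 \<le> t"
    show "AE \<omega> in M.
              nn_cond_exp M (F t) (\<lambda>\<omega>'. ennreal (\<bar>X (Suc t) \<omega>' - X t \<omega>'\<bar> powr p)) \<omega>
                \<le> ennreal (C * (1 + X t \<omega>) powr (p - 2 - \<delta>))"
      using C0[rule_format, OF t]
    proof eventually_elim
      case (elim \<omega>)
      have "C0 * (1 + X t \<omega>) powr (p - 2 - \<delta>) \<le> C * (1 + X t \<omega>) powr (p - 2 - \<delta>)"
        by (intro mult_right_mono) (auto simp: C_def)
      then show ?case using elim by (meson ennreal_leI order_trans)
    qed
  qed (use S_nonneg S_zero S_locfin F_sub F_mono X_adapted X_in_S A1 s2_pos A2_drift A2_var \<delta> in auto)
  have pos: "0 < P.prob (L.exc_above y)" for y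
    by (rule L.exc_above_pos[OF S_unbdd A3a A3b])
  have a: "0 < a" using r_gt by (simp add: a_def)
  have upper: "eventually (\<lambda>x. P.prob (L.exc_above x) \<le> x powr (-a) * ln x powr (1 + \<epsilon>)) at_top" if "0 < \<epsilon>" for \<epsilon>
  proof -
    obtain K R0 where K: "\<And>R. R0 \<le> R \<Longrightarrow> powlog a (-1) R * P.prob (L.exc_above R) \<le> K"
      by (rule L.exc_above_upper_bound) blast
    have "eventually (\<lambda>x. K \<le> ln x powr \<epsilon>) at_top" using that by real_asymp
    with eventually_ge_at_top[of R0] eventually_gt_at_top[of 1]
    show ?thesis
    proof eventually_elim
      case (elim x)
      have x: "0 < ln x" "0 < x" using elim by auto
      have "P.prob (L.exc_above x) = x powr (-a) * ln x * (powlog a (-1) x * P.prob (L.exc_above x))"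
        using x by (simp add: powlog_def powr_minus field_simps)
      also have "\<dots> \<le> x powr (-a) * ln x * ln x powr \<epsilon>"
        using K[OF elim(1)] elim x by (intro mult_left_mono) auto
      also have "\<dots> = x powr (-a) * ln x powr (1 + \<epsilon>)" using x by (simp add: powr_add)
      finally show ?case .
    qed
  qed
  have lower: "eventually (\<lambda>x. x powr (-a) * ln x powr (-\<epsilon>) \<le> P.prob (L.exc_above x)) at_top" if "0 < \<epsilon>" for \<epsilon>
  proof -
    have "0 < \<epsilon> / 2" using that by simp
    from L.exc_above_lower_bound[OF this pos] obtain \<kappa> R0 where \<kappa>: "0 < \<kappa>"
      "\<And>R. R0 \<le> R \<Longrightarrow> \<kappa> \<le> powlog a (\<epsilon> / 2) (2 * R) * P.prob (L.exc_above R)" by blast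
    have "((\<lambda>x. powlog a (\<epsilon> / 2) (2 * x) * (x powr (-a) * ln x powr (-\<epsilon>))) \<longlongrightarrow> 0) at_top"
      unfolding powlog_def using that a by real_asymp
    then have "eventually (\<lambda>x. powlog a (\<epsilon> / 2) (2 * x) * (x powr (-a) * ln x powr (-\<epsilon>)) < \<kappa>) at_top"
      using \<kappa>(1) by (rule order_tendstoD(2))
    with eventually_ge_at_top[of R0] eventually_gt_at_top[of 1]
    show ?thesis
    proof eventually_elim
      case (elim x)
      have pl: "0 < powlog a (\<epsilon> / 2) (2 * x)" using elim by (simp add: powlog_def)
      have "powlog a (\<epsilon> / 2) (2 * x) * (x powr (-a) * ln x powr (-\<epsilon>))
          \<le> powlog a (\<epsilon> / 2) (2 * x) * P.prob (L.exc_above x)"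
        using \<kappa>(2)[OF elim(1)] elim(3) by linarith
      then show ?case using pl by (simp only: mult_le_cancel_left_pos)
    qed
  qed
  let ?Z = "\<lambda>\<omega>. real_of_ereal (first_exc_max X \<omega>)"
  have Zm: "?Z \<in> borel_measurable M" by measurable
  have Z0: "0 \<le> ?Z \<omega>" if "\<omega> \<in> space M" for \<omega>
    using L.first_exc_max_nonneg[OF that] by (rule real_of_ereal_pos)
  have "(\<integral>\<^sup>+\<omega>. ennreal (?Z \<omega> powr a) \<partial>M) = \<infinity>"
    by (rule P.moment_infinite_of_tail[OF Zm Z0 a]) (use lower[of 1] L.prob_real_first_exc_max_ge in auto)
  moreover have "(\<integral>\<^sup>+\<omega>. ennreal (?Z \<omega> powr (a - \<epsilon>)) \<partial>M) < \<infinity>" if \<epsilon>: "0 < \<epsilon>" for \<epsilon>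
  proof (cases "a - \<epsilon> \<le> 0")
    case True
    then show ?thesis by (rule L.nonpos_moment_finite)
  next
    case False
    show ?thesis
    proof (rule P.moment_finite_of_tail[OF Zm Z0, of _ "a - \<epsilon> / 2"])
      have "eventually (\<lambda>x. x powr (-a) * ln x powr (1 + 1) \<le> x powr (- (a - \<epsilon> / 2))) at_top"
        using \<epsilon> by real_asymp
      then show "eventually (\<lambda>x. P.prob {\<omega> \<in> space M. x \<le> ?Z \<omega>} \<le> x powr (- (a - \<epsilon> / 2))) at_top"
        using upper[of 1] unfolding L.prob_real_first_exc_max_ge
        by (auto elim: eventually_elim2 intro: order_trans)
    qed (use False \<epsilon> in auto)
  qed
  moreover have "eventually (\<lambda>x.
             x powr (-1 - r) * ln x powr (-\<epsilon>)
               \<le> measure M {\<omega> \<in> space M. first_exc_max X \<omega> \<ge> ereal x} \<and>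
             measure M {\<omega> \<in> space M. first_exc_max X \<omega> \<ge> ereal x}
               \<le> x powr (-1 - r) * ln x powr (1 + \<epsilon>)) at_top" if "0 < \<epsilon>" for \<epsilon>
    using eventually_conj[OF lower[OF that] upper[OF that]]
    unfolding L.prob_first_exc_max_ge by (simp add: a_def)
  ultimately show ?thesis by (simp add: a_def)
qed

end
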